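(* Let $d,N\geq 1$ be integers, $\boldsymbol{x}=(x_1,\dots,x_d)$ coordinates on $(\mathbb{C}^d,\boldsymbol{0})$ and $\boldsymbol{y}=(y_1,\dots,y_N)\in\mathbb{C}^N$. Let $P\in\mathbb{C}\{\boldsymbol{x}\}\setminus\{0\}$ with $P(\boldsymbol{0})=0$, let $L=a_1(\boldsymbol{x})\partial_{x_1}+\cdots+a_d(\boldsymbol{x})\partial_{x_d}$ with $a_1,\dots,a_d\in\mathbb{C}\{\boldsymbol{x}\}$ not all identically zero, and let $F$ be a $\mathbb{C}^N$-valued holomorphic map defined near $(\boldsymbol{0},\boldsymbol{0})\in\mathbb{C}^d\times\mathbb{C}^N$. Assume that $F(\boldsymbol{0},\boldsymbol{0})=\boldsymbol{0}$ and that $\mu:=\frac{\partial F}{\partial\boldsymbol{y}}(\boldsymbol{0},\boldsymbol{0})$ is an invertible matrix. If $P$ divides $L(P)$ in $\mathbb{C}\{\boldsymbol{x}\}$, then the system of partial differential equations $$P(\boldsymbol{x})\,L(\boldsymbol{y})(\boldsymbol{x})=F(\boldsymbol{x},\boldsymbol{y})$$ has a unique formal power series solution $\widehat{\boldsymbol{y}}\in\mathbb{C}[[\boldsymbol{x}]]^N$ with $\widehat{\boldsymbol{y}}(\boldsymbol{0})=\boldsymbol{0}$. Moreover, $\widehat{\boldsymbol{y}}$ is a $P$-$1$--Gevrey series.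
   Context: $\mathbb{C}\{\boldsymbol{x}\}$ and $\mathbb{C}[[\boldsymbol{x}]]$ denote the rings of convergent and formal power series in $\boldsymbol{x}=(x_1,\dots,x_d)$ with complex coefficients. The operator $L$ acts on vectors componentwise. For $\boldsymbol{r}=(r_1,\dots,r_d)$ with all $r_j>0$, let $D_{\boldsymbol{r}}=\{\boldsymbol{x}\in\mathbb{C}^d: |x_j|<r_j,\ j=1,\dots,d\}$ and let $\mathcal{O}_b(D_{\boldsymbol{r}})$ be the set of bounded holomorphic $\mathbb{C}$-valued functions on $D_{\boldsymbol{r}}$. For $P\in\mathbb{C}\{\boldsymbol{x}\}\setminus\{0\}$ with $P(\boldsymbol{0})=0$ and $s\geq 0$, a series $\hat f\in\mathbb{C}[[\boldsymbol{x}]]$ is called a $P$-$s$--Gevrey series if there are a polyradius $\boldsymbol{r}$, constants $C,A>0$ and a sequence $(f_n)_{n\geq 0}$ in $\mathcal{O}_b(D_{\boldsymbol{r}})$ such that $\hat f=\sum_{n=0}^\infty f_nP^n$ (as formal power series, each $f_n$ and $P$ being identified with its Taylor series at the origin) and $\sup_{\boldsymbol{x}\in D_{\boldsymbol{r}}}|f_n(\boldsymbol{x})|\leq CA^n\, n!^s$ for all $n\geq 0$. A vector of formal power series is $P$-$s$--Gevrey if each of its components is. *)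

theory Defs
  imports "HOL-Analysis.Analysis" "HOL-Library.Function_Algebras"
begin

text \<open>
  Formal power series over the complex numbers in the variables indexed by a finite type
  \<open>'d\<close>. A multi-index is a function \<open>'d \<Rightarrow> nat\<close>; addition and zero of multi-indices are the
  pointwise ones of \<^theory>\<open>HOL-Library.Function_Algebras\<close>, so \<open>mcoeff f 0\<close> is the constant
  term \<open>f(0)\<close>.
\<close>

typedef 'd mfps = "UNIV :: (('d \<Rightarrow> nat) \<Rightarrow> complex) set"
  morphisms mcoeff Abs_mfps ..

setup_lifting type_definition_mfps

lemma mfps_eqI: "(\<And>\<gamma>. mcoeff f \<gamma> = mcoeff g \<gamma>) \<Longrightarrow> f = g"
  by transfer auto

lemma finite_midx_antidiag: "finite {(\<alpha>, \<beta>). \<alpha> + \<beta> = (\<gamma> :: 'd::finite \<Rightarrow> nat)}"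
proof -
  let ?B = "PiE (UNIV :: 'd set) (\<lambda>i. {..\<gamma> i})"
  have "finite ?B"
    by (rule finite_PiE) auto
  moreover have "{(\<alpha>, \<beta>). \<alpha> + \<beta> = \<gamma>} \<subseteq> ?B \<times> ?B"
    by (auto simp: PiE_def extensional_def)
  ultimately show ?thesis
    by (meson finite_SigmaI finite_subset)
qed

instantiation mfps :: (finite) comm_ring_1
begin

lift_definition zero_mfps :: "'a mfps" is "\<lambda>_. 0" .
lift_definition one_mfps :: "'a mfps" is "\<lambda>\<gamma>. if \<gamma> = 0 then 1 else 0" .
lift_definition plus_mfps :: "'a mfps \<Rightarrow> 'a mfps \<Rightarrow> 'a mfps" is "\<lambda>f g \<gamma>. f \<gamma> + g \<gamma>" .
lift_definition minus_mfps :: "'a mfps \<Rightarrow> 'a mfps \<Rightarrow> 'a mfps" is "\<lambda>f g \<gamma>. f \<gamma> - g \<gamma>" .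
lift_definition uminus_mfps :: "'a mfps \<Rightarrow> 'a mfps" is "\<lambda>f \<gamma>. - f \<gamma>" .
lift_definition times_mfps :: "'a mfps \<Rightarrow> 'a mfps \<Rightarrow> 'a mfps"
  is "\<lambda>f g \<gamma>. \<Sum>(\<alpha>, \<beta>) | \<alpha> + \<beta> = \<gamma>. f \<alpha> * g \<beta>" .

instance
proof
  fix f g h :: "'a mfps"
  show "f * g * h = f * (g * h)"
  proof (rule mfps_eqI)
    fix \<gamma> :: "'a \<Rightarrow> nat"
    let ?S = "\<lambda>\<delta> :: 'a \<Rightarrow> nat. {(\<alpha>, \<beta>). \<alpha> + \<beta> = \<delta>}"
    have fin: "finite (?S \<delta>)" for \<delta>
      by (rule finite_midx_antidiag)
    have "mcoeff (f * g * h) \<gamma> =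
        (\<Sum>p\<in>?S \<gamma>. \<Sum>q\<in>?S (fst p). mcoeff f (fst q) * mcoeff g (snd q) * mcoeff h (snd p))"
      by (simp add: times_mfps.rep_eq sum_distrib_right case_prod_unfold)
    also have "\<dots> = (\<Sum>(p, q)\<in>Sigma (?S \<gamma>) (\<lambda>p. ?S (fst p)).
        mcoeff f (fst q) * mcoeff g (snd q) * mcoeff h (snd p))"
      using fin by (subst sum.Sigma) auto
    also have "\<dots> = (\<Sum>(p, q)\<in>Sigma (?S \<gamma>) (\<lambda>p. ?S (snd p)).
        mcoeff f (fst p) * (mcoeff g (fst q) * mcoeff h (snd q)))"
      by (rule sum.reindex_bij_witness[of _
            "\<lambda>(p, q). ((fst p + fst q, snd q), (fst p, fst q))"
            "\<lambda>(p, q). ((fst q, snd q + snd p), (snd q, snd p))"])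
         (auto simp: ac_simps)
    also have "\<dots> = (\<Sum>p\<in>?S \<gamma>. \<Sum>q\<in>?S (snd p).
        mcoeff f (fst p) * (mcoeff g (fst q) * mcoeff h (snd q)))"
      using fin by (subst sum.Sigma) auto
    also have "\<dots> = mcoeff (f * (g * h)) \<gamma>"
      by (simp add: times_mfps.rep_eq sum_distrib_left case_prod_unfold)
    finally show "mcoeff (f * g * h) \<gamma> = mcoeff (f * (g * h)) \<gamma>" .
  qed
  show "f * g = g * f"
  proof (rule mfps_eqI)
    fix \<gamma> :: "'a \<Rightarrow> nat"
    show "mcoeff (f * g) \<gamma> = mcoeff (g * f) \<gamma>"
      unfolding times_mfps.rep_eq
      by (rule sum.reindex_bij_witness[of _ prod.swap prod.swap]) (auto simp: ac_simps)
  qed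
  show "1 * f = f"
  proof (rule mfps_eqI)
    fix \<gamma> :: "'a \<Rightarrow> nat"
    have "mcoeff (1 * f) \<gamma> = (\<Sum>p\<in>{(0 :: 'a \<Rightarrow> nat, \<gamma>)}. case p of (\<alpha>, \<beta>) \<Rightarrow>
        (if \<alpha> = 0 then 1 else 0) * mcoeff f \<beta>)"
      unfolding times_mfps.rep_eq one_mfps.rep_eq
      by (rule sum.mono_neutral_right) (use finite_midx_antidiag in \<open>auto split: if_splits\<close>)
    then show "mcoeff (1 * f) \<gamma> = mcoeff f \<gamma>"
      by simp
  qed
  show "(f + g) * h = f * h + g * h"
    by (rule mfps_eqI)
       (simp add: times_mfps.rep_eq plus_mfps.rep_eq case_prod_unfold algebra_simps sum.distrib)
  show "(0 :: 'a mfps) \<noteq> 1"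
    by transfer (metis zero_neq_one)
qed (transfer; auto simp: algebra_simps)+

end

lift_definition mmonom :: "complex \<Rightarrow> ('d \<Rightarrow> nat) \<Rightarrow> 'd mfps"
  is "\<lambda>c \<alpha> \<gamma>. if \<gamma> = \<alpha> then c else 0" .

lift_definition mpderiv :: "'d \<Rightarrow> 'd mfps \<Rightarrow> 'd mfps"
  is "\<lambda>j f \<gamma>. of_nat (Suc (\<gamma> j)) * f (\<gamma>(j := Suc (\<gamma> j)))" .

definition vfield :: "('d::finite \<Rightarrow> 'd mfps) \<Rightarrow> 'd mfps \<Rightarrow> 'd mfps" where
  "vfield a f = (\<Sum>j\<in>UNIV. a j * mpderiv j f)"

text \<open>
  Convergence of a family of formal power series, coefficient by coefficient: every coefficient
  receives only finitely many nonzero contributions.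
\<close>

definition formal_has_sum :: "('i \<Rightarrow> 'd mfps) \<Rightarrow> 'd mfps \<Rightarrow> bool" where
  "formal_has_sum f S \<longleftrightarrow>
     (\<forall>\<gamma>. finite {i. mcoeff (f i) \<gamma> \<noteq> 0} \<and>
          mcoeff S \<gamma> = (\<Sum>i | mcoeff (f i) \<gamma> \<noteq> 0. mcoeff (f i) \<gamma>))"

definition polydisc :: "('d \<Rightarrow> real) \<Rightarrow> (complex ^ 'd) set" where
  "polydisc r = {x. \<forall>j. norm (x $ j) < r j}"

definition mfps_convergent :: "'d::finite mfps \<Rightarrow> bool" where
  "mfps_convergent T \<longleftrightarrow>
     (\<exists>r. (\<forall>j. 0 < r j) \<and>
          (\<forall>x\<in>polydisc r. (\<lambda>\<alpha>. mcoeff T \<alpha> * (\<Prod>j\<in>UNIV. x $ j ^ \<alpha> j)) summable_on UNIV))"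

text \<open>
  \<open>T\<close> is the Taylor series of \<open>f\<close> at the origin: it converges to \<open>f\<close> on some polydisc around the
  origin (the analogue in several variables of \<^const>\<open>has_fps_expansion\<close>).
\<close>

definition has_mfps_expansion :: "(complex ^ 'd \<Rightarrow> complex) \<Rightarrow> 'd::finite mfps \<Rightarrow> bool" where
  "has_mfps_expansion f T \<longleftrightarrow>
     (\<exists>r. (\<forall>j. 0 < r j) \<and>
          (\<forall>x\<in>polydisc r. ((\<lambda>\<alpha>. mcoeff T \<alpha> * (\<Prod>j\<in>UNIV. x $ j ^ \<alpha> j)) has_sum f x) UNIV))"

text \<open>Only used for open sets \<open>U\<close>: the Frechet derivative exists and is complex linear.\<close>

definition mholomorphic_on :: "(complex ^ 'd::finite \<Rightarrow> complex) \<Rightarrow> (complex ^ 'd) set \<Rightarrow> bool" where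
  "mholomorphic_on f U \<longleftrightarrow>
     (\<forall>x\<in>U. \<exists>D. (f has_derivative D) (at x) \<and> (\<forall>c v. D (c *s v) = c * D v))"

definition bounded_holomorphic :: "('d::finite \<Rightarrow> real) \<Rightarrow> (complex ^ 'd \<Rightarrow> complex) set" where
  "bounded_holomorphic r = {f. mholomorphic_on f (polydisc r) \<and> bounded (f ` polydisc r)}"

definition P_gevrey :: "'d::finite mfps \<Rightarrow> real \<Rightarrow> 'd mfps \<Rightarrow> bool" where
  "P_gevrey P s fhat \<longleftrightarrow>
     (\<exists>(r :: 'd \<Rightarrow> real) (C :: real) (A :: real) f T.
        (\<forall>j. 0 < r j) \<and> 0 < C \<and> 0 < A \<and>
        (\<forall>n::nat. f n \<in> bounded_holomorphic r \<and> has_mfps_expansion (f n) (T n)) \<and>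
        formal_has_sum (\<lambda>n. T n * P ^ n) fhat \<and>
        (\<forall>n. \<forall>x\<in>polydisc r. norm (f n x) \<le> C * A ^ n * fact n powr s))"

text \<open>
  The space \<open>\<complex>\<^sup>d \<times> \<complex>\<^sup>N\<close> is represented as \<open>complex ^ ('d + 'n)\<close>: the coordinates \<open>Inl i\<close> are the
  \<open>x\<^sub>i\<close> and the coordinates \<open>Inr k\<close> are the \<open>y\<^sub>k\<close>. If \<open>G\<close> is a series in the variables \<open>(x, y)\<close>, then
  \<open>formal_subst G y S\<close> says that \<open>S = G(x, y(x))\<close>, for series \<open>y\<^sub>k\<close> in the variables \<open>x\<close>.
\<close>

definition formal_subst ::
  "('d::finite + 'n::finite) mfps \<Rightarrow> 'd mfps ^ 'n \<Rightarrow> 'd mfps \<Rightarrow> bool" where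
  "formal_subst G y S \<longleftrightarrow>
     formal_has_sum
       (\<lambda>\<alpha>. mmonom (mcoeff G \<alpha>) (\<lambda>i. \<alpha> (Inl i)) * (\<Prod>k\<in>UNIV. (y $ k) ^ \<alpha> (Inr k))) S"

text \<open>
  \<open>y\<close> is a formal solution of \<open>P(x) L(y)(x) = F(x, y)\<close> for \<open>L = \<Sum>\<^sub>j a\<^sub>j \<partial>/\<partial>x\<^sub>j\<close>; the series \<open>G k\<close> is the
  Taylor series of the component \<open>F\<^sub>k\<close> at the origin.
\<close>

definition formal_solution ::
  "'d::finite mfps \<Rightarrow> ('d \<Rightarrow> 'd mfps) \<Rightarrow> (complex ^ ('d + 'n) \<Rightarrow> complex ^ 'n) \<Rightarrow>
   'd mfps ^ 'n::finite \<Rightarrow> bool" where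
  "formal_solution P a F y \<longleftrightarrow>
     (\<exists>G. \<forall>k. has_mfps_expansion (\<lambda>z. F z $ k) (G k) \<and>
              formal_subst (G k) y (P * vfield a (y $ k)))"

end

theory Submission
  imports Defs "HOL-Complex_Analysis.Complex_Analysis"
begin

text \<open>
  Let \<open>t\<close> be a new variable that stands for \<open>P\<close>, and look for a solution of the form
  \<open>y(x) = Y(P(x), x)\<close>. Because \<open>L(P) = P Q\<close>, the chain rule turns \<open>P L(y)\<close> into
  \<open>t L(Y) + t\<^sup>2 Q \<partial>Y/\<partial>t\<close> at \<open>t = P(x)\<close>, so it suffices to solve
  \<open>F(x, Y) = t L(Y) + t\<^sup>2 Q \<partial>Y/\<partial>t\<close> with \<open>Y(0) = 0\<close> in power series in \<open>(t, x)\<close>. Writing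
  \<open>Y = \<Sum>\<^sub>n Y\<^sub>n(x) t\<^sup>n\<close> then gives \<open>y = \<Sum>\<^sub>n Y\<^sub>n P\<^sup>n\<close>, and the Gevrey property of \<open>y\<close> is a growth
  condition on the \<open>Y\<^sub>n\<close>.

  The growth condition comes from a weighted \<open>\<ell>\<^sup>1\<close> norm on series in \<open>(t, x)\<close> in which the
  monomial \<open>t\<^sup>n x\<^sup>\<alpha>\<close> has the weight \<open>\<rho>\<^bsup>|\<alpha>|\<^esup> \<tau>\<^sup>n |\<alpha>|! / (n + |\<alpha>|)!\<close>. A derivative in \<open>x\<close> costs a
  factor \<open>|\<alpha>|\<close> and lowers \<open>|\<alpha>|\<close> by one, while \<open>t\<close> raises \<open>n\<close> by one; the sum \<open>n + |\<alpha>|\<close> is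
  unchanged, and hence \<open>t \<partial>/\<partial>x\<^sub>j\<close> is bounded, with norm at most \<open>\<tau>/\<rho>\<close>
  (\<open>wbound_t_mpderiv_Some\<close>); \<open>t\<^sup>2 \<partial>/\<partial>t\<close> has norm at most \<open>\<tau>\<close>. The norm is submultiplicative
  (\<open>gwt_add\<close>), so analytic functions can be applied to small series. With \<open>\<nu>\<close> the inverse of the
  Jacobian and \<open>H\<close> what remains of \<open>F\<close> after removing the terms that are linear in \<open>y\<close> with
  constant coefficients, the equation reads
  \<open>Y = \<nu> (t L(Y) + t\<^sup>2 Q \<partial>Y/\<partial>t - H(x, Y))\<close>. For suitable radii the right-hand side maps a small ball
  to itself. The iterates converge coefficient by coefficient, since the right-hand side raises the
  order of the difference of two arguments if \<open>t\<close> is counted with weight 2 and each \<open>x\<^sub>j\<close> with weight 1. This gives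
  \<open>lifted_solution_exists\<close>, and \<open>wbound_tcoeff\<close> reads off a bound of the form \<open>C A\<^sup>n n!\<close> for \<open>Y\<^sub>n\<close>.
  The implicit function theorem, which provides \<open>Y\<^sub>0\<close>, is the coefficient of \<open>t\<^sup>0\<close> of this argument.

  For uniqueness, the difference \<open>\<delta>\<close> of two solutions satisfies \<open>\<delta> = \<nu> (P L(\<delta>) - h)\<close>, where every
  component of \<open>h\<close> lies in the maximal ideal times the ideal generated by the components of \<open>\<delta>\<close>. The
  operator \<open>P L\<close> maps multiples of \<open>P\<^sup>n\<close> to multiples of \<open>P\<^bsup>n + 1\<^esup>\<close>. Playing both facts against each
  other shows that \<open>\<delta>\<close> lies in every power of the maximal ideal (\<open>formal_solution_unique\<close>).

  Three analytic facts connect these formal arguments with holomorphic functions: a convergent series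
  defines a bounded holomorphic function on a polydisc (\<open>mholomorphic_meval\<close>), Taylor expansions
  are unique (\<open>has_mfps_expansion_unique\<close>), and holomorphic functions have Taylor expansions
  (\<open>mholomorphic_has_mfps_expansion\<close>).
\<close>

section \<open>Multi-indices and orders of vanishing\<close>

(* Induction over multi-indices eta-expands them; as simplification rules the pointwise laws would
   then rewrite under the abstraction and destroy the sum beta + munit k. *)
declare plus_fun_apply [simp del] zero_fun_apply [simp del]

lemmas midx_eq = fun_eq_iff plus_fun_apply zero_fun_apply

definition munit :: "'d \<Rightarrow> 'd \<Rightarrow> nat" where
  "munit j = (\<lambda>i. if i = j then 1 else 0)"

definition wdeg :: "('d::finite \<Rightarrow> nat) \<Rightarrow> ('d \<Rightarrow> nat) \<Rightarrow> nat" where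
  "wdeg w \<alpha> = (\<Sum>j\<in>UNIV. w j * \<alpha> j)"

abbreviation mdeg :: "('d::finite \<Rightarrow> nat) \<Rightarrow> nat" where
  "mdeg \<equiv> wdeg (\<lambda>_. Suc 0)"

lemma mdeg_conv_sum: "mdeg \<alpha> = (\<Sum>j\<in>UNIV. \<alpha> j)"
  by (simp add: wdeg_def)

lemma wdeg_add [simp]: "wdeg w (\<alpha> + \<beta>) = wdeg w \<alpha> + wdeg w \<beta>"
  by (simp add: wdeg_def sum.distrib algebra_simps plus_fun_apply)

lemma wdeg_0 [simp]: "wdeg w 0 = 0"
  by (simp add: wdeg_def zero_fun_apply)

lemma wdeg_munit [simp]: "wdeg w (munit j) = w j"
  by (simp add: wdeg_def munit_def if_distrib cong: if_cong)

lemma munit_same [simp]: "munit j j = Suc 0" and munit_other: "i \<noteq> j \<Longrightarrow> munit j i = 0"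
  by (simp_all add: munit_def)

lemma munit_nonzero [simp]: "munit j \<noteq> 0"
  by (auto simp: munit_def midx_eq)

lemma munit_inj [simp]: "munit j = munit k \<longleftrightarrow> j = k"
  by (auto simp: munit_def midx_eq split: if_splits)

lemma midx_split:
  assumes "\<alpha> j \<noteq> (0::nat)" shows "\<alpha> = \<alpha>(j := \<alpha> j - 1) + munit j"
  using assms by (auto simp: midx_eq munit_def)

lemma fun_upd_Suc_eq_add_munit: "\<gamma>(j := Suc (\<gamma> j)) = \<gamma> + munit j"
  by (auto simp: midx_eq munit_def)

lemma le_mdeg: "\<alpha> j \<le> mdeg \<alpha>"
  unfolding mdeg_conv_sum by (rule member_le_sum) auto

lemma mdeg_eq_0_iff [simp]: "mdeg \<alpha> = 0 \<longleftrightarrow> \<alpha> = 0"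
  unfolding mdeg_conv_sum by (auto simp: midx_eq)

lemma mdeg_le_wdeg:
  assumes "\<And>j. Suc 0 \<le> w j" shows "mdeg \<alpha> \<le> wdeg w \<alpha>"
  unfolding wdeg_def by (intro sum_mono mult_right_mono assms) auto

lemma midx_induct [case_names zero add]:
  assumes "P 0" and "\<And>\<beta> k. P \<beta> \<Longrightarrow> P (\<beta> + munit k)"
  shows "P (\<alpha> :: 'd::finite \<Rightarrow> nat)"
proof (induction "mdeg \<alpha>" arbitrary: \<alpha>)
  case 0
  then show ?case using assms(1) by simp
next
  case (Suc n)
  then have "\<alpha> \<noteq> 0" by auto
  then obtain j where j: "\<alpha> j \<noteq> 0" by (auto simp: midx_eq)
  define \<beta> where "\<beta> = \<alpha>(j := \<alpha> j - 1)"
  have eq: "\<alpha> = \<beta> + munit j" unfolding \<beta>_def by (rule midx_split[of \<alpha> j, OF j])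
  have "mdeg \<alpha> = mdeg \<beta> + 1" by (subst eq) simp
  then have "P \<beta>" using Suc by auto
  then show ?case using assms(2) eq by metis
qed

lemma finite_mdeg_le: "finite {\<alpha> :: 'd::finite \<Rightarrow> nat. mdeg \<alpha> \<le> m}"
proof (rule finite_subset)
  show "{\<alpha> :: 'd \<Rightarrow> nat. mdeg \<alpha> \<le> m} \<subseteq> PiE UNIV (\<lambda>_. {..m})"
    by (auto simp: PiE_def extensional_def intro: order_trans[OF le_mdeg])
qed (intro finite_PiE; auto)

lemma mcoeff_arith [simp]:
  "mcoeff 0 \<gamma> = 0" "mcoeff (f + g) \<gamma> = mcoeff f \<gamma> + mcoeff g \<gamma>"
  "mcoeff (f - g) \<gamma> = mcoeff f \<gamma> - mcoeff g \<gamma>" "mcoeff (- f) \<gamma> = - mcoeff f \<gamma>"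
  by (simp_all add: zero_mfps.rep_eq plus_mfps.rep_eq minus_mfps.rep_eq uminus_mfps.rep_eq)

lemma mcoeff_sum [simp]: "mcoeff (\<Sum>i\<in>A. f i) \<gamma> = (\<Sum>i\<in>A. mcoeff (f i) \<gamma>)"
  by (induction A rule: infinite_finite_induct) auto

lemma mcoeff_mult: "mcoeff (f * g) \<gamma> = (\<Sum>(\<alpha>, \<beta>) | \<alpha> + \<beta> = \<gamma>. mcoeff f \<alpha> * mcoeff g \<beta>)"
  by (simp add: times_mfps.rep_eq)

text \<open>
  The ideal of series of order at least \<open>m\<close> when the variable \<open>j\<close> has weight \<open>w j\<close>; with all weights
  one it is the \<open>m\<close>-th power of the maximal ideal. These ideals define the topology in which all
  formal limits below are taken.
\<close>

definition vanish :: "('d::finite \<Rightarrow> nat) \<Rightarrow> nat \<Rightarrow> 'd mfps set" where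
  "vanish w m = {f. \<forall>\<alpha>. wdeg w \<alpha> < m \<longrightarrow> mcoeff f \<alpha> = 0}"

abbreviation mvanish :: "nat \<Rightarrow> 'd::finite mfps set" where
  "mvanish \<equiv> vanish (\<lambda>_. Suc 0)"

lemma vanishI: "(\<And>\<alpha>. wdeg w \<alpha> < m \<Longrightarrow> mcoeff f \<alpha> = 0) \<Longrightarrow> f \<in> vanish w m"
  by (simp add: vanish_def)

lemma vanishD: "f \<in> vanish w m \<Longrightarrow> wdeg w \<alpha> < m \<Longrightarrow> mcoeff f \<alpha> = 0"
  by (simp add: vanish_def)

lemma vanish_arith:
  "0 \<in> vanish w m" "f \<in> vanish w m \<Longrightarrow> g \<in> vanish w m \<Longrightarrow> f + g \<in> vanish w m"
  "f \<in> vanish w m \<Longrightarrow> g \<in> vanish w m \<Longrightarrow> f - g \<in> vanish w m"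
  by (auto simp: vanish_def)

lemma vanish_sum: "(\<And>i. i \<in> A \<Longrightarrow> f i \<in> vanish w m) \<Longrightarrow> (\<Sum>i\<in>A. f i) \<in> vanish w m"
  by (auto simp: vanish_def)

lemma vanish_0 [simp]: "f \<in> vanish w 0"
  by (simp add: vanish_def)

lemma vanish_mono: "m \<le> n \<Longrightarrow> f \<in> vanish w n \<Longrightarrow> f \<in> vanish w m"
  by (auto simp: vanish_def)

lemma vanish_mult:
  assumes "f \<in> vanish w m" "g \<in> vanish w n" shows "f * g \<in> vanish w (m + n)"
proof (rule vanishI)
  fix \<gamma> assume *: "wdeg w \<gamma> < m + n"
  have "mcoeff f \<alpha> * mcoeff g \<beta> = 0" if "\<alpha> + \<beta> = \<gamma>" for \<alpha> \<beta>
  proof (cases "wdeg w \<alpha> < m")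
    case True then show ?thesis using assms(1) by (simp add: vanishD)
  next
    case False
    then have "wdeg w \<beta> < n" using * that[symmetric] by simp
    then show ?thesis using assms(2) by (simp add: vanishD)
  qed
  then show "mcoeff (f * g) \<gamma> = 0"
    unfolding mcoeff_mult by (intro sum.neutral) auto
qed

lemma vanish_mult_right: "g \<in> vanish w n \<Longrightarrow> f * g \<in> vanish w n"
  using vanish_mult[of f w 0 g n] by simp

lemma mvanish_subset_vanish:
  assumes "\<And>j. Suc 0 \<le> w j" shows "mvanish m \<subseteq> vanish w m"
  using mdeg_le_wdeg[of w] assms by (auto simp: vanish_def intro: le_less_trans)

lemma mvanish_1_iff: "f \<in> mvanish (Suc 0) \<longleftrightarrow> mcoeff f 0 = 0"
  by (auto simp: vanish_def)

lemma vanish_all_eq_0: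
  assumes "\<And>m. f \<in> vanish w m" shows "f = 0"
  by (rule mfps_eqI) (use assms in \<open>auto intro: vanishD\<close>)

lemma vanish_all_eq:
  assumes "\<And>m. f - g \<in> vanish w m" shows "f = g"
  using vanish_all_eq_0[of "f - g"] assms by auto

lemma mcoeff_mult_0: "mcoeff (f * g) 0 = mcoeff f 0 * mcoeff g 0"
proof -
  have "{(\<alpha>, \<beta>). \<alpha> + \<beta> = (0::'a \<Rightarrow> nat)} = {(0, 0)}"
    by (auto simp: midx_eq)
  then show ?thesis unfolding mcoeff_mult by simp
qed

section \<open>Monomials and continuity\<close>

definition mvar :: "'d \<Rightarrow> 'd mfps" where "mvar j = mmonom 1 (munit j)"

abbreviation mconst :: "complex \<Rightarrow> 'd mfps" where "mconst c \<equiv> mmonom c 0"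

definition mpow :: "('k::finite \<Rightarrow> 'e::finite mfps) \<Rightarrow> ('k \<Rightarrow> nat) \<Rightarrow> 'e mfps" where
  "mpow g \<alpha> = (\<Prod>k\<in>UNIV. g k ^ \<alpha> k)"

lemma mcoeff_mmonom: "mcoeff (mmonom c \<alpha>) \<gamma> = (if \<gamma> = \<alpha> then c else 0)"
  by (simp add: mmonom.rep_eq)

lemma mcoeff_mpderiv: "mcoeff (mpderiv j f) \<gamma> = of_nat (Suc (\<gamma> j)) * mcoeff f (\<gamma> + munit j)"
  by (simp add: mpderiv.rep_eq fun_upd_Suc_eq_add_munit)

lemma mmonom_vanish: "mmonom c \<alpha> \<in> vanish w (wdeg w \<alpha>)"
  by (auto simp: vanish_def mcoeff_mmonom)

lemma mcoeff_mmonom_mult_add: "mcoeff (mmonom c \<alpha> * f) (\<alpha> + \<beta>) = c * mcoeff f \<beta>"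
proof -
  have "mcoeff (mmonom c \<alpha> * f) (\<alpha> + \<beta>) =
      (\<Sum>p\<in>{(\<alpha>, \<beta>)}. case p of (\<alpha>', \<beta>) \<Rightarrow> mcoeff (mmonom c \<alpha>) \<alpha>' * mcoeff f \<beta>)"
    unfolding mcoeff_mult
    by (rule sum.mono_neutral_right)
       (use finite_midx_antidiag in \<open>auto simp: mcoeff_mmonom split: if_splits\<close>)
  then show ?thesis by (simp add: mcoeff_mmonom)
qed

lemma mcoeff_mmonom_mult_eq_0:
  assumes "\<And>\<beta>. \<gamma> \<noteq> \<alpha> + \<beta>" shows "mcoeff (mmonom c \<alpha> * f) \<gamma> = 0"
  unfolding mcoeff_mult
  by (rule sum.neutral) (use assms in \<open>auto simp: mcoeff_mmonom\<close>)

lemma mmonom_mult: "mmonom c \<alpha> * mmonom d \<beta> = mmonom (c * d) (\<alpha> + \<beta>)"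
proof (rule mfps_eqI)
  fix \<gamma>
  show "mcoeff (mmonom c \<alpha> * mmonom d \<beta>) \<gamma> = mcoeff (mmonom (c * d) (\<alpha> + \<beta>)) \<gamma>"
  proof (cases "\<exists>\<delta>. \<gamma> = \<alpha> + \<delta>")
    case True
    then obtain \<delta> where \<delta>: "\<gamma> = \<alpha> + \<delta>" by blast
    have "\<delta> = \<beta> \<longleftrightarrow> \<alpha> + \<delta> = \<alpha> + \<beta>" by (simp add: midx_eq)
    then show ?thesis unfolding \<delta> by (simp add: mcoeff_mmonom_mult_add) (simp add: mcoeff_mmonom)
  next
    case False
    then show ?thesis by (subst mcoeff_mmonom_mult_eq_0) (auto simp: mcoeff_mmonom)
  qed
qed

lemma mmonom_0 [simp]: "mmonom 0 \<alpha> = 0"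
  by (rule mfps_eqI) (simp add: mcoeff_mmonom)

lemma mconst_1 [simp]: "mconst 1 = 1"
  by (rule mfps_eqI) (simp add: mcoeff_mmonom one_mfps.rep_eq)

lemma mcoeff_1_0 [simp]: "mcoeff 1 0 = 1"
  by (simp add: one_mfps.rep_eq)

lemma mconst_mult: "mconst c * mconst d = mconst (c * d)"
  by (simp add: mmonom_mult)

lemma mcoeff_mconst_mult: "mcoeff (mconst c * f) \<gamma> = c * mcoeff f \<gamma>"
  using mcoeff_mmonom_mult_add[of c 0 f \<gamma>] by simp

lemma mcoeff_mvar_0 [simp]: "mcoeff (mvar j) 0 = 0"
  by (simp add: mvar_def mcoeff_mmonom munit_nonzero[symmetric] del: munit_nonzero)

lemma mvar_vanish: "mvar j \<in> vanish w (w j)"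
  using mmonom_vanish[of 1 "munit j" w] by (simp add: mvar_def)

lemma mpow_0 [simp]: "mpow g 0 = 1"
  by (simp add: mpow_def zero_fun_apply)

lemma mpow_add: "mpow g (\<alpha> + \<beta>) = mpow g \<alpha> * mpow g \<beta>"
  by (simp add: mpow_def power_add prod.distrib plus_fun_apply)

lemma mpow_munit [simp]: "mpow g (munit k) = g k"
proof -
  have "mpow g (munit k) = (\<Prod>i\<in>{k}. g i ^ munit k i)"
    unfolding mpow_def by (rule prod.mono_neutral_right) (auto simp: munit_def)
  then show ?thesis by simp
qed

lemma mpow_vanish:
  assumes "\<And>k. mcoeff (g k) 0 = 0" shows "mpow g \<alpha> \<in> mvanish (mdeg \<alpha>)"
proof (induction \<alpha> rule: midx_induct)
  case (add \<beta> k)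
  have "g k \<in> mvanish (Suc 0)" using assms by (simp add: mvanish_1_iff)
  then show ?case using vanish_mult[OF add, of "g k" "Suc 0"] by (simp add: mpow_add)
qed simp

lemma mpow_const_0:
  assumes "\<And>k. mcoeff (g k) 0 = 0" "\<alpha> \<noteq> 0" shows "mcoeff (mpow g \<alpha>) 0 = 0"
proof -
  have "mdeg \<alpha> \<noteq> 0" using assms(2) by simp
  then show ?thesis
    by (intro vanishD[OF mpow_vanish[OF assms(1)]]) auto
qed

lemma mmonom_conv_mpow: "mmonom c \<alpha> = mconst c * mpow mvar \<alpha>"
proof -
  have "mpow mvar \<alpha> = mmonom 1 \<alpha>"
    by (induction \<alpha> rule: midx_induct) (simp_all add: mpow_add mvar_def mmonom_mult)
  then show ?thesis by (simp add: mmonom_mult)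
qed

text \<open>
  Multiplicative identities need to be checked on constants and variables only.
\<close>

lemma mmonom_induct [case_names const var mult]:
  assumes "\<And>c. S (mconst c)" "\<And>j. S (mvar j)" "\<And>f g. S f \<Longrightarrow> S g \<Longrightarrow> S (f * g)"
  shows "S (mmonom c (\<alpha> :: 'd::finite \<Rightarrow> nat))"
proof -
  have "S (mpow mvar \<alpha>)"
  proof (induction \<alpha> rule: midx_induct)
    case zero
    then show ?case using assms(1)[of 1] by simp
  qed (use assms in \<open>simp add: mpow_add\<close>)
  then show ?thesis using assms mmonom_conv_mpow by metis
qed

definition mtrunc :: "nat \<Rightarrow> 'd::finite mfps \<Rightarrow> 'd mfps" where
  "mtrunc m f = (\<Sum>\<alpha> | mdeg \<alpha> \<le> m. mmonom (mcoeff f \<alpha>) \<alpha>)"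

lemma diff_mtrunc_vanish: "f - mtrunc m f \<in> mvanish (Suc m)"
proof (rule vanishI)
  fix \<gamma> :: "'a \<Rightarrow> nat" assume "mdeg \<gamma> < Suc m"
  then have "\<gamma> \<in> {\<alpha>. mdeg \<alpha> \<le> m}" by simp
  then show "mcoeff (f - mtrunc m f) \<gamma> = 0"
    using finite_mdeg_le[where 'd = 'a]
    by (simp add: mtrunc_def mcoeff_mmonom sum.delta)
qed

text \<open>
  Additive maps that are continuous for the powers of the maximal ideal, uniformly up to a shift \<open>c\<close>
  of the order: multiplication has shift 0, a derivative has shift 1.
\<close>

definition mcontinuous :: "('d::finite mfps \<Rightarrow> 'e::finite mfps) \<Rightarrow> bool" where
  "mcontinuous \<Phi> \<longleftrightarrow> (\<forall>f g. \<Phi> (f + g) = \<Phi> f + \<Phi> g) \<and> (\<exists>c. \<forall>m. \<forall>f\<in>mvanish (m + c). \<Phi> f \<in> mvanish m)"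

lemma mcontinuousI:
  assumes "\<And>f g. \<Phi> (f + g) = \<Phi> f + \<Phi> g"
    and "\<And>m f. f \<in> mvanish (m + c) \<Longrightarrow> \<Phi> f \<in> mvanish m"
  shows "mcontinuous \<Phi>"
  using assms unfolding mcontinuous_def by blast

lemma mcontinuous_apply_sum:
  assumes "mcontinuous \<Phi>"
  shows "\<Phi> (\<Sum>i\<in>A. f i) = (\<Sum>i\<in>A. \<Phi> (f i))"
proof -
  have add: "\<Phi> (f + g) = \<Phi> f + \<Phi> g" for f g
    using assms by (simp add: mcontinuous_def)
  have "\<Phi> 0 = 0" using add[of 0 0] by simp
  then show ?thesis by (induction A rule: infinite_finite_induct) (simp_all add: add)
qed

text \<open>
  Polynomials are dense, so two continuous additive maps coincide as soon as they agree on monomials.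
  The algebra of substitution (ring homomorphism, composition, chain rule) is derived from this
  principle, which avoids rearranging sums over multi-indices.
\<close>

lemma mcontinuous_eqI:
  fixes \<Phi> \<Psi> :: "'d::finite mfps \<Rightarrow> 'e::finite mfps"
  assumes \<Phi>: "mcontinuous \<Phi>" and \<Psi>: "mcontinuous \<Psi>"
    and eq: "\<And>c \<alpha>. \<Phi> (mmonom c \<alpha>) = \<Psi> (mmonom c \<alpha>)"
  shows "\<Phi> f = \<Psi> f"
proof (rule vanish_all_eq)
  fix m
  have add: "\<Phi> (f + g) = \<Phi> f + \<Phi> g" "\<Psi> (f + g) = \<Psi> f + \<Psi> g" for f g
    using \<Phi> \<Psi> by (simp_all add: mcontinuous_def)
  obtain c1 where c1: "\<And>m f. f \<in> mvanish (m + c1) \<Longrightarrow> \<Phi> f \<in> mvanish m"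
    using \<Phi> unfolding mcontinuous_def by blast
  obtain c2 where c2: "\<And>m f. f \<in> mvanish (m + c2) \<Longrightarrow> \<Psi> f \<in> mvanish m"
    using \<Psi> unfolding mcontinuous_def by blast
  define n where "n = m + c1 + c2"
  define r where "r = f - mtrunc n f"
  have r: "r \<in> mvanish (Suc n)" unfolding r_def by (rule diff_mtrunc_vanish)
  have f: "f = mtrunc n f + r" by (simp add: r_def)
  have "\<Phi> (mtrunc n f) = \<Psi> (mtrunc n f)"
    unfolding mtrunc_def by (simp add: mcontinuous_apply_sum \<Phi> \<Psi> eq)
  then have "\<Phi> f - \<Psi> f = \<Phi> r - \<Psi> r"
    by (subst (1 2) f) (simp add: add)
  also have "\<dots> \<in> mvanish m"
    by (intro vanish_arith c1 c2 vanish_mono[OF _ r]) (simp_all add: n_def)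
  finally show "\<Phi> f - \<Psi> f \<in> mvanish m" .
qed

lemma mcontinuous_comp: "mcontinuous \<Phi> \<Longrightarrow> mcontinuous \<Psi> \<Longrightarrow> mcontinuous (\<lambda>f. \<Phi> (\<Psi> f))"
proof -
  assume *: "mcontinuous \<Phi>" "mcontinuous \<Psi>"
  obtain c1 where c1: "\<And>m f. f \<in> mvanish (m + c1) \<Longrightarrow> \<Phi> f \<in> mvanish m"
    using * unfolding mcontinuous_def by blast
  obtain c2 where c2: "\<And>m f. f \<in> mvanish (m + c2) \<Longrightarrow> \<Psi> f \<in> mvanish m"
    using * unfolding mcontinuous_def by blast
  show ?thesis
  proof (rule mcontinuousI[where c = "c1 + c2"])
    show "\<Phi> (\<Psi> (f + g)) = \<Phi> (\<Psi> f) + \<Phi> (\<Psi> g)" for f g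
      using * by (simp add: mcontinuous_def)
    show "\<Phi> (\<Psi> f) \<in> mvanish m" if "f \<in> mvanish (m + (c1 + c2))" for m f
      using that by (intro c1 c2) (simp add: add.assoc)
  qed
qed

lemma mcontinuous_mult_left: "mcontinuous (\<lambda>f. g * f)"
  by (rule mcontinuousI[where c = 0]) (simp_all add: distrib_left vanish_mult_right)

lemma mcontinuous_mult_right: "mcontinuous (\<lambda>f. f * g)"
  using mcontinuous_mult_left[of g] by (simp add: mult.commute)

lemma mcontinuous_mult_left': "mcontinuous \<Phi> \<Longrightarrow> mcontinuous (\<lambda>f. g * \<Phi> f)"
  by (rule mcontinuous_comp[OF mcontinuous_mult_left])

lemma mcontinuous_mult_right': "mcontinuous \<Phi> \<Longrightarrow> mcontinuous (\<lambda>f. \<Phi> f * g)"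
  by (rule mcontinuous_comp[OF mcontinuous_mult_right])

lemma mcontinuous_add:
  assumes "mcontinuous \<Phi>" "mcontinuous \<Psi>" shows "mcontinuous (\<lambda>f. \<Phi> f + \<Psi> f)"
proof -
  obtain c1 where c1: "\<And>m f. f \<in> mvanish (m + c1) \<Longrightarrow> \<Phi> f \<in> mvanish m"
    using assms unfolding mcontinuous_def by blast
  obtain c2 where c2: "\<And>m f. f \<in> mvanish (m + c2) \<Longrightarrow> \<Psi> f \<in> mvanish m"
    using assms unfolding mcontinuous_def by blast
  show ?thesis
  proof (rule mcontinuousI[where c = "c1 + c2"])
    show "\<Phi> (f + g) + \<Psi> (f + g) = \<Phi> f + \<Psi> f + (\<Phi> g + \<Psi> g)" for f g
      using assms by (simp add: mcontinuous_def)
    show "\<Phi> f + \<Psi> f \<in> mvanish m" if "f \<in> mvanish (m + (c1 + c2))" for m f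
      by (intro vanish_arith c1 c2 vanish_mono[OF _ that]) simp_all
  qed
qed

lemma mcontinuous_0: "mcontinuous (\<lambda>_. 0)"
  by (rule mcontinuousI[where c = 0]) (simp_all add: vanish_arith)

lemma mcontinuous_sum: "(\<And>i. i \<in> A \<Longrightarrow> mcontinuous (\<Phi> i)) \<Longrightarrow> mcontinuous (\<lambda>f. \<Sum>i\<in>A. \<Phi> i f)"
  by (induction A rule: infinite_finite_induct) (simp_all add: mcontinuous_add mcontinuous_0)

lemma mpderiv_vanish: "f \<in> vanish w m \<Longrightarrow> mpderiv j f \<in> vanish w (m - w j)"
  by (rule vanishI) (simp add: mcoeff_mpderiv vanish_def)

lemma mpderiv_add: "mpderiv j (f + g) = mpderiv j f + mpderiv j g"
  by (rule mfps_eqI) (simp add: mcoeff_mpderiv algebra_simps)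

lemma mcontinuous_mpderiv: "mcontinuous (mpderiv j)"
proof (rule mcontinuousI[where c = 1])
  show "mpderiv j f \<in> mvanish m" if "f \<in> mvanish (m + 1)" for m f
    using mpderiv_vanish[OF that, of j] by simp
qed (rule mpderiv_add)

lemma mpderiv_mmonom:
  "mpderiv j (mmonom c \<alpha>) = mmonom (of_nat (\<alpha> j) * c) (\<alpha>(j := \<alpha> j - 1))"
proof (rule mfps_eqI)
  fix \<gamma>
  show "mcoeff (mpderiv j (mmonom c \<alpha>)) \<gamma> = mcoeff (mmonom (of_nat (\<alpha> j) * c) (\<alpha>(j := \<alpha> j - 1))) \<gamma>"
  proof (cases "\<alpha> j = 0")
    case True
    then have "\<gamma> + munit j \<noteq> \<alpha>" by (auto simp: midx_eq munit_def)
    then show ?thesis using True by (simp add: mcoeff_mpderiv mcoeff_mmonom)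
  next
    case False
    then have "\<gamma> + munit j = \<alpha> \<longleftrightarrow> \<gamma> = \<alpha>(j := \<alpha> j - 1)"
      by (auto simp: midx_eq munit_def split: if_splits)
    moreover have "Suc (\<gamma> j) = \<alpha> j" if "\<gamma> + munit j = \<alpha>"
      using that by (auto simp: plus_fun_apply)
    ultimately show ?thesis by (auto simp: mcoeff_mpderiv mcoeff_mmonom simp del: of_nat_Suc)
  qed
qed

lemma mpderiv_mvar: "mpderiv i (mvar k) = (if i = k then 1 else 0)"
proof -
  have "(munit k)(k := munit k k - 1) = 0" by (auto simp: munit_def midx_eq)
  then show ?thesis by (auto simp: mvar_def mpderiv_mmonom munit_other)
qed

lemma mpderiv_mult: "mpderiv j (f * g) = mpderiv j f * g + f * mpderiv j g"
proof -
  note cont = mcontinuous_add mcontinuous_mult_left mcontinuous_mult_right mcontinuous_mult_left'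
    mcontinuous_mult_right' mcontinuous_mpderiv mcontinuous_comp[OF mcontinuous_mpderiv]
  have monom: "mpderiv j (mmonom c \<alpha> * mmonom d \<beta>) =
      mpderiv j (mmonom c \<alpha>) * mmonom d \<beta> + mmonom c \<alpha> * mpderiv j (mmonom d \<beta>)" for c d \<alpha> \<beta>
  proof -
    have *: "mmonom (of_nat (\<alpha> j) * x) (\<alpha>(j := \<alpha> j - 1) + \<beta>) =
        mmonom (of_nat (\<alpha> j) * x) ((\<alpha> + \<beta>)(j := \<alpha> j + \<beta> j - 1))" for \<alpha> \<beta> :: "'a \<Rightarrow> nat" and x
    proof (cases "\<alpha> j = 0")
      case False
      then have "\<alpha>(j := \<alpha> j - 1) + \<beta> = (\<alpha> + \<beta>)(j := \<alpha> j + \<beta> j - 1)" by (auto simp: midx_eq)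
      then show ?thesis by simp
    qed simp
    have add: "mmonom (a + b) \<gamma> = mmonom a \<gamma> + mmonom b \<gamma>" for a b and \<gamma> :: "'a \<Rightarrow> nat"
      by (rule mfps_eqI) (simp add: mcoeff_mmonom)
    show ?thesis
      using *[of \<alpha> "c * d" \<beta>] *[of \<beta> "c * d" \<alpha>]
      by (simp add: mpderiv_mmonom mmonom_mult add[symmetric] plus_fun_apply distrib_left distrib_right ac_simps)
  qed
  \<comment> \<open>Both sides are continuous in each argument separately, so the density argument is used twice.\<close>
  have "mpderiv j (mmonom c \<alpha> * g) = mpderiv j (mmonom c \<alpha>) * g + mmonom c \<alpha> * mpderiv j g" for c \<alpha>
    by (rule mcontinuous_eqI[where f = g]) (intro cont monom)+
  then show ?thesis
    by (rule mcontinuous_eqI[where f = f, rotated 2]) (intro cont)+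
qed

section \<open>Substitution of power series without constant term\<close>

text \<open>
  Composition of series, \<open>G(g)\<close>. If the \<open>g k\<close> have no constant term then \<open>g\<^sup>\<alpha>\<close> has order at least
  \<open>|\<alpha>|\<close>, so that the coefficient at \<open>\<gamma>\<close> of the infinite sum \<open>\<Sum>\<^sub>\<alpha> G\<^sub>\<alpha> g\<^sup>\<alpha>\<close> only receives
  contributions with \<open>|\<alpha>| \<le> |\<gamma>|\<close>.
\<close>

definition msubst :: "'k::finite mfps \<Rightarrow> ('k \<Rightarrow> 'e::finite mfps) \<Rightarrow> 'e mfps" where
  "msubst G g = Abs_mfps (\<lambda>\<gamma>. \<Sum>\<alpha> | mdeg \<alpha> \<le> mdeg \<gamma>. mcoeff G \<alpha> * mcoeff (mpow g \<alpha>) \<gamma>)"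

lemma mcoeff_msubst:
  "mcoeff (msubst G g) \<gamma> = (\<Sum>\<alpha> | mdeg \<alpha> \<le> mdeg \<gamma>. mcoeff G \<alpha> * mcoeff (mpow g \<alpha>) \<gamma>)"
  unfolding msubst_def by (subst Abs_mfps_inverse) auto

lemma msubst_add: "msubst (F + G) g = msubst F g + msubst G g"
  by (rule mfps_eqI) (simp add: mcoeff_msubst algebra_simps sum.distrib)

lemma msubst_vanish: "F \<in> mvanish m \<Longrightarrow> msubst F g \<in> mvanish m"
  by (rule vanishI) (auto simp: mcoeff_msubst vanish_def)

lemma mcontinuous_msubst: "mcontinuous (\<lambda>F. msubst F g)"
  by (rule mcontinuousI[where c = 0]) (simp_all add: msubst_add msubst_vanish)

lemma msubst_sum: "msubst (\<Sum>i\<in>A. f i) g = (\<Sum>i\<in>A. msubst (f i) g)"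
  by (rule mcontinuous_apply_sum[OF mcontinuous_msubst])

lemma msubst_0_left [simp]: "msubst 0 g = 0"
  using msubst_sum[of undefined "{}" g] by simp

lemma msubst_uminus: "msubst (- F) g = - msubst F g"
  using msubst_add[of F "-F" g] by (simp add: eq_neg_iff_add_eq_0 add.commute)

lemma msubst_diff: "msubst (F - G) g = msubst F g - msubst G g"
  using msubst_add[of F "-G" g] by (simp add: msubst_uminus)

lemma mcoeff_msubst_0 [simp]: "mcoeff (msubst F g) 0 = mcoeff F 0"
  by (simp add: mcoeff_msubst)

context
  fixes g :: "'k::finite \<Rightarrow> 'e::finite mfps"
  assumes g0: "\<And>k. mcoeff (g k) 0 = 0"
begin

lemma msubst_mmonom: "msubst (mmonom c \<alpha>) g = mconst c * mpow g \<alpha>"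
proof (rule mfps_eqI)
  fix \<gamma> :: "'e \<Rightarrow> nat"
  have *: "(\<Sum>\<beta> | mdeg \<beta> \<le> mdeg \<gamma>. mcoeff (mmonom c \<alpha>) \<beta> * mcoeff (mpow g \<beta>) \<gamma>) =
     (\<Sum>\<beta> | mdeg \<beta> \<le> mdeg \<gamma>. if \<beta> = \<alpha> then c * mcoeff (mpow g \<beta>) \<gamma> else 0)"
    by (rule sum.cong) (auto simp: mcoeff_mmonom)
  have "mcoeff (mpow g \<alpha>) \<gamma> = 0" if "\<not> mdeg \<alpha> \<le> mdeg \<gamma>"
    using that by (intro vanishD[OF mpow_vanish[of g]] g0) auto
  then show "mcoeff (msubst (mmonom c \<alpha>) g) \<gamma> = mcoeff (mconst c * mpow g \<alpha>) \<gamma>"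
    unfolding mcoeff_msubst * using finite_mdeg_le[where 'd = 'k]
    by (auto simp: mcoeff_mconst_mult)
qed

lemma msubst_mconst [simp]: "msubst (mconst c) g = mconst c"
  by (simp add: msubst_mmonom)

lemma msubst_1 [simp]: "msubst 1 g = 1"
  using msubst_mconst[of 1] by simp

lemma msubst_mvar [simp]: "msubst (mvar k) g = g k"
  unfolding mvar_def by (simp add: msubst_mmonom)

lemma msubst_mult: "msubst (F * G) g = msubst F g * msubst G g"
proof -
  note cont = mcontinuous_mult_left mcontinuous_mult_right mcontinuous_mult_left'
    mcontinuous_mult_right' mcontinuous_msubst mcontinuous_comp[OF mcontinuous_msubst]
  have monom: "msubst (mmonom c \<alpha> * mmonom d \<beta>) g = msubst (mmonom c \<alpha>) g * msubst (mmonom d \<beta>) g"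
    for c d \<alpha> \<beta>
    by (simp only: mmonom_mult[of c \<alpha>] msubst_mmonom mpow_add mconst_mult[symmetric] ac_simps)
  have "msubst (mmonom c \<alpha> * G) g = msubst (mmonom c \<alpha>) g * msubst G g" for c \<alpha>
    by (rule mcontinuous_eqI[where f = G]) (intro cont monom)+
  then show ?thesis
    by (rule mcontinuous_eqI[where f = F, rotated 2]) (intro cont)+
qed

lemma msubst_power: "msubst (F ^ n) g = msubst F g ^ n"
  by (induction n) (simp_all add: msubst_mult)

lemma msubst_prod: "msubst (\<Prod>i\<in>A. f i) g = (\<Prod>i\<in>A. msubst (f i) g)"
  by (induction A rule: infinite_finite_induct) (simp_all add: msubst_mult)

lemma msubst_mpow: "msubst (mpow h \<alpha>) g = mpow (\<lambda>k. msubst (h k) g) \<alpha>"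
  by (simp add: mpow_def msubst_prod msubst_power)

text \<open>
  The chain rule holds for variables, and as both sides are derivations along the ring homomorphism
  given by substitution, it extends to monomials and then, by density, to all series.
\<close>

lemma mpderiv_msubst:
  "mpderiv j (msubst F g) = (\<Sum>k\<in>UNIV. msubst (mpderiv k F) g * mpderiv j (g k))"
proof (rule mcontinuous_eqI[where f = F])
  show "mcontinuous (\<lambda>F. mpderiv j (msubst F g))"
    by (intro mcontinuous_comp[OF mcontinuous_mpderiv] mcontinuous_msubst)
  show "mcontinuous (\<lambda>F. \<Sum>k\<in>UNIV. msubst (mpderiv k F) g * mpderiv j (g k))"
    by (intro mcontinuous_sum mcontinuous_mult_right' mcontinuous_comp[OF mcontinuous_msubst]
        mcontinuous_mpderiv)
  have deriv_const: "mpderiv i (mconst c) = 0" for i :: "'x::finite" and c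
    by (simp add: mpderiv_mmonom zero_fun_apply)
  show "mpderiv j (msubst (mmonom c \<alpha>) g) =
      (\<Sum>k\<in>UNIV. msubst (mpderiv k (mmonom c \<alpha>)) g * mpderiv j (g k))" for c \<alpha>
  proof (induction rule: mmonom_induct)
    case (const c)
    then show ?case by (simp add: deriv_const)
  next
    case (var k)
    have "(\<Sum>i\<in>UNIV. msubst (mpderiv i (mvar k)) g * mpderiv j (g i)) =
        (\<Sum>i\<in>UNIV. if i = k then mpderiv j (g i) else 0)"
      by (rule sum.cong) (auto simp: mpderiv_mvar)
    then show ?case by simp
  next
    case (mult f h)
    then show ?case
      by (simp add: msubst_mult mpderiv_mult msubst_add sum.distrib algebra_simps sum_distrib_left)
  qed
qed

end

lemma msubst_msubst:
  assumes "\<And>k. mcoeff (g k) 0 = 0" "\<And>k. mcoeff (h k) 0 = 0"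
  shows "msubst (msubst F g) h = msubst F (\<lambda>k. msubst (g k) h)"
proof (rule mcontinuous_eqI[where f = F])
  show "mcontinuous (\<lambda>F. msubst (msubst F g) h)"
    by (intro mcontinuous_comp[OF mcontinuous_msubst] mcontinuous_msubst)
  show "mcontinuous (\<lambda>F. msubst F (\<lambda>k. msubst (g k) h))"
    by (rule mcontinuous_msubst)
qed (use assms in \<open>simp add: msubst_mmonom msubst_mult msubst_mpow\<close>)

lemma msubst_mvar_id: "msubst F mvar = F"
  by (rule mcontinuous_eqI[where f = F])
     (simp_all add: mcontinuous_msubst msubst_mmonom mmonom_conv_mpow[symmetric],
      rule mcontinuousI[where c = 0], auto)

subsection \<open>Sums of formal power series\<close>

text \<open>
  When the orders of the terms tend to infinity, coefficientwise convergence is automatic and only the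
  value of the sum is at stake.
\<close>

lemma formal_has_sum_iff:
  assumes "\<And>i. f i \<in> mvanish (d i)" and fin: "\<And>m. finite {i. d i \<le> m}"
  shows "formal_has_sum f S \<longleftrightarrow> (\<forall>\<gamma>. mcoeff S \<gamma> = (\<Sum>i | d i \<le> mdeg \<gamma>. mcoeff (f i) \<gamma>))"
proof -
  have sub: "{i. mcoeff (f i) \<gamma> \<noteq> 0} \<subseteq> {i. d i \<le> mdeg \<gamma>}" for \<gamma>
    using vanishD[OF assms(1)] by (auto simp: not_less[symmetric])
  then have "finite {i. mcoeff (f i) \<gamma> \<noteq> 0}" for \<gamma>
    using fin finite_subset by blast
  moreover have "(\<Sum>i | mcoeff (f i) \<gamma> \<noteq> 0. mcoeff (f i) \<gamma>) =
      (\<Sum>i | d i \<le> mdeg \<gamma>. mcoeff (f i) \<gamma>)" for \<gamma>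
    by (rule sum.mono_neutral_left) (use sub fin in auto)
  ultimately show ?thesis by (simp add: formal_has_sum_def)
qed

lemma formal_has_sum_msubst:
  assumes "\<And>k. mcoeff (g k) 0 = 0"
  shows "formal_has_sum (\<lambda>\<alpha>. mconst (mcoeff G \<alpha>) * mpow g \<alpha>) S \<longleftrightarrow> S = msubst G g"
proof -
  have "formal_has_sum (\<lambda>\<alpha>. mconst (mcoeff G \<alpha>) * mpow g \<alpha>) S \<longleftrightarrow>
     (\<forall>\<gamma>. mcoeff S \<gamma> = mcoeff (msubst G g) \<gamma>)"
    by (subst formal_has_sum_iff[where d = mdeg])
       (auto intro!: vanish_mult_right mpow_vanish assms finite_mdeg_le
         simp: mcoeff_mconst_mult mcoeff_msubst)
  then show ?thesis by (auto intro: mfps_eqI)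
qed

lemma formal_subst_iff:
  fixes G :: "('d::finite + 'n::finite) mfps" and y :: "'d mfps ^ 'n"
  assumes "\<And>k. mcoeff (y $ k) 0 = 0"
  shows "formal_subst G y S \<longleftrightarrow> S = msubst G (case_sum mvar (($) y))"
proof -
  have *: "mmonom (mcoeff G \<alpha>) (\<lambda>i. \<alpha> (Inl i)) * (\<Prod>k\<in>UNIV. (y $ k) ^ \<alpha> (Inr k)) =
      mconst (mcoeff G \<alpha>) * mpow (case_sum mvar (($) y)) \<alpha>" for \<alpha>
  proof -
    have "(\<Prod>k\<in>UNIV. case_sum mvar (($) y) k ^ \<alpha> k) =
        (\<Prod>i\<in>UNIV. mvar i ^ \<alpha> (Inl i)) * (\<Prod>k\<in>UNIV. (y $ k) ^ \<alpha> (Inr k))"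
      unfolding UNIV_sum by (subst prod.union_disjoint) (auto simp: prod.reindex)
    then show ?thesis
      by (subst mmonom_conv_mpow) (simp add: mpow_def ac_simps)
  qed
  show ?thesis
    unfolding formal_subst_def * 
    by (rule formal_has_sum_msubst) (use assms in \<open>auto split: sum.split\<close>)
qed

section \<open>Uniqueness of the formal solution\<close>

definition mideal :: "'e::finite mfps set \<Rightarrow> bool" where
  "mideal J \<longleftrightarrow> 0 \<in> J \<and> (\<forall>f\<in>J. \<forall>g\<in>J. f + g \<in> J) \<and> (\<forall>f. \<forall>g\<in>J. f * g \<in> J)"

lemma mideal_add: "mideal J \<Longrightarrow> f \<in> J \<Longrightarrow> g \<in> J \<Longrightarrow> f + g \<in> J"
  and mideal_mult: "mideal J \<Longrightarrow> g \<in> J \<Longrightarrow> f * g \<in> J"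
  and mideal_0: "mideal J \<Longrightarrow> 0 \<in> J"
  by (auto simp: mideal_def)

lemma mideal_diff: "mideal J \<Longrightarrow> f \<in> J \<Longrightarrow> g \<in> J \<Longrightarrow> f - g \<in> J"
  using mideal_add[of J f "- 1 * g"] mideal_mult[of J g "-1"] by simp

lemma mideal_sum: "mideal J \<Longrightarrow> (\<And>i. i \<in> A \<Longrightarrow> f i \<in> J) \<Longrightarrow> (\<Sum>i\<in>A. f i) \<in> J"
  by (induction A rule: infinite_finite_induct) (auto intro: mideal_0 mideal_add)

lemma mideal_vanish: "mideal (vanish w m)"
  by (auto simp: mideal_def intro: vanish_arith vanish_mult_right)

lemma mpow_diff_in_ideal:
  assumes J: "mideal J" and diff: "\<And>k. g' k - g k \<in> J"
  shows "mpow g' \<alpha> - mpow g \<alpha> \<in> J"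
proof (induction \<alpha> rule: midx_induct)
  case zero
  then show ?case using J by (simp add: mideal_0)
next
  case (add \<beta> k)
  have "mpow g' (\<beta> + munit k) - mpow g (\<beta> + munit k) =
      mpow g' \<beta> * (g' k - g k) + g k * (mpow g' \<beta> - mpow g \<beta>)"
    by (simp add: mpow_add algebra_simps)
  then show ?case using J add diff by (simp add: mideal_add mideal_mult)
qed

text \<open>
  The contraction property of substitution: if \<open>g'\<close> and \<open>g\<close> agree modulo \<open>J\<close>, then nonlinear
  monomials agree modulo the maximal ideal times \<open>J\<close>, because a factor without constant term is left
  over when a difference \<open>g' k - g k\<close> is split off. Linear monomials gain nothing, and so they may
  occur only for those \<open>k\<close> where \<open>g' k = g k\<close>. The inclusion of a power of the maximal ideal in
  \<open>J'\<close> allows \<open>H\<close> to be truncated to a polynomial.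
\<close>

lemma msubst_diff_in_ideal:
  fixes g g' :: "'k::finite \<Rightarrow> 'e::finite mfps"
  assumes J: "mideal J" and J': "mideal J'"
    and mJ: "\<And>f u. mcoeff f 0 = 0 \<Longrightarrow> u \<in> J \<Longrightarrow> f * u \<in> J'"
    and m: "mvanish m \<subseteq> J'"
    and g0: "\<And>k. mcoeff (g k) 0 = 0" and g'0: "\<And>k. mcoeff (g' k) 0 = 0"
    and diff: "\<And>k. g' k - g k \<in> J"
    and lin: "\<And>k. g' k \<noteq> g k \<Longrightarrow> mcoeff H (munit k) = 0"
  shows "msubst H g' - msubst H g \<in> J'"
proof -
  have mon: "mconst (mcoeff H \<alpha>) * (mpow g' \<alpha> - mpow g \<alpha>) \<in> J'" for \<alpha>
  proof (cases "\<alpha> = 0")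
    case False
    then obtain j where j: "\<alpha> j \<noteq> 0" by (auto simp: midx_eq)
    define \<beta> where "\<beta> = \<alpha>(j := \<alpha> j - 1)"
    have \<alpha>: "\<alpha> = \<beta> + munit j" unfolding \<beta>_def by (rule midx_split[of \<alpha> j, OF j])
    show ?thesis
    proof (cases "\<beta> = 0")
      case True
      then show ?thesis using \<alpha> lin[of j] J' by (cases "g' j = g j") (auto simp: mideal_0)
    next
      case False
      have "mpow g' \<alpha> - mpow g \<alpha> =
          mpow g' \<beta> * (g' j - g j) + g j * (mpow g' \<beta> - mpow g \<beta>)"
        by (simp add: \<alpha> mpow_add algebra_simps)
      moreover have "mpow g' \<beta> * (g' j - g j) \<in> J'"
        by (intro mJ mpow_const_0 g'0 False diff)
      moreover have "g j * (mpow g' \<beta> - mpow g \<beta>) \<in> J'"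
        by (intro mJ g0 mpow_diff_in_ideal J diff)
      ultimately show ?thesis using J' by (simp add: mideal_add mideal_mult)
    qed
  qed (use J' in \<open>simp add: mideal_0\<close>)
  define r where "r = H - mtrunc m H"
  have "r \<in> mvanish m"
    unfolding r_def using diff_mtrunc_vanish vanish_mono le_SucI by blast
  then have r: "msubst r g' \<in> J'" "msubst r g \<in> J'"
    using m by (auto intro: msubst_vanish)
  have H: "H = mtrunc m H + r" by (simp add: r_def)
  have "msubst (mtrunc m H) g' - msubst (mtrunc m H) g =
      (\<Sum>\<alpha> | mdeg \<alpha> \<le> m. mconst (mcoeff H \<alpha>) * (mpow g' \<alpha> - mpow g \<alpha>))"
    by (simp add: mtrunc_def msubst_sum msubst_mmonom g0 g'0 sum_subtractf algebra_simps)
  also have "\<dots> \<in> J'" by (intro mideal_sum J' mon)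
  finally have tr: "msubst (mtrunc m H) g' - msubst (mtrunc m H) g \<in> J'" .
  have "msubst H g' - msubst H g =
      (msubst (mtrunc m H) g' - msubst (mtrunc m H) g) + (msubst r g' - msubst r g)"
    by (subst (1 2) H) (simp add: msubst_add)
  also have "\<dots> \<in> J'" by (intro mideal_add[OF J'] tr mideal_diff[OF J'] r)
  finally show ?thesis .
qed

text \<open>
  The part of a series in \<open>(x, y)\<close> that is linear in \<open>y\<close> with constant coefficients. What is left of
  \<open>F\<close> after subtracting it meets the condition on linear monomials in \<open>msubst_diff_in_ideal\<close>.
\<close>

definition ylin :: "('d::finite + 'n::finite) mfps \<Rightarrow> ('d + 'n) mfps" where
  "ylin G = (\<Sum>k\<in>UNIV. mconst (mcoeff G (munit (Inr k))) * mvar (Inr k))"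

lemma mcoeff_ylin: "mcoeff (G - ylin G) (munit (Inr k)) = 0"
  by (simp add: ylin_def mcoeff_mconst_mult) (simp add: mvar_def mcoeff_mmonom if_distrib cong: if_cong)

lemma mcoeff_ylin_0: "mcoeff (G - ylin G) 0 = mcoeff G 0"
  by (simp add: ylin_def mcoeff_mconst_mult)

lemma msubst_split_ylin:
  assumes "\<And>k. mcoeff (g k) 0 = 0"
  shows "msubst G g =
    (\<Sum>k\<in>UNIV. mconst (mcoeff G (munit (Inr k))) * g (Inr k)) + msubst (G - ylin G) g"
  using assms by (simp add: msubst_diff ylin_def msubst_sum msubst_mult)

lemma mconst_matrix_inverse:
  fixes \<mu> \<nu> :: "'n::finite \<Rightarrow> 'n \<Rightarrow> complex"
  assumes "\<And>i k. (\<Sum>l\<in>UNIV. \<nu> i l * \<mu> l k) = (if i = k then 1 else 0)"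
  shows "(\<Sum>l\<in>UNIV. mconst (\<nu> i l) * (\<Sum>k\<in>UNIV. mconst (\<mu> l k) * f k)) = f i"
proof (rule mfps_eqI)
  fix \<gamma> :: "'a \<Rightarrow> nat"
  have "mcoeff (\<Sum>l\<in>UNIV. mconst (\<nu> i l) * (\<Sum>k\<in>UNIV. mconst (\<mu> l k) * f k)) \<gamma> =
      (\<Sum>l\<in>UNIV. \<Sum>k\<in>UNIV. \<nu> i l * \<mu> l k * mcoeff (f k) \<gamma>)"
    by (simp add: mcoeff_mconst_mult sum_distrib_left mult.assoc)
  also have "\<dots> = (\<Sum>k\<in>UNIV. (\<Sum>l\<in>UNIV. \<nu> i l * \<mu> l k) * mcoeff (f k) \<gamma>)"
    by (subst sum.swap) (simp add: sum_distrib_right)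
  also have "\<dots> = mcoeff (f i) \<gamma>"
    by (simp add: assms if_distrib[of "\<lambda>x. x * _"] cong: if_cong)
  finally show "mcoeff (\<Sum>l\<in>UNIV. mconst (\<nu> i l) * (\<Sum>k\<in>UNIV. mconst (\<mu> l k) * f k)) \<gamma> =
      mcoeff (f i) \<gamma>" .
qed

lemma vfield_add: "vfield a (f + g) = vfield a f + vfield a g"
  by (simp add: vfield_def mpderiv_add algebra_simps sum.distrib)

lemma vfield_diff: "vfield a (f - g) = vfield a f - vfield a g"
  using vfield_add[of a "f - g" g] by simp

lemma vfield_mult: "vfield a (f * g) = vfield a f * g + f * vfield a g"
  by (simp add: vfield_def mpderiv_mult algebra_simps sum.distrib sum_distrib_left)

lemma vfield_vanish: "f \<in> mvanish (Suc m) \<Longrightarrow> vfield a f \<in> mvanish m"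
  unfolding vfield_def by (intro vanish_sum vanish_mult_right) (use mpderiv_vanish in fastforce)

text \<open>
  This is where the divisibility of \<open>L(P)\<close> by \<open>P\<close> matters for uniqueness: \<open>L\<close> preserves the ideals
  \<open>(P\<^sup>n)\<close>, although it may lower the order of a series.
\<close>

lemma vfield_power_mult:
  assumes "vfield a P = P * Q"
  shows "\<exists>v. vfield a (P ^ n * u) = P ^ n * v"
proof (induction n)
  case (Suc n)
  then obtain v where "vfield a (P ^ n * u) = P ^ n * v" by blast
  then have "vfield a (P ^ Suc n * u) = P ^ Suc n * (Q * u + v)"
    using assms by (simp add: vfield_mult algebra_simps)
  then show ?case by blast
qed auto

text \<open>
  The ideal generated by \<open>P\<^sup>n\<close> and the \<open>m\<close>-th power of the maximal ideal.
\<close>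

definition pideal :: "'d::finite mfps \<Rightarrow> nat \<Rightarrow> nat \<Rightarrow> 'd mfps set" where
  "pideal P n m = {P ^ n * u + v | u v. v \<in> mvanish m}"

lemma mideal_pideal: "mideal (pideal P n m)"
  unfolding mideal_def
proof (intro conjI ballI allI)
  show "0 \<in> pideal P n m"
    unfolding pideal_def by (rule CollectI, rule exI[of _ 0], rule exI[of _ 0]) (simp add: vanish_arith)
next
  fix f g assume "f \<in> pideal P n m" "g \<in> pideal P n m"
  then obtain u v u' v' where "f = P ^ n * u + v" "g = P ^ n * u' + v'" "v \<in> mvanish m" "v' \<in> mvanish m"
    unfolding pideal_def by blast
  then have "f + g = P ^ n * (u + u') + (v + v')" "v + v' \<in> mvanish m"
    by (auto simp: algebra_simps intro: vanish_arith)
  then show "f + g \<in> pideal P n m" unfolding pideal_def by blast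
next
  fix f g assume "g \<in> pideal P n m"
  then obtain u v where "g = P ^ n * u + v" "v \<in> mvanish m"
    unfolding pideal_def by blast
  then have "f * g = P ^ n * (f * u) + f * v" "f * v \<in> mvanish m"
    by (auto simp: algebra_simps intro: vanish_mult_right)
  then show "f * g \<in> pideal P n m" unfolding pideal_def by blast
qed

text \<open>
  The difference \<open>\<delta>\<close> of two solutions is \<open>\<nu> (P L(\<delta>) - h)\<close>, with \<open>h\<close> the difference of the nonlinear
  parts. The order of vanishing does not improve under \<open>P L\<close> in general: it may stay the same
  if \<open>P\<close> has a linear part and \<open>L\<close> a constant one. But \<open>P L\<close> improves the exponent \<open>n\<close> in
  \<open>(P\<^sup>n) + \<mm>\<^sup>m\<close>, where \<open>\<mm>\<close> is the maximal ideal, and \<open>h\<close> improves the exponent \<open>m\<close>. An induction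
  on \<open>m\<close>, for all \<open>n\<close> at once, with an inner induction on \<open>n\<close>, gives \<open>\<delta> \<in> (P\<^sup>n) + \<mm>\<^sup>m\<close> for
  all \<open>n\<close> and \<open>m\<close>. As \<open>P\<^sup>m\<close> lies in \<open>\<mm>\<^sup>m\<close>, the choice \<open>n = m\<close> yields \<open>\<delta> = 0\<close>.
\<close>

theorem formal_solution_unique:
  fixes G :: "'n::finite \<Rightarrow> ('d::finite + 'n) mfps" and y y' :: "'n \<Rightarrow> 'd mfps"
  assumes P0: "mcoeff P 0 = 0" and LP: "vfield a P = P * Q"
    and \<nu>: "\<And>i k. (\<Sum>l\<in>UNIV. \<nu> i l * mcoeff (G l) (munit (Inr k))) = (if i = k then 1 else 0)"
    and y0: "\<And>k. mcoeff (y k) 0 = 0" and y'0: "\<And>k. mcoeff (y' k) 0 = 0"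
    and sol: "\<And>k. msubst (G k) (case_sum mvar y) = P * vfield a (y k)"
    and sol': "\<And>k. msubst (G k) (case_sum mvar y') = P * vfield a (y' k)"
  shows "y' = y"
proof -
  define \<delta> where "\<delta> k = y' k - y k" for k
  define h where "h l = msubst (G l - ylin (G l)) (case_sum mvar y') -
    msubst (G l - ylin (G l)) (case_sum mvar y)" for l
  have z0: "mcoeff (case_sum mvar y k) 0 = 0" "mcoeff (case_sum mvar y' k) 0 = 0" for k
    using y0 y'0 by (auto split: sum.split)
  have eq: "\<delta> i = (\<Sum>l\<in>UNIV. mconst (\<nu> i l) * (P * vfield a (\<delta> l) - h l))" for i
  proof -
    have "(\<Sum>k\<in>UNIV. mconst (mcoeff (G l) (munit (Inr k))) * \<delta> k) = P * vfield a (\<delta> l) - h l" for l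
      using msubst_split_ylin[of "case_sum mvar y" "G l", OF z0(1)]
        msubst_split_ylin[of "case_sum mvar y'" "G l", OF z0(2)]
      unfolding sol sol' h_def \<delta>_def vfield_diff right_diff_distrib sum_subtractf
      by (simp add: algebra_simps)
    then show ?thesis using mconst_matrix_inverse[OF \<nu>, of i \<delta>] by simp
  qed
  have step_P: "P * vfield a f \<in> pideal P (Suc n) (Suc m)" if f: "f \<in> pideal P n (Suc m)" for f n m
  proof -
    obtain u v where f: "f = P ^ n * u + v" and v: "v \<in> mvanish (Suc m)"
      using f unfolding pideal_def by blast
    obtain w where w: "vfield a (P ^ n * u) = P ^ n * w"
      using vfield_power_mult[OF LP] by blast
    have "P * vfield a f = P ^ Suc n * w + P * vfield a v"
      by (simp add: f vfield_add w distrib_left mult.assoc)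
    moreover have "P * vfield a v \<in> mvanish (Suc m)"
      using vanish_mult[of P _ "Suc 0", OF _ vfield_vanish[OF v]] P0 by (simp add: mvanish_1_iff)
    ultimately show ?thesis unfolding pideal_def by blast
  qed
  have step_h: "h l \<in> pideal P n (Suc m)" if "\<And>k. \<delta> k \<in> pideal P n m" for l n m
    unfolding h_def
  proof (rule msubst_diff_in_ideal[OF mideal_pideal[of P n m] mideal_pideal[of P n "Suc m"]])
    show "f * u \<in> pideal P n (Suc m)" if f: "mcoeff f 0 = 0" and u: "u \<in> pideal P n m" for f u
    proof -
      obtain u' v where u: "u = P ^ n * u' + v" and v: "v \<in> mvanish m"
        using u unfolding pideal_def by blast
      have "f * v \<in> mvanish (Suc m)"
        using vanish_mult[of f _ "Suc 0", OF _ v] f by (simp add: mvanish_1_iff)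
      moreover have "f * u = P ^ n * (f * u') + f * v" by (simp add: u algebra_simps)
      ultimately show ?thesis unfolding pideal_def by blast
    qed
    show "mvanish (Suc m) \<subseteq> pideal P n (Suc m)"
    proof
      fix v :: "'d mfps" assume "v \<in> mvanish (Suc m)"
      moreover have "v = P ^ n * 0 + v" by simp
      ultimately show "v \<in> pideal P n (Suc m)" unfolding pideal_def by blast
    qed
    show "case_sum mvar y' k - case_sum mvar y k \<in> pideal P n m" for k
      using that mideal_0[OF mideal_pideal] by (auto simp: \<delta>_def split: sum.split)
    show "mcoeff (G l - ylin (G l)) (munit k) = 0" if "case_sum mvar y' k \<noteq> case_sum mvar y k" for k
      using that by (cases k) (auto simp del: mcoeff_arith simp: mcoeff_ylin)
  qed (rule z0)+
  have "\<forall>n k. \<delta> k \<in> pideal P n m" for m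
  proof (induction m)
    case 0
    have "f = P ^ n * 0 + f" for f n by simp
    then show ?case unfolding pideal_def using vanish_0 by blast
  next
    case (Suc m)
    have "\<forall>k. \<delta> k \<in> pideal P n (Suc m)" for n
    proof (induction n)
      case 0
      have "\<delta> k = P ^ 0 * \<delta> k + 0" for k by simp
      then show ?case unfolding pideal_def using vanish_arith(1) by blast
    next
      case (Suc n)
      show ?case
      proof
        fix i
        have "(\<Sum>l\<in>UNIV. mconst (\<nu> i l) * (P * vfield a (\<delta> l) - h l)) \<in> pideal P (Suc n) (Suc m)"
          using Suc \<open>\<forall>n k. \<delta> k \<in> pideal P n m\<close>
          by (intro mideal_sum mideal_mult mideal_diff mideal_pideal step_P step_h) auto
        then show "\<delta> i \<in> pideal P (Suc n) (Suc m)" using eq by metis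
      qed
    qed
    then show ?case by blast
  qed
  then have *: "\<delta> k \<in> pideal P m m" for k m by blast
  have "\<delta> k \<in> mvanish m" for k m
  proof -
    obtain u v where f: "\<delta> k = P ^ m * u + v" and v: "v \<in> mvanish m"
      using *[of k m] unfolding pideal_def by blast
    have "P ^ m \<in> mvanish m" for m
      by (induction m) (use P0 vanish_mult[of P _ "Suc 0"] in \<open>auto simp: mvanish_1_iff\<close>)
    then show ?thesis unfolding f using v
      by (intro vanish_arith) (auto simp: mult.commute intro: vanish_mult_right)
  qed
  then have "\<delta> k = 0" for k by (rule vanish_all_eq_0)
  then show ?thesis by (auto simp: \<delta>_def fun_eq_iff)
qed

section \<open>Weighted norms of formal power series\<close>

text \<open>
  The weighted \<open>\<ell>\<^sup>1\<close> norm of \<open>f\<close> is at most \<open>B\<close>. Stating it through finite partial sums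
  spares summability conditions and makes bounds stable under coefficientwise limits
  (\<open>wbound_limit\<close>).
\<close>

definition wbound :: "(('d::finite \<Rightarrow> nat) \<Rightarrow> real) \<Rightarrow> 'd mfps \<Rightarrow> real \<Rightarrow> bool" where
  "wbound w f B \<longleftrightarrow> (\<forall>A. finite A \<longrightarrow> (\<Sum>\<alpha>\<in>A. norm (mcoeff f \<alpha>) * w \<alpha>) \<le> B)"

lemma wboundD: "wbound w f B \<Longrightarrow> finite A \<Longrightarrow> (\<Sum>\<alpha>\<in>A. norm (mcoeff f \<alpha>) * w \<alpha>) \<le> B"
  by (simp add: wbound_def)

lemma wbound_nonneg: "wbound w f B \<Longrightarrow> 0 \<le> B"
  using wboundD[of w f B "{}"] by simp

lemma wbound_le: "wbound w f B \<Longrightarrow> B \<le> C \<Longrightarrow> wbound w f C"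
  unfolding wbound_def by (meson order_trans)

text \<open>
  For operators that move coefficients around injectively and multiply them by factors, it suffices to
  compare the weights term by term.
\<close>

lemma wbound_transport:
  assumes f: "wbound v f B" and "0 \<le> c"
    and zero: "\<And>\<gamma>. \<gamma> \<notin> S \<Longrightarrow> mcoeff g \<gamma> = 0" and inj: "inj_on \<phi> S"
    and le: "\<And>\<gamma>. \<gamma> \<in> S \<Longrightarrow> norm (mcoeff g \<gamma>) * w \<gamma> \<le> c * (norm (mcoeff f (\<phi> \<gamma>)) * v (\<phi> \<gamma>))"
  shows "wbound w g (c * B)"
  unfolding wbound_def
proof (intro allI impI)
  fix A :: "('b \<Rightarrow> nat) set" assume A: "finite A"
  have "(\<Sum>\<gamma>\<in>A. norm (mcoeff g \<gamma>) * w \<gamma>) = (\<Sum>\<gamma>\<in>A \<inter> S. norm (mcoeff g \<gamma>) * w \<gamma>)"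
    by (rule sum.mono_neutral_right) (use A zero in auto)
  also have "\<dots> \<le> (\<Sum>\<gamma>\<in>A \<inter> S. c * (norm (mcoeff f (\<phi> \<gamma>)) * v (\<phi> \<gamma>)))"
    by (rule sum_mono) (use le in auto)
  also have "\<dots> = c * (\<Sum>\<beta>\<in>\<phi> ` (A \<inter> S). norm (mcoeff f \<beta>) * v \<beta>)"
    by (subst sum.reindex) (auto intro: inj_on_subset[OF inj] simp: sum_distrib_left)
  also have "\<dots> \<le> c * B"
    by (intro mult_left_mono wboundD[OF f]) (use A assms(2) in auto)
  finally show "(\<Sum>\<gamma>\<in>A. norm (mcoeff g \<gamma>) * w \<gamma>) \<le> c * B" .
qed

lemma wbound_dominated:
  assumes "wbound v f B" "\<And>\<gamma>. norm (mcoeff g \<gamma>) * w \<gamma> \<le> norm (mcoeff f \<gamma>) * v \<gamma>"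
  shows "wbound w g B"
  using wbound_transport[OF assms(1), of 1 UNIV g id w] assms(2) by auto

lemma wbound_mconst_mult: "wbound w f B \<Longrightarrow> wbound w (mconst c * f) (norm c * B)"
  by (rule wbound_transport[where S = UNIV and \<phi> = id and f = f and v = w])
     (auto simp: mcoeff_mconst_mult norm_mult)

lemma wbound_uminus: "wbound w f B \<Longrightarrow> wbound w (- f) B"
  by (auto intro: wbound_dominated)

context
  fixes w :: "('d::finite \<Rightarrow> nat) \<Rightarrow> real"
  assumes w_nonneg: "\<And>\<alpha>. 0 \<le> w \<alpha>"
begin

lemma wbound_add:
  assumes "wbound w f B" "wbound w g C" shows "wbound w (f + g) (B + C)"
  unfolding wbound_def
proof (intro allI impI)
  fix A :: "('d \<Rightarrow> nat) set" assume A: "finite A"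
  have "(\<Sum>\<gamma>\<in>A. norm (mcoeff (f + g) \<gamma>) * w \<gamma>) \<le>
      (\<Sum>\<gamma>\<in>A. norm (mcoeff f \<gamma>) * w \<gamma> + norm (mcoeff g \<gamma>) * w \<gamma>)"
    by (intro sum_mono)
       (simp add: distrib_right[symmetric] mult_right_mono norm_triangle_ineq w_nonneg)
  also have "\<dots> \<le> B + C"
    unfolding sum.distrib by (intro add_mono wboundD A assms)
  finally show "(\<Sum>\<gamma>\<in>A. norm (mcoeff (f + g) \<gamma>) * w \<gamma>) \<le> B + C" .
qed

lemma wbound_diff: "wbound w f B \<Longrightarrow> wbound w g C \<Longrightarrow> wbound w (f - g) (B + C)"
  using wbound_add[of f B "- g" C] wbound_uminus[of w g C] by simp

lemma wbound_0: "wbound w 0 0"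
  by (simp add: wbound_def)

lemma wbound_sum:
  "finite I \<Longrightarrow> (\<And>i. i \<in> I \<Longrightarrow> wbound w (f i) (B i)) \<Longrightarrow> wbound w (\<Sum>i\<in>I. f i) (\<Sum>i\<in>I. B i)"
  by (induction I rule: finite_induct) (auto intro: wbound_0 wbound_add)

context
  assumes w_add: "\<And>\<alpha> \<beta>. w (\<alpha> + \<beta>) \<le> w \<alpha> * w \<beta>" and w_0: "w 0 \<le> 1"
begin

text \<open>
  A submultiplicative weight makes the norm submultiplicative: each product of coefficients that
  contributes to \<open>f * g\<close> occurs once in the product of the two norms.
\<close>

lemma wbound_mult:
  assumes f: "wbound w f B" and g: "wbound w g C" shows "wbound w (f * g) (B * C)"
  unfolding wbound_def
proof (intro allI impI)
  fix A :: "('d \<Rightarrow> nat) set" assume A: "finite A"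
  define S where "S \<gamma> = {(\<alpha>, \<beta>). \<alpha> + \<beta> = (\<gamma> :: 'd \<Rightarrow> nat)}" for \<gamma>
  define T where "T = (\<Union>\<gamma>\<in>A. S \<gamma>)"
  have finS: "finite (S \<gamma>)" for \<gamma> unfolding S_def by (rule finite_midx_antidiag)
  then have finT: "finite T" unfolding T_def using A by simp
  let ?F = "\<lambda>\<alpha>. norm (mcoeff f \<alpha>) * w \<alpha>" and ?G = "\<lambda>\<beta>. norm (mcoeff g \<beta>) * w \<beta>"
  have "(\<Sum>\<gamma>\<in>A. norm (mcoeff (f * g) \<gamma>) * w \<gamma>) \<le> (\<Sum>\<gamma>\<in>A. \<Sum>p\<in>S \<gamma>. ?F (fst p) * ?G (snd p))"
  proof (rule sum_mono)
    fix \<gamma>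
    have "norm (mcoeff (f * g) \<gamma>) * w \<gamma> \<le>
        (\<Sum>p\<in>S \<gamma>. norm (mcoeff f (fst p) * mcoeff g (snd p))) * w \<gamma>"
      unfolding mcoeff_mult S_def case_prod_unfold
      by (intro mult_right_mono norm_sum w_nonneg)
    also have "\<dots> = (\<Sum>p\<in>S \<gamma>. norm (mcoeff f (fst p)) * norm (mcoeff g (snd p)) * w (fst p + snd p))"
      unfolding sum_distrib_right by (rule sum.cong) (auto simp: S_def norm_mult)
    also have "\<dots> \<le> (\<Sum>p\<in>S \<gamma>. norm (mcoeff f (fst p)) * norm (mcoeff g (snd p)) * (w (fst p) * w (snd p)))"
      by (intro sum_mono mult_left_mono w_add) auto
    finally show "norm (mcoeff (f * g) \<gamma>) * w \<gamma> \<le> (\<Sum>p\<in>S \<gamma>. ?F (fst p) * ?G (snd p))"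
      by (simp add: ac_simps)
  qed
  also have "\<dots> = (\<Sum>p\<in>T. ?F (fst p) * ?G (snd p))"
    unfolding T_def by (rule sum.UNION_disjoint[symmetric]) (use A finS in \<open>auto simp: S_def\<close>)
  also have "\<dots> \<le> (\<Sum>p\<in>fst ` T \<times> snd ` T. ?F (fst p) * ?G (snd p))"
    by (rule sum_mono2) (use finT w_nonneg in \<open>auto intro!: mult_nonneg_nonneg rev_image_eqI\<close>)
  also have "\<dots> = (\<Sum>\<alpha>\<in>fst ` T. ?F \<alpha>) * (\<Sum>\<beta>\<in>snd ` T. ?G \<beta>)"
    by (simp add: sum_product sum.cartesian_product case_prod_unfold)
  also have "\<dots> \<le> B * C"
    by (intro mult_mono wboundD f g sum_nonneg mult_nonneg_nonneg w_nonneg wbound_nonneg[OF f])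
       (use finT in auto)
  finally show "(\<Sum>\<gamma>\<in>A. norm (mcoeff (f * g) \<gamma>) * w \<gamma>) \<le> B * C" .
qed

lemma wbound_1: "wbound w 1 1"
  unfolding wbound_def
proof (intro allI impI)
  fix A :: "('d \<Rightarrow> nat) set" assume "finite A"
  then have "(\<Sum>\<gamma>\<in>A. norm (mcoeff 1 \<gamma>) * w \<gamma>) = (\<Sum>\<gamma>\<in>A. if \<gamma> = 0 then w \<gamma> else 0)"
    by (intro sum.cong) (auto simp: one_mfps.rep_eq)
  also have "\<dots> \<le> 1" using \<open>finite A\<close> w_0 by simp
  finally show "(\<Sum>\<gamma>\<in>A. norm (mcoeff 1 \<gamma>) * w \<gamma>) \<le> 1" .
qed

lemma wbound_power: "wbound w f B \<Longrightarrow> wbound w (f ^ n) (B ^ n)"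
  by (induction n) (simp_all add: wbound_1 wbound_mult)

lemma wbound_prod:
  "finite I \<Longrightarrow> (\<And>i. i \<in> I \<Longrightarrow> wbound w (f i) (B i)) \<Longrightarrow> wbound w (\<Prod>i\<in>I. f i) (\<Prod>i\<in>I. B i)"
  by (induction I rule: finite_induct) (auto intro: wbound_1 wbound_mult)

text \<open>
  The norm of \<open>G(g)\<close> is at most the norm of \<open>G\<close> itself, taken with the norms of the \<open>g k\<close> as radii.
\<close>

lemma wbound_msubst:
  fixes G :: "'k::finite mfps"
  assumes G: "wbound (\<lambda>\<alpha>. \<Prod>k\<in>UNIV. B k ^ \<alpha> k) G K" and g: "\<And>k. wbound w (g k) (B k)"
  shows "wbound w (msubst G g) K"
  unfolding wbound_def
proof (intro allI impI)
  fix A :: "('d \<Rightarrow> nat) set" assume A: "finite A"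
  define m where "m = Max (insert 0 (mdeg ` A))"
  have m: "mdeg \<gamma> \<le> m" if "\<gamma> \<in> A" for \<gamma>
    using A that by (auto simp: m_def intro!: Max_ge)
  have "(\<Sum>\<gamma>\<in>A. norm (mcoeff (msubst G g) \<gamma>) * w \<gamma>) \<le>
      (\<Sum>\<gamma>\<in>A. \<Sum>\<alpha> | mdeg \<alpha> \<le> m. norm (mcoeff G \<alpha>) * norm (mcoeff (mpow g \<alpha>) \<gamma>) * w \<gamma>)"
  proof (rule sum_mono)
    fix \<gamma> assume \<gamma>: "\<gamma> \<in> A"
    have "norm (mcoeff (msubst G g) \<gamma>) \<le>
        (\<Sum>\<alpha> | mdeg \<alpha> \<le> mdeg \<gamma>. norm (mcoeff G \<alpha>) * norm (mcoeff (mpow g \<alpha>) \<gamma>))"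
      unfolding mcoeff_msubst norm_mult[symmetric] by (rule norm_sum)
    also have "\<dots> \<le> (\<Sum>\<alpha> | mdeg \<alpha> \<le> m. norm (mcoeff G \<alpha>) * norm (mcoeff (mpow g \<alpha>) \<gamma>))"
      by (rule sum_mono2) (use m[OF \<gamma>] finite_mdeg_le in auto)
    finally show "norm (mcoeff (msubst G g) \<gamma>) * w \<gamma> \<le>
        (\<Sum>\<alpha> | mdeg \<alpha> \<le> m. norm (mcoeff G \<alpha>) * norm (mcoeff (mpow g \<alpha>) \<gamma>) * w \<gamma>)"
      unfolding sum_distrib_right[symmetric] by (rule mult_right_mono) (rule w_nonneg)
  qed
  also have "\<dots> = (\<Sum>\<alpha> | mdeg \<alpha> \<le> m. norm (mcoeff G \<alpha>) *
      (\<Sum>\<gamma>\<in>A. norm (mcoeff (mpow g \<alpha>) \<gamma>) * w \<gamma>))"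
    by (subst sum.swap) (simp add: sum_distrib_left mult.assoc)
  also have "\<dots> \<le> (\<Sum>\<alpha> | mdeg \<alpha> \<le> m. norm (mcoeff G \<alpha>) * (\<Prod>k\<in>UNIV. B k ^ \<alpha> k))"
    by (intro sum_mono mult_left_mono wboundD A) (auto simp: mpow_def intro!: wbound_prod wbound_power g)
  also have "\<dots> \<le> K" by (rule wboundD[OF G finite_mdeg_le])
  finally show "(\<Sum>\<gamma>\<in>A. norm (mcoeff (msubst G g) \<gamma>) * w \<gamma>) \<le> K" .
qed

end

end

definition rwt :: "real \<Rightarrow> ('d::finite \<Rightarrow> nat) \<Rightarrow> real" where
  "rwt R \<alpha> = R ^ mdeg \<alpha>"

lemma rwt_conv_prod: "rwt R \<alpha> = (\<Prod>k\<in>UNIV. R ^ \<alpha> k)"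
  by (simp add: rwt_def mdeg_conv_sum power_sum)

lemma wbound_rwt_mono:
  assumes "wbound (rwt R) f B" "0 \<le> r" "r \<le> R" shows "wbound (rwt r) f B"
  using assms by (auto intro!: wbound_dominated[OF assms(1)] mult_left_mono power_mono simp: rwt_def)

text \<open>
  The weight \<open>\<rho>\<^bsup>|\<alpha>|\<^esup> \<tau>\<^sup>n |\<alpha>|! / (n + |\<alpha>|)!\<close> of the monomial \<open>t\<^sup>n x\<^sup>\<alpha>\<close>. The new variable \<open>t\<close> is the
  index \<open>None\<close> and \<open>x\<^sub>j\<close> is the index \<open>Some j\<close>. Up to factors \<open>2\<^bsup>n + |\<alpha>|\<^esup>\<close> the last quotient is
  \<open>1 / n!\<close>, so a finite norm means growth of Gevrey order one in \<open>t\<close>; the form chosen here is the one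
  for which \<open>t \<partial>/\<partial>x\<^sub>j\<close> is bounded without shrinking \<open>\<rho>\<close>.
\<close>

definition gwt :: "real \<Rightarrow> real \<Rightarrow> ('d::finite option \<Rightarrow> nat) \<Rightarrow> real" where
  "gwt \<rho> \<tau> \<gamma> = \<rho> ^ mdeg (\<lambda>j. \<gamma> (Some j)) * \<tau> ^ \<gamma> None *
     (fact (mdeg (\<lambda>j. \<gamma> (Some j))) / fact (\<gamma> None + mdeg (\<lambda>j. \<gamma> (Some j))))"

lemma gwt_nonneg: "0 \<le> \<rho> \<Longrightarrow> 0 \<le> \<tau> \<Longrightarrow> 0 \<le> gwt \<rho> \<tau> \<gamma>"
  by (simp add: gwt_def)

lemma gwt_0 [simp]: "gwt \<rho> \<tau> 0 = 1"
proof -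
  have "(\<lambda>j. (0 :: 'd option \<Rightarrow> nat) (Some j)) = 0" by (simp add: midx_eq)
  then show ?thesis unfolding gwt_def \<open>_ = 0\<close> by (simp add: zero_fun_apply)
qed

text \<open>
  This is the inequality \<open>(a + b choose a) \<le> (a + b + n + m choose a + n)\<close> between binomial coefficients
  with denominators cleared, which is what submultiplicativity of the weight amounts to.
\<close>

lemma fact_mult_le:
  "fact (a + n) * fact (b + m) * fact (a + b) \<le> (fact a * fact b * fact (a + b + n + m) :: real)"
proof (induction n)
  case 0
  show ?case
  proof (induction m)
    case (Suc m)
    have "real (b + m + 1) * (fact (a + 0) * fact (b + m) * fact (a + b)) \<le>
        real (a + b + m + 1) * (fact a * fact b * fact (a + b + 0 + m))"
      by (intro mult_mono Suc) auto
    then show ?case by (simp add: algebra_simps)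
  qed simp
next
  case (Suc n)
  have "real (a + n + 1) * (fact (a + n) * fact (b + m) * fact (a + b)) \<le>
      real (a + b + n + m + 1) * (fact a * fact b * fact (a + b + n + m))"
    by (intro mult_mono Suc) auto
  then show ?case by (simp add: algebra_simps)
qed

lemma gwt_add:
  assumes "0 \<le> \<rho>" "0 \<le> \<tau>" shows "gwt \<rho> \<tau> (\<alpha> + \<beta>) \<le> gwt \<rho> \<tau> \<alpha> * gwt \<rho> \<tau> \<beta>"
proof -
  define a b n m where a_b_n_m_def: "a = mdeg (\<lambda>j. \<alpha> (Some j))" "b = mdeg (\<lambda>j. \<beta> (Some j))"
    "n = \<alpha> None" "m = \<beta> None"
  have "(\<lambda>j. (\<alpha> + \<beta>) (Some j)) = (\<lambda>j. \<alpha> (Some j)) + (\<lambda>j. \<beta> (Some j))" by (simp add: midx_eq)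
  then have ab: "mdeg (\<lambda>j. (\<alpha> + \<beta>) (Some j)) = a + b" by (simp add: a_b_n_m_def)
  have nm: "(\<alpha> + \<beta>) None = n + m" by (simp add: a_b_n_m_def plus_fun_apply)
  have "fact (a + b) / fact (n + m + (a + b)) \<le> (fact a / fact (n + a)) * (fact b / fact (m + b) :: real)"
    using fact_mult_le[of a n b m] by (simp add: field_simps add_ac)
  then have "\<rho> ^ (a + b) * \<tau> ^ (n + m) * (fact (a + b) / fact (n + m + (a + b))) \<le>
      \<rho> ^ (a + b) * \<tau> ^ (n + m) * ((fact a / fact (n + a)) * (fact b / fact (m + b)))"
    using assms by (intro mult_left_mono) auto
  then show ?thesis
    unfolding gwt_def ab nm a_b_n_m_def[symmetric] by (simp add: power_add mult_ac)
qed

lemma mcoeff_mvar_mult_add: "mcoeff (mvar k * f) (munit k + \<beta>) = mcoeff f \<beta>"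
  unfolding mvar_def mcoeff_mmonom_mult_add by simp

text \<open>
  The coefficient at \<open>t\<^bsup>n + 1\<^esup> x\<^sup>\<beta>\<close> of the new series is \<open>\<beta>\<^sub>j + 1\<close> times an old one at
  \<open>t\<^sup>n x\<^sup>\<beta> x\<^sub>j\<close>. The denominators \<open>(n + 1 + |\<beta>|)!\<close> of the two weights coincide, and the numerators
  \<open>|\<beta>|!\<close> and \<open>(|\<beta>| + 1)!\<close> absorb the factor.
\<close>

lemma wbound_t_mpderiv_Some:
  assumes "0 < \<rho>" "0 < \<tau>" and f: "wbound (gwt \<rho> \<tau>) f B"
  shows "wbound (gwt \<rho> \<tau>) (mvar None * mpderiv (Some j) f) (\<tau> / \<rho> * B)"
proof (rule wbound_transport[OF f, where S = "range (\<lambda>\<beta>. munit None + \<beta>)"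
      and \<phi> = "\<lambda>\<gamma>. \<gamma>(None := \<gamma> None - 1) + munit (Some j)"])
  have upd: "(munit None + \<beta>)(None := (munit None + \<beta>) None - 1) = \<beta>" for \<beta> :: "'a option \<Rightarrow> nat"
    by (auto simp: midx_eq munit_def)
  show "inj_on (\<lambda>\<gamma>. \<gamma>(None := \<gamma> None - 1) + munit (Some j)) (range (\<lambda>\<beta>. munit None + \<beta>))"
    by (rule inj_onI) (clarsimp simp only: upd add_right_cancel)
  show "mcoeff (mvar None * mpderiv (Some j) f) \<gamma> = 0" if "\<gamma> \<notin> range (\<lambda>\<beta>. munit None + \<beta>)" for \<gamma>
    using that unfolding mvar_def by (intro mcoeff_mmonom_mult_eq_0) auto
  fix \<gamma> :: "'a option \<Rightarrow> nat" assume "\<gamma> \<in> range (\<lambda>\<beta>. munit None + \<beta>)"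
  then obtain \<beta> where \<gamma>: "\<gamma> = munit None + \<beta>" by blast
  define a n where "a = mdeg (\<lambda>j. \<beta> (Some j))" and "n = \<beta> None"
  have "(\<lambda>i. (\<beta> + munit (Some j)) (Some i)) = (\<lambda>i. \<beta> (Some i)) + munit j"
    by (auto simp: midx_eq munit_def)
  then have a1: "mdeg (\<lambda>i. (\<beta> + munit (Some j)) (Some i)) = Suc a" by (simp add: a_def)
  have a2: "mdeg (\<lambda>i. (munit None + \<beta>) (Some i)) = a"
    by (simp add: a_def plus_fun_apply munit_def)
  have n1: "(munit None + \<beta>) None = Suc n" "(\<beta> + munit (Some j)) None = n"
    by (simp_all add: n_def plus_fun_apply munit_def)
  have le: "real (Suc (\<beta> (Some j))) \<le> real (Suc a)"
    using le_mdeg[of "\<lambda>i. \<beta> (Some i)" j] by (simp add: a_def)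
  have "real (Suc (\<beta> (Some j))) * gwt \<rho> \<tau> \<gamma> =
      real (Suc (\<beta> (Some j))) * (\<rho> ^ a * \<tau> ^ Suc n * (fact a / fact (Suc n + a)))"
    by (simp add: gwt_def \<gamma> a2 n1)
  also have "\<dots> \<le> real (Suc a) * (\<rho> ^ a * \<tau> ^ Suc n * (fact a / fact (Suc n + a)))"
    by (intro mult_right_mono le) (use assms in auto)
  also have "\<dots> = \<tau> / \<rho> * gwt \<rho> \<tau> (\<beta> + munit (Some j))"
  proof -
    have "fact (Suc a) = real (Suc a) * fact a" "n + Suc a = Suc n + a" by simp_all
    then show ?thesis unfolding gwt_def a1 n1 using assms(1) by (simp del: fact_Suc)
  qed
  finally have "norm (mcoeff f (\<beta> + munit (Some j))) * (real (Suc (\<beta> (Some j))) * gwt \<rho> \<tau> \<gamma>) \<le>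
      norm (mcoeff f (\<beta> + munit (Some j))) * (\<tau> / \<rho> * gwt \<rho> \<tau> (\<beta> + munit (Some j)))"
    by (rule mult_left_mono) simp
  then show "norm (mcoeff (mvar None * mpderiv (Some j) f) \<gamma>) * gwt \<rho> \<tau> \<gamma> \<le> \<tau> / \<rho> *
      (norm (mcoeff f (\<gamma>(None := \<gamma> None - 1) + munit (Some j))) *
       gwt \<rho> \<tau> (\<gamma>(None := \<gamma> None - 1) + munit (Some j)))"
    unfolding \<gamma> upd mcoeff_mvar_mult_add mcoeff_mpderiv norm_mult norm_of_nat by (simp only: ac_simps)
qed (use assms in simp)

text \<open>
  Here the factor \<open>n + 1\<close> produced by \<open>\<partial>/\<partial>t\<close> is absorbed by the denominator, which the net gain of
  one power of \<open>t\<close> multiplies by \<open>n + 2 + |\<alpha>|\<close>.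
\<close>

lemma wbound_t2_mpderiv_None:
  fixes f :: "'d::finite option mfps"
  assumes "0 < \<rho>" "0 < \<tau>" and f: "wbound (gwt \<rho> \<tau>) f B"
  shows "wbound (gwt \<rho> \<tau>) (mvar None * (mvar None * mpderiv None f)) (\<tau> * B)"
proof (rule wbound_transport[OF f, where S = "range (\<lambda>\<beta>. munit None + (munit None + \<beta>))"
      and \<phi> = "\<lambda>\<gamma>. \<gamma>(None := \<gamma> None - 1)"])
  have upd: "(munit None + \<beta>)(None := (munit None + \<beta>) None - 1) = \<beta>" for \<beta> :: "'d option \<Rightarrow> nat"
    by (auto simp: midx_eq munit_def)
  show "inj_on (\<lambda>\<gamma> :: 'd option \<Rightarrow> nat. \<gamma>(None := \<gamma> None - 1)) (range (\<lambda>\<beta>. munit None + (munit None + \<beta>)))"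
    by (rule inj_onI, elim rangeE) (metis upd)
  show "mcoeff (mvar None * (mvar None * mpderiv None f)) \<gamma> = 0"
    if \<gamma>: "\<gamma> \<notin> range (\<lambda>\<beta>. munit None + (munit None + \<beta>))" for \<gamma>
  proof (cases "\<exists>\<beta>. \<gamma> = munit None + \<beta>")
    case True
    then obtain \<beta> where \<beta>: "\<gamma> = munit None + \<beta>" by blast
    have "mcoeff (mvar None * mpderiv None f) \<beta> = 0"
      unfolding mvar_def by (rule mcoeff_mmonom_mult_eq_0) (use \<gamma> \<beta> in auto)
    then show ?thesis by (simp add: \<beta> mcoeff_mvar_mult_add)
  next
    case False
    then show ?thesis unfolding mvar_def by (intro mcoeff_mmonom_mult_eq_0) auto
  qed
  fix \<gamma> :: "'d option \<Rightarrow> nat" assume "\<gamma> \<in> range (\<lambda>\<beta>. munit None + (munit None + \<beta>))"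
  then obtain \<beta> where \<gamma>: "\<gamma> = munit None + (munit None + \<beta>)" by blast
  define a n where "a = mdeg (\<lambda>j. \<beta> (Some j))" and "n = \<beta> None"
  have a: "mdeg (\<lambda>i. \<gamma> (Some i)) = a" "mdeg (\<lambda>i. (munit None + \<beta>) (Some i)) = a"
    by (simp_all add: a_def \<gamma> plus_fun_apply munit_def)
  have n: "\<gamma> None = Suc (Suc n)" "(munit None + \<beta>) None = Suc n"
    by (simp_all add: n_def \<gamma> plus_fun_apply munit_def)
  have "real (Suc n) * gwt \<rho> \<tau> \<gamma> =
      (\<rho> ^ a * \<tau> ^ Suc (Suc n) * fact a / fact (Suc n + a)) * (real (Suc n) / real (Suc (Suc n + a)))"
    by (simp add: gwt_def a n divide_simps)
  also have "\<dots> \<le> (\<rho> ^ a * \<tau> ^ Suc (Suc n) * fact a / fact (Suc n + a)) * 1"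
    by (rule mult_left_mono) (use assms in auto)
  also have "\<dots> = \<tau> * gwt \<rho> \<tau> (munit None + \<beta>)"
    by (simp add: gwt_def a n)
  finally have "norm (mcoeff f (munit None + \<beta>)) * (real (Suc n) * gwt \<rho> \<tau> \<gamma>) \<le>
      norm (mcoeff f (munit None + \<beta>)) * (\<tau> * gwt \<rho> \<tau> (munit None + \<beta>))"
    by (rule mult_left_mono) simp
  then show "norm (mcoeff (mvar None * (mvar None * mpderiv None f)) \<gamma>) * gwt \<rho> \<tau> \<gamma> \<le>
      \<tau> * (norm (mcoeff f (\<gamma>(None := \<gamma> None - 1))) * gwt \<rho> \<tau> (\<gamma>(None := \<gamma> None - 1)))"
    unfolding \<gamma> upd mcoeff_mvar_mult_add mcoeff_mpderiv norm_mult norm_of_nat n_def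
    by (simp only: ac_simps)
qed (use assms in simp)

lemma wbound_mvar_Some:
  assumes "0 \<le> \<rho>" shows "wbound (gwt \<rho> \<tau>) (mvar (Some j)) \<rho>"
  unfolding wbound_def
proof (intro allI impI)
  fix A :: "('a option \<Rightarrow> nat) set" assume A: "finite A"
  have "(\<lambda>i. munit (Some j) (Some i)) = munit j" by (auto simp: munit_def fun_eq_iff)
  then have "gwt \<rho> \<tau> (munit (Some j)) = \<rho>"
    by (simp add: gwt_def munit_other)
  then have "(\<Sum>\<gamma>\<in>A. norm (mcoeff (mvar (Some j)) \<gamma>) * gwt \<rho> \<tau> \<gamma>) =
      (\<Sum>\<gamma>\<in>A. if \<gamma> = munit (Some j) then \<rho> else 0)"
    by (intro sum.cong) (auto simp: mvar_def mcoeff_mmonom)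
  also have "\<dots> \<le> \<rho>" using A assms by simp
  finally show "(\<Sum>\<gamma>\<in>A. norm (mcoeff (mvar (Some j)) \<gamma>) * gwt \<rho> \<tau> \<gamma>) \<le> \<rho>" .
qed

definition tcoeff :: "nat \<Rightarrow> 'd::finite option mfps \<Rightarrow> 'd mfps" where
  "tcoeff n f = Abs_mfps (\<lambda>\<alpha>. mcoeff f (case_option n \<alpha>))"

lemma mcoeff_tcoeff: "mcoeff (tcoeff n f) \<alpha> = mcoeff f (case_option n \<alpha>)"
  unfolding tcoeff_def by (simp add: Abs_mfps_inverse)

text \<open>
  The passage from the norm in \<open>(t, x)\<close> to bounds for the coefficients of \<open>t\<^sup>n\<close>: from
  \<open>(n + |\<alpha>| choose n) \<le> 2\<^bsup>n + |\<alpha>|\<^esup>\<close> one gets the factor \<open>n! (2/\<tau>)\<^sup>n\<close>, at the price of half of the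
  radius in \<open>x\<close>.
\<close>

lemma wbound_tcoeff:
  assumes "0 < \<rho>" "0 < \<tau>" and f: "wbound (gwt \<rho> \<tau>) f B"
  shows "wbound (rwt (\<rho> / 2)) (tcoeff n f) (fact n * (2 / \<tau>) ^ n * B)"
proof (rule wbound_transport[OF f, where S = UNIV and \<phi> = "\<lambda>\<alpha>. case_option n \<alpha>"])
  show "inj (\<lambda>\<alpha>. case_option n \<alpha>)"
    by (rule injI) (metis option.simps(5) ext)
  fix \<alpha> :: "'a \<Rightarrow> nat"
  define a where "a = mdeg \<alpha>"
  have "real ((n + a) choose n) \<le> 2 ^ (n + a)"
    using binomial_le_pow2[of "n + a" n] of_nat_le_iff[of "(n + a) choose n" "2 ^ (n + a)", where ?'a = real]
    by (simp del: of_nat_le_iff)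
  then have "fact a * fact n * real ((n + a) choose n) \<le> fact a * fact n * 2 ^ (n + a)"
    by (intro mult_left_mono) auto
  moreover have "fact a * fact n * real ((n + a) choose n) = fact (n + a)"
    by (subst binomial_fact) auto
  ultimately have "fact (n + a) \<le> (fact a * fact n * 2 ^ (n + a) :: real)" by simp
  then have 1: "(1::real) / 2 ^ a \<le> fact n * 2 ^ n * (fact a / fact (n + a))"
    by (simp add: field_simps power_add)
  have "rwt (\<rho> / 2) \<alpha> = \<rho> ^ a * (1 / 2 ^ a)"
    by (simp add: rwt_def a_def power_divide)
  also have "\<dots> \<le> \<rho> ^ a * (fact n * 2 ^ n * (fact a / fact (n + a)))"
    by (rule mult_left_mono[OF 1]) (use assms in simp)
  also have "\<dots> = fact n * (2 / \<tau>) ^ n * gwt \<rho> \<tau> (case_option n \<alpha>)"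
    using assms by (simp add: gwt_def a_def power_divide field_simps)
  finally have "norm (mcoeff f (case_option n \<alpha>)) * rwt (\<rho> / 2) \<alpha> \<le>
      norm (mcoeff f (case_option n \<alpha>)) * (fact n * (2 / \<tau>) ^ n * gwt \<rho> \<tau> (case_option n \<alpha>))"
    by (rule mult_left_mono) simp
  then show "norm (mcoeff (tcoeff n f) \<alpha>) * rwt (\<rho> / 2) \<alpha> \<le> fact n * (2 / \<tau>) ^ n *
      (norm (mcoeff f (case_option n \<alpha>)) * gwt \<rho> \<tau> (case_option n \<alpha>))"
    by (simp add: mcoeff_tcoeff ac_simps)
qed (use assms in \<open>auto\<close>)

section \<open>The equation with the additional variable\<close>

definition emb :: "'d::finite mfps \<Rightarrow> 'd option mfps" where
  "emb f = msubst f (\<lambda>i. mvar (Some i))"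

text \<open>
  The operator \<open>t L + t\<^sup>2 Q \<partial>/\<partial>t\<close>. The powers of \<open>t\<close> are kept next to the derivatives because only
  these combinations are bounded.
\<close>

definition lifted_op :: "('d::finite \<Rightarrow> 'd mfps) \<Rightarrow> 'd mfps \<Rightarrow> 'd option mfps \<Rightarrow> 'd option mfps" where
  "lifted_op a Q f = (\<Sum>j\<in>UNIV. emb (a j) * (mvar None * mpderiv (Some j) f)) +
     emb Q * (mvar None * (mvar None * mpderiv None f))"

definition lifted_args :: "('n \<Rightarrow> 'd option mfps) \<Rightarrow> 'd + 'n \<Rightarrow> 'd option mfps" where
  "lifted_args Y = case_sum (\<lambda>i. mvar (Some i)) Y"

lemma lifted_args_0: "(\<And>k. mcoeff (Y k) 0 = 0) \<Longrightarrow> mcoeff (lifted_args Y k) 0 = 0"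
  by (simp add: lifted_args_def split: sum.split)

lemma lifted_op_diff: "lifted_op a Q (f - g) = lifted_op a Q f - lifted_op a Q g"
proof -
  have "mpderiv j (f - g) = mpderiv j f - mpderiv j g" for j
    using mpderiv_add[of j "f - g" g] by simp
  then show ?thesis by (simp add: lifted_op_def right_diff_distrib sum_subtractf)
qed

lemma mcoeff_lifted_op_0 [simp]: "mcoeff (lifted_op a Q f) 0 = 0"
  by (simp add: lifted_op_def mcoeff_mult_0)

lemma case_option_mvar_0: "mcoeff P 0 = 0 \<Longrightarrow> mcoeff (case_option P mvar k) 0 = 0"
  by (simp split: option.split)

lemma msubst_emb:
  assumes "mcoeff P 0 = 0"
  shows "msubst (emb f) (case_option P mvar) = f"
  unfolding emb_def
  by (subst msubst_msubst) (simp_all add: case_option_mvar_0 assms msubst_mvar_id)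

text \<open>
  Under \<open>t = P(x)\<close> the chain rule gives \<open>L(f(P, x)) = (L f)(P, x) + (\<partial>f/\<partial>t)(P, x) L(P)\<close>, and
  \<open>L(P) = P Q\<close> supplies the second factor \<open>t\<close>.
\<close>

lemma msubst_lifted_op:
  fixes P :: "'d::finite mfps"
  assumes P0: "mcoeff P 0 = 0" and LP: "vfield a P = P * Q"
  shows "msubst (lifted_op a Q f) (case_option P mvar) = P * vfield a (msubst f (case_option P mvar))"
proof -
  let ?\<sigma> = "case_option P mvar"
  note \<sigma>0 = case_option_mvar_0[OF P0]
  define D where "D k = msubst (mpderiv k f) ?\<sigma>" for k
  have "mpderiv j (msubst f ?\<sigma>) = D (Some j) + D None * mpderiv j P" for j
  proof -
    have "mpderiv j (msubst f ?\<sigma>) = D None * mpderiv j P + (\<Sum>i\<in>UNIV. D (Some i) * mpderiv j (mvar i))"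
      unfolding mpderiv_msubst[OF \<sigma>0] UNIV_option_conv D_def
      by (subst sum.insert) (auto simp: sum.reindex)
    also have "(\<Sum>i\<in>UNIV. D (Some i) * mpderiv j (mvar i)) = (\<Sum>i\<in>UNIV. if i = j then D (Some i) else 0)"
      by (rule sum.cong) (auto simp: mpderiv_mvar)
    finally show ?thesis by simp
  qed
  then have "vfield a (msubst f ?\<sigma>) = (\<Sum>j\<in>UNIV. a j * D (Some j)) + D None * vfield a P"
    by (simp add: vfield_def algebra_simps sum.distrib sum_distrib_left)
  then have "P * vfield a (msubst f ?\<sigma>) = (\<Sum>j\<in>UNIV. a j * (P * D (Some j))) + Q * (P * (P * D None))"
    by (simp add: LP algebra_simps sum_distrib_left)
  then show ?thesis
    by (simp add: lifted_op_def msubst_add msubst_sum msubst_mult[OF \<sigma>0] msubst_emb[OF P0]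
        msubst_mvar[OF \<sigma>0] D_def)
qed

subsection \<open>Formal solution by iteration\<close>

text \<open>
  The right-hand side of \<open>Y = \<nu> (t L(Y) + t\<^sup>2 Q \<partial>Y/\<partial>t - H(x, Y))\<close>, where \<open>H\<close> is \<open>F\<close> without the
  terms that are linear in \<open>y\<close> with constant coefficients.
\<close>

definition picard ::
  "('d::finite \<Rightarrow> 'd mfps) \<Rightarrow> 'd mfps \<Rightarrow> ('n::finite \<Rightarrow> ('d + 'n) mfps) \<Rightarrow> ('n \<Rightarrow> 'n \<Rightarrow> complex) \<Rightarrow>
   ('n \<Rightarrow> 'd option mfps) \<Rightarrow> 'n \<Rightarrow> 'd option mfps" where
  "picard a Q G \<nu> Y i = (\<Sum>l\<in>UNIV. mconst (\<nu> i l) *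
     (lifted_op a Q (Y l) - msubst (G l - ylin (G l)) (lifted_args Y)))"

text \<open>
  With \<open>t\<close> of weight 2, the operator \<open>t \<partial>/\<partial>x\<^sub>j\<close> raises the order by one; with the ordinary degree it
  would only preserve it.
\<close>

definition twt :: "'d option \<Rightarrow> nat" where
  "twt k = (case k of None \<Rightarrow> 2 | Some _ \<Rightarrow> Suc 0)"

lemma lifted_op_vanish:
  assumes "f \<in> vanish twt m" shows "lifted_op a Q f \<in> vanish twt (Suc m)"
proof -
  have t: "mvar None \<in> vanish twt 2" using mvar_vanish[of None twt] by (simp add: twt_def)
  have "mvar None * mpderiv (Some j) f \<in> vanish twt (Suc m)" for j
    using vanish_mult[OF t mpderiv_vanish[OF assms, of "Some j"]]
    by (rule vanish_mono[rotated]) (simp add: twt_def)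
  moreover have "mvar None * (mvar None * mpderiv None f) \<in> vanish twt (Suc m)"
    using vanish_mult[OF t vanish_mult[OF t mpderiv_vanish[OF assms, of None]]]
    by (rule vanish_mono[rotated]) (simp add: twt_def)
  ultimately show ?thesis
    unfolding lifted_op_def
    by (intro vanish_arith(2) vanish_sum) (auto intro!: vanish_mult_right[of "mvar None * _"])
qed

lemma mcoeff_picard_0:
  assumes "\<And>l. mcoeff (G l) 0 = 0" shows "mcoeff (picard a Q G \<nu> Y i) 0 = 0"
  using assms mcoeff_ylin_0[of "G _"] by (simp add: picard_def mcoeff_mult_0)

lemma picard_contracts:
  fixes Y Y' :: "'n::finite \<Rightarrow> 'd::finite option mfps"
  assumes Y0: "\<And>k. mcoeff (Y k) 0 = 0" and Y'0: "\<And>k. mcoeff (Y' k) 0 = 0"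
    and diff: "\<And>k. Y' k - Y k \<in> vanish twt m"
  shows "picard a Q G \<nu> Y' i - picard a Q G \<nu> Y i \<in> vanish twt (Suc m)"
proof -
  have twt1: "Suc 0 \<le> twt k" for k :: "'d option" by (simp add: twt_def split: option.split)
  have "msubst (G l - ylin (G l)) (lifted_args Y') - msubst (G l - ylin (G l)) (lifted_args Y)
      \<in> vanish twt (Suc m)" for l
  proof (rule msubst_diff_in_ideal[OF mideal_vanish[of twt m] mideal_vanish])
    show "f * u \<in> vanish twt (Suc m)" if "mcoeff f 0 = 0" "u \<in> vanish twt m"
      for f u :: "'d option mfps"
    proof -
      have "f \<in> vanish twt 1"
        using that(1) mvanish_subset_vanish[of twt "Suc 0", OF twt1]
        by (auto simp: mvanish_1_iff[symmetric])
      then show ?thesis using vanish_mult[of f twt 1 u m] that(2) by simp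
    qed
    show "mvanish (Suc m) \<subseteq> (vanish twt (Suc m) :: 'd option mfps set)"
      by (rule mvanish_subset_vanish[OF twt1])
    show "lifted_args Y' k - lifted_args Y k \<in> vanish twt m" for k
      using diff by (auto simp: lifted_args_def vanish_arith split: sum.split)
    show "mcoeff (G l - ylin (G l)) (munit k) = 0" if "lifted_args Y' k \<noteq> lifted_args Y k" for k
      using that by (cases k) (auto simp: lifted_args_def mcoeff_ylin simp del: mcoeff_arith)
  qed (use Y0 Y'0 in \<open>simp_all add: lifted_args_0\<close>)
  then have "(lifted_op a Q (Y' l - Y l) - (msubst (G l - ylin (G l)) (lifted_args Y') -
      msubst (G l - ylin (G l)) (lifted_args Y))) \<in> vanish twt (Suc m)" for l
    by (intro vanish_arith(3)[OF lifted_op_vanish[OF diff]])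
  then have "(\<Sum>l\<in>UNIV. mconst (\<nu> i l) * (lifted_op a Q (Y' l - Y l) -
      (msubst (G l - ylin (G l)) (lifted_args Y') - msubst (G l - ylin (G l)) (lifted_args Y))))
      \<in> vanish twt (Suc m)"
    by (intro vanish_sum vanish_mult_right)
  also have "(\<Sum>l\<in>UNIV. mconst (\<nu> i l) * (lifted_op a Q (Y' l - Y l) -
      (msubst (G l - ylin (G l)) (lifted_args Y') - msubst (G l - ylin (G l)) (lifted_args Y)))) =
      picard a Q G \<nu> Y' i - picard a Q G \<nu> Y i"
    unfolding picard_def sum_subtractf[symmetric] lifted_op_diff
    by (rule sum.cong) (simp_all add: right_diff_distrib)
  finally show ?thesis .
qed

lemma wbound_limit:
  assumes "\<And>m. f - h m \<in> vanish v m" "\<And>m. wbound w (h m) B"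
  shows "wbound w f B"
  unfolding wbound_def
proof (intro allI impI)
  fix A :: "('a \<Rightarrow> nat) set" assume A: "finite A"
  define m where "m = Suc (Max (insert 0 (wdeg v ` A)))"
  have "wdeg v \<gamma> < m" if "\<gamma> \<in> A" for \<gamma>
    using A that by (auto simp: m_def less_Suc_eq_le intro!: Max_ge)
  then have "mcoeff f \<gamma> = mcoeff (h m) \<gamma>" if "\<gamma> \<in> A" for \<gamma>
    using vanishD[OF assms(1)[of m]] that by fastforce
  then have "(\<Sum>\<gamma>\<in>A. norm (mcoeff f \<gamma>) * w \<gamma>) = (\<Sum>\<gamma>\<in>A. norm (mcoeff (h m) \<gamma>) * w \<gamma>)"
    by (intro sum.cong) auto
  then show "(\<Sum>\<gamma>\<in>A. norm (mcoeff f \<gamma>) * w \<gamma>) \<le> B"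
    using wboundD[OF assms(2) A] by simp
qed

text \<open>
  The \<open>n\<close>-th and all later iterates agree up to weighted order \<open>n\<close>, so the coefficient at \<open>\<gamma>\<close> of the
  limit can be read off from the first iterate whose number exceeds the weighted degree of \<open>\<gamma>\<close>. The
  bound passes to the limit because each finite partial sum is that of some iterate.
\<close>

lemma picard_fixpoint_exists:
  fixes a :: "'d::finite \<Rightarrow> 'd mfps" and G :: "'n::finite \<Rightarrow> ('d + 'n) mfps"
  assumes G0: "\<And>l. mcoeff (G l) 0 = 0"
    and inv: "\<And>Y. (\<And>k. wbound w (Y k) s) \<Longrightarrow> (\<And>i. wbound w (picard a Q G \<nu> Y i) s)"
    and start: "wbound w 0 s"
  obtains Y where "\<And>k. mcoeff (Y k) 0 = 0" "\<And>i. picard a Q G \<nu> Y i = Y i" "\<And>k. wbound w (Y k) s"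
proof -
  define it where "it n = (picard a Q G \<nu> ^^ n) (\<lambda>_. 0)" for n
  have it_Suc: "it (Suc n) = picard a Q G \<nu> (it n)" for n by (simp add: it_def)
  have it_0: "mcoeff (it n k) 0 = 0" for n k
    by (cases n) (simp_all add: it_Suc mcoeff_picard_0 G0, simp add: it_def)
  have it_bound: "wbound w (it n k) s" for n k
  proof (induction n arbitrary: k)
    case 0
    then show ?case using start by (simp add: it_def)
  qed (simp add: it_Suc inv)
  have step: "it (Suc n) k - it n k \<in> vanish twt n" for n k
  proof (induction n arbitrary: k)
    case (Suc n)
    then show ?case by (subst (1 2) it_Suc) (intro picard_contracts it_0)
  qed simp
  have diff: "it (n + p) k - it n k \<in> vanish twt n" for n p k
  proof (induction p)
    case (Suc p)
    have "it (Suc (n + p)) k - it (n + p) k \<in> vanish twt n"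
      by (rule vanish_mono[OF _ step]) simp
    from vanish_arith(2)[OF this Suc] show ?case by simp
  qed (simp add: vanish_arith)
  define Y where "Y k = Abs_mfps (\<lambda>\<gamma>. mcoeff (it (Suc (wdeg twt \<gamma>)) k) \<gamma>)" for k
  have Y_it: "Y k - it n k \<in> vanish twt n" for k n
  proof (rule vanishI)
    fix \<gamma> :: "'d option \<Rightarrow> nat" assume *: "wdeg twt \<gamma> < n"
    then have "mcoeff (it (Suc (wdeg twt \<gamma>) + (n - Suc (wdeg twt \<gamma>))) k - it (Suc (wdeg twt \<gamma>)) k) \<gamma> = 0"
      by (intro vanishD[OF diff]) simp
    then show "mcoeff (Y k - it n k) \<gamma> = 0"
      using * by (simp add: Y_def Abs_mfps_inverse)
  qed
  have Y0: "mcoeff (Y k) 0 = 0" for k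
    using it_0 by (simp add: Y_def Abs_mfps_inverse)
  have "picard a Q G \<nu> Y i = Y i" for i
  proof (rule vanish_all_eq)
    fix n
    have "picard a Q G \<nu> Y i - it (Suc n) i \<in> vanish twt n"
      unfolding it_Suc by (rule vanish_mono[OF _ picard_contracts[OF it_0 Y0 Y_it]]) simp
    from vanish_arith(3)[OF this vanish_mono[OF _ Y_it[of i "Suc n"], of n]]
    show "picard a Q G \<nu> Y i - Y i \<in> vanish twt n" by simp
  qed
  moreover have "wbound w (Y k) s" for k
    by (rule wbound_limit[OF Y_it it_bound])
  ultimately show thesis using that Y0 by blast
qed

text \<open>
  Multiplying the fixed point equation by the Jacobian turns \<open>\<nu>\<close> into the identity and restores the
  linear part of \<open>F\<close>.
\<close>

lemma picard_fixpoint_solves: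
  fixes a :: "'d::finite \<Rightarrow> 'd mfps" and G :: "'n::finite \<Rightarrow> ('d + 'n) mfps"
  assumes \<nu>: "\<And>i k. (\<Sum>l\<in>UNIV. mcoeff (G i) (munit (Inr l)) * \<nu> l k) = (if i = k then 1 else 0)"
    and Y0: "\<And>k. mcoeff (Y k) 0 = 0" and fix_Y: "\<And>i. picard a Q G \<nu> Y i = Y i"
  shows "msubst (G l) (lifted_args Y) = lifted_op a Q (Y l)"
proof -
  define X where "X l = lifted_op a Q (Y l) - msubst (G l - ylin (G l)) (lifted_args Y)" for l
  have Y: "Y i = (\<Sum>l\<in>UNIV. mconst (\<nu> i l) * X l)" for i
    using fix_Y[of i] by (simp add: picard_def X_def)
  have "(\<Sum>k\<in>UNIV. mconst (mcoeff (G l) (munit (Inr k))) * Y k) = X l"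
    unfolding Y by (rule mconst_matrix_inverse[OF \<nu>])
  moreover have "msubst (G l) (lifted_args Y) =
      (\<Sum>k\<in>UNIV. mconst (mcoeff (G l) (munit (Inr k))) * lifted_args Y (Inr k)) +
      msubst (G l - ylin (G l)) (lifted_args Y)"
    by (rule msubst_split_ylin) (rule lifted_args_0[OF Y0])
  ultimately show ?thesis by (simp add: X_def lifted_args_def)
qed

subsection \<open>Estimates for the iteration\<close>

lemma wbound_emb:
  assumes "0 \<le> \<rho>" "0 \<le> \<tau>" "\<rho> \<le> R" "wbound (rwt R) f K"
  shows "wbound (gwt \<rho> \<tau>) (emb f) K"
  unfolding emb_def
proof (rule wbound_msubst[where B = "\<lambda>_. \<rho>"])
  show "wbound (\<lambda>\<alpha>. \<Prod>k\<in>UNIV. \<rho> ^ \<alpha> k) f K"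
    using wbound_rwt_mono[OF assms(4,1,3)] by (simp add: rwt_conv_prod[abs_def])
  show "wbound (gwt \<rho> \<tau>) (mvar (Some k)) \<rho>" for k
    by (rule wbound_mvar_Some[OF assms(1)])
qed (use assms in \<open>auto intro: gwt_nonneg gwt_add\<close>)

lemma wbound_lifted_op:
  assumes "0 < \<rho>" "0 < \<tau>" "\<rho> \<le> R" and a: "\<And>j. wbound (rwt R) (a j) K" and Q: "wbound (rwt R) Q K"
    and f: "wbound (gwt \<rho> \<tau>) f s"
  shows "wbound (gwt \<rho> \<tau>) (lifted_op a Q f :: 'd::finite option mfps)
    (\<tau> * (real CARD('d) * K / \<rho> + K) * s)"
proof -
  have nn: "0 \<le> gwt \<rho> \<tau> \<alpha>" for \<alpha> :: "'d option \<Rightarrow> nat" using assms by (simp add: gwt_nonneg)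
  have mult: "wbound (gwt \<rho> \<tau>) (g * h) (B * C)"
    if "wbound (gwt \<rho> \<tau>) g B" "wbound (gwt \<rho> \<tau>) h C" for g h :: "'d option mfps" and B C
    using that assms by (intro wbound_mult gwt_add nn) auto
  have e: "wbound (gwt \<rho> \<tau>) (emb (a j)) K" "wbound (gwt \<rho> \<tau>) (emb Q) K" for j
    using assms by (auto intro!: wbound_emb[where R = R])
  have "wbound (gwt \<rho> \<tau>) (lifted_op a Q f)
      ((\<Sum>j\<in>(UNIV :: 'd set). K * (\<tau> / \<rho> * s)) + K * (\<tau> * s))"
    unfolding lifted_op_def
    by (intro wbound_add wbound_sum mult e wbound_t_mpderiv_Some wbound_t2_mpderiv_None nn f assms(1,2))
       auto
  then show ?thesis by (simp add: algebra_simps)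
qed

text \<open>
  The monomials of the nonlinear part are of two kinds. Those of degree at least 2 are quadratically
  small in \<open>s\<close>, as \<open>\<rho> \<le> s \<le> R\<close>; the remaining ones are the variables \<open>x\<^sub>i\<close>, which contribute \<open>\<rho>\<close>.
\<close>

lemma wbound_nonlinear:
  fixes G :: "('d::finite + 'n::finite) mfps" and Y :: "'n \<Rightarrow> 'd option mfps"
  assumes "0 < \<rho>" "0 < \<tau>" "\<rho> \<le> s" "s \<le> R" and G: "wbound (rwt R) G M" and G0: "mcoeff G 0 = 0"
    and Y: "\<And>k. wbound (gwt \<rho> \<tau>) (Y k) s"
  shows "wbound (gwt \<rho> \<tau>) (msubst (G - ylin G) (lifted_args Y)) (((s / R)\<^sup>2 + \<rho> / R) * M)"
proof (rule wbound_msubst[where B = "case_sum (\<lambda>_. \<rho>) (\<lambda>_. s)"])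
  define B where "B = (case_sum (\<lambda>_. \<rho>) (\<lambda>_. s) :: 'd + 'n \<Rightarrow> real)"
  have pos: "0 < s" "0 < R" "\<rho> / R \<ge> 0" using assms by auto
  have coeff: "mcoeff (G - ylin G) \<alpha> = 0 \<or>
      (\<alpha> \<noteq> 0 \<and> (\<forall>k. \<alpha> \<noteq> munit (Inr k)) \<and> mcoeff (G - ylin G) \<alpha> = mcoeff G \<alpha>)" for \<alpha>
  proof (cases "\<exists>k. \<alpha> = munit (Inr k)")
    case True
    then show ?thesis using mcoeff_ylin[of G] by auto
  next
    case False
    then have "mcoeff (ylin G) \<alpha> = 0"
      by (simp add: ylin_def mcoeff_mconst_mult mvar_def mcoeff_mmonom)
    then show ?thesis using False G0 by auto
  qed
  have B_le: "(\<Prod>k\<in>UNIV. B k ^ \<alpha> k) \<le> ((s / R)\<^sup>2 + \<rho> / R) * rwt R \<alpha>"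
    if nz: "\<alpha> \<noteq> 0" "\<forall>k. \<alpha> \<noteq> munit (Inr k)" for \<alpha>
  proof (cases "mdeg \<alpha> \<ge> 2")
    case True
    then obtain p where p: "mdeg \<alpha> = 2 + p" using le_Suc_ex by blast
    have "(\<Prod>k\<in>UNIV. B k ^ \<alpha> k) \<le> rwt s \<alpha>"
      unfolding rwt_conv_prod
      by (rule prod_mono) (use assms in \<open>auto simp: B_def split: sum.split intro!: power_mono\<close>)
    also have "\<dots> = (s / R)\<^sup>2 * (s / R) ^ p * rwt R \<alpha>"
    proof -
      have "(s / R)\<^sup>2 * (s / R) ^ p * R ^ (2 + p) = (s / R * R) ^ (2 + p)"
        unfolding power_mult_distrib power_add by (simp only: ac_simps)
      then show ?thesis using pos by (simp add: rwt_def p)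
    qed
    also have "\<dots> \<le> (s / R)\<^sup>2 * 1 * rwt R \<alpha>"
      using pos assms by (intro mult_right_mono mult_left_mono power_le_one) (auto simp: rwt_def)
    also have "\<dots> \<le> ((s / R)\<^sup>2 + \<rho> / R) * rwt R \<alpha>"
      using pos by (intro mult_right_mono) (auto simp: rwt_def)
    finally show ?thesis .
  next
    case False
    obtain j where j: "\<alpha> j \<noteq> 0" using nz(1) by (auto simp: midx_eq)
    define \<beta> where "\<beta> = \<alpha>(j := \<alpha> j - 1)"
    have eq: "\<alpha> = \<beta> + munit j" unfolding \<beta>_def by (rule midx_split[of \<alpha> j, OF j])
    with False have "mdeg \<beta> = 0" by (auto simp del: mdeg_eq_0_iff)
    then have \<alpha>: "\<alpha> = munit j" using eq by simp
    then obtain i where i: "j = Inl i" using nz(2) by (cases j) auto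
    have "(\<Prod>k\<in>UNIV. B k ^ \<alpha> k) = (\<Prod>k\<in>{j}. B k ^ \<alpha> k)"
      by (rule prod.mono_neutral_right) (auto simp: \<alpha> munit_def)
    also have "\<dots> = \<rho>" by (simp add: \<alpha> B_def i)
    also have "\<dots> = \<rho> / R * rwt R \<alpha>" using pos by (simp add: \<alpha> rwt_def)
    also have "\<dots> \<le> ((s / R)\<^sup>2 + \<rho> / R) * rwt R \<alpha>"
      using pos by (intro mult_right_mono) (auto simp: rwt_def)
    finally show ?thesis .
  qed
  show "wbound (\<lambda>\<alpha>. \<Prod>k\<in>UNIV. case_sum (\<lambda>_. \<rho>) (\<lambda>_. s) k ^ \<alpha> k) (G - ylin G) (((s / R)\<^sup>2 + \<rho> / R) * M)"
  proof (rule wbound_transport[OF G, where S = UNIV and \<phi> = id])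
    show "norm (mcoeff (G - ylin G) \<alpha>) * (\<Prod>k\<in>UNIV. case_sum (\<lambda>_. \<rho>) (\<lambda>_. s) k ^ \<alpha> k)
       \<le> ((s / R)\<^sup>2 + \<rho> / R) * (norm (mcoeff G (id \<alpha>)) * rwt R (id \<alpha>))" for \<alpha>
      using coeff[of \<alpha>]
    proof
      assume "mcoeff (G - ylin G) \<alpha> = 0"
      then show ?thesis using pos by (simp add: rwt_def)
    next
      assume *: "\<alpha> \<noteq> 0 \<and> (\<forall>k. \<alpha> \<noteq> munit (Inr k)) \<and> mcoeff (G - ylin G) \<alpha> = mcoeff G \<alpha>"
      then have "norm (mcoeff G \<alpha>) * (\<Prod>k\<in>UNIV. B k ^ \<alpha> k) \<le>
          norm (mcoeff G \<alpha>) * (((s / R)\<^sup>2 + \<rho> / R) * rwt R \<alpha>)"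
        by (intro mult_left_mono B_le) auto
      then show ?thesis using * by (simp add: B_def ac_simps)
    qed
  qed (use pos in auto)
  show "wbound (gwt \<rho> \<tau>) (lifted_args Y k) (case_sum (\<lambda>_. \<rho>) (\<lambda>_. s) k)" for k
    using Y assms by (auto simp: lifted_args_def wbound_mvar_Some split: sum.split)
qed (use assms in \<open>auto intro: gwt_nonneg gwt_add\<close>)

text \<open>
  The radii are chosen one after the other so that each of the three contributions to the iteration is
  at most \<open>s/3\<close>: first \<open>s\<close> small, to control the quadratic terms; then \<open>\<rho>\<close> small compared with
  \<open>s\<close>, to control the terms depending on \<open>x\<close> alone; finally \<open>\<tau>\<close> small, to control the
  differential operator, whose norm is a multiple of \<open>\<tau>\<close> that involves \<open>1/\<rho>\<close>.
\<close>

theorem lifted_solution_exists: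
  fixes a :: "'d::finite \<Rightarrow> 'd mfps" and G :: "'n::finite \<Rightarrow> ('d + 'n) mfps"
  assumes G0: "\<And>l. mcoeff (G l) 0 = 0"
    and \<nu>: "\<And>i k. (\<Sum>l\<in>UNIV. mcoeff (G i) (munit (Inr l)) * \<nu> l k) = (if i = k then 1 else 0)"
    and R: "0 < R" and a: "\<And>j. wbound (rwt R) (a j) M" and Q: "wbound (rwt R) Q M"
    and G: "\<And>l. wbound (rwt R) (G l) M"
  obtains Y \<rho> \<tau> s where "0 < \<rho>" "0 < \<tau>" "0 < s" "\<And>k. mcoeff (Y k) 0 = 0"
    "\<And>l. msubst (G l) (lifted_args Y) = lifted_op a Q (Y l)"
    "\<And>k. wbound (gwt \<rho> \<tau>) (Y k) s"
proof -
  have M: "0 \<le> M" using Q by (rule wbound_nonneg)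
  define V where "V = Max (range (\<lambda>(i, l). norm (\<nu> i l)))"
  have V: "norm (\<nu> i l) \<le> V" for i l
    unfolding V_def by (rule Max_ge) (auto intro: rangeI[of _ "(i, l)"] image_eqI[of _ _ "(i, l)"])
  have V0: "0 \<le> V" using V[of undefined undefined] norm_ge_zero order_trans by blast
  define N where "N = real CARD('n)"
  define c where "c = N * V * M + 1"
  have c: "0 < c" "N * V * M \<le> c" using M V0 by (auto simp: c_def N_def intro!: add_nonneg_pos)
  define s where "s = min R (R\<^sup>2 / (3 * c))"
  have s: "0 < s" "s \<le> R" "s \<le> R\<^sup>2 / (3 * c)" using R c by (auto simp: s_def)
  define \<rho> where "\<rho> = min s (s * R / (3 * c))"
  have \<rho>: "0 < \<rho>" "\<rho> \<le> s" "\<rho> \<le> s * R / (3 * c)" using s R c by (auto simp: \<rho>_def)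
  define e where "e = N * V * (real CARD('d) * M / \<rho> + M) + 1"
  have e: "0 < e" "N * V * (real CARD('d) * M / \<rho> + M) \<le> e"
    using M V0 \<rho> by (auto simp: e_def N_def intro!: add_nonneg_pos mult_nonneg_nonneg)
  define \<tau> where "\<tau> = 1 / (3 * e)"
  have \<tau>: "0 < \<tau>" using e by (simp add: \<tau>_def)
  have t1: "N * V * (\<tau> * (real CARD('d) * M / \<rho> + M) * s) \<le> s / 3"
  proof -
    have "N * V * (\<tau> * (real CARD('d) * M / \<rho> + M) * s) = N * V * (real CARD('d) * M / \<rho> + M) * (\<tau> * s)"
      by (simp add: ac_simps)
    also have "\<dots> \<le> e * (\<tau> * s)" using e \<tau> s by (intro mult_right_mono) auto
    also have "\<dots> = s / 3" using e by (simp add: \<tau>_def)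
    finally show ?thesis .
  qed
  have t2: "N * V * ((s / R)\<^sup>2 * M) \<le> s / 3"
  proof -
    have "N * V * ((s / R)\<^sup>2 * M) = N * V * M * (s * s / R\<^sup>2)" by (simp add: power2_eq_square)
    also have "\<dots> \<le> c * (s * s / R\<^sup>2)" using c by (intro mult_right_mono) auto
    also have "\<dots> \<le> c * (s * (R\<^sup>2 / (3 * c)) / R\<^sup>2)"
      using c s by (intro mult_left_mono divide_right_mono) auto
    also have "\<dots> = s / 3" using c R by simp
    finally show ?thesis .
  qed
  have t3: "N * V * (\<rho> / R * M) \<le> s / 3"
  proof -
    have "N * V * (\<rho> / R * M) = N * V * M * (\<rho> / R)" by simp
    also have "\<dots> \<le> c * (\<rho> / R)" using c \<rho> R by (intro mult_right_mono) auto
    also have "\<dots> \<le> c * (s * R / (3 * c) / R)"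
      using c \<rho> R by (intro mult_left_mono divide_right_mono) auto
    also have "\<dots> = s / 3" using c R by simp
    finally show ?thesis .
  qed
  let ?w = "gwt \<rho> \<tau> :: ('d option \<Rightarrow> nat) \<Rightarrow> real"
  have nn: "0 \<le> ?w \<alpha>" for \<alpha> using \<rho> \<tau> by (simp add: gwt_nonneg)
  have inv: "wbound ?w (picard a Q G \<nu> Y i) s" if Y: "\<And>k. wbound ?w (Y k) s" for Y i
  proof -
    define X where "X = \<tau> * (real CARD('d) * M / \<rho> + M) * s + ((s / R)\<^sup>2 + \<rho> / R) * M"
    have X: "wbound ?w (lifted_op a Q (Y l) - msubst (G l - ylin (G l)) (lifted_args Y)) X" for l
      unfolding X_def using \<rho> \<tau> s a Q G G0 Y
      by (intro wbound_diff nn wbound_lifted_op[where R = R] wbound_nonlinear) auto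
    then have X0: "0 \<le> X" by (blast dest: wbound_nonneg)
    have "wbound ?w (picard a Q G \<nu> Y i) (\<Sum>l\<in>UNIV. norm (\<nu> i l) * X)"
      unfolding picard_def by (intro wbound_sum nn wbound_mconst_mult X) auto
    moreover have "(\<Sum>l\<in>UNIV. norm (\<nu> i l) * X) \<le> (\<Sum>l\<in>(UNIV :: 'n set). V * X)"
      by (intro sum_mono mult_right_mono V X0)
    moreover have "(\<Sum>l\<in>(UNIV :: 'n set). V * X) = N * V * X" by (simp add: N_def)
    moreover have "N * V * X = N * V * (\<tau> * (real CARD('d) * M / \<rho> + M) * s) +
        N * V * ((s / R)\<^sup>2 * M) + N * V * (\<rho> / R * M)"
      by (simp add: X_def distrib_left distrib_right)
    moreover have "\<dots> \<le> s" using t1 t2 t3 by linarith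
    ultimately show ?thesis by (auto intro: wbound_le)
  qed
  have "wbound ?w 0 s" using s by (auto simp: wbound_def)
  with inv obtain Y where Y: "\<And>k. mcoeff (Y k) 0 = 0" "\<And>i. picard a Q G \<nu> Y i = Y i" "\<And>k. wbound ?w (Y k) s"
    by (rule picard_fixpoint_exists[OF G0]) auto
  show thesis
    by (rule that[OF \<rho>(1) \<tau> s(1) Y(1) _ Y(3)]) (rule picard_fixpoint_solves[OF \<nu> Y(1,2)])
qed

text \<open>
  Both the substitution \<open>t = P(x)\<close> and the summation of the series in \<open>P\<close> are continuous in \<open>f\<close>, so
  this needs a proof for monomials \<open>t\<^sup>n x\<^sup>\<alpha>\<close> only.
\<close>

lemma formal_has_sum_tcoeff:
  assumes P0: "mcoeff P 0 = 0"
  shows "formal_has_sum (\<lambda>n. tcoeff n f * P ^ n) (msubst f (case_option P mvar))"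
proof -
  have Pn: "P ^ n \<in> mvanish n" for n
    by (induction n) (use P0 vanish_mult[of P _ "Suc 0"] in \<open>auto simp: mvanish_1_iff\<close>)
  have vanish_term: "tcoeff n f * P ^ n \<in> mvanish n" for n f by (rule vanish_mult_right[OF Pn])
  define S where "S f = Abs_mfps (\<lambda>\<gamma>. \<Sum>n\<le>mdeg \<gamma>. mcoeff (tcoeff n f * P ^ n) \<gamma>)" for f
  have S: "mcoeff (S f) \<gamma> = (\<Sum>n\<le>mdeg \<gamma>. mcoeff (tcoeff n f * P ^ n) \<gamma>)" for f \<gamma>
    by (simp add: S_def Abs_mfps_inverse)
  have "msubst f (case_option P mvar) = S f"
  proof (rule mcontinuous_eqI[where f = f])
    show "mcontinuous (\<lambda>f. msubst f (case_option P mvar))" by (rule mcontinuous_msubst)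
    show "mcontinuous S"
    proof (rule mcontinuousI[where c = 0])
      have "tcoeff n (f + g) = tcoeff n f + tcoeff n g" for n and f g :: "'a option mfps"
        by (rule mfps_eqI) (simp add: mcoeff_tcoeff)
      then have "mcoeff (S (f + g)) \<gamma> = mcoeff (S f + S g) \<gamma>" for f g \<gamma>
        unfolding S mcoeff_arith by (simp add: distrib_right sum.distrib)
      then show "S (f + g) = S f + S g" for f g by (rule mfps_eqI)
      fix m and f :: "'a option mfps" assume f: "f \<in> mvanish (m + 0)"
      have "tcoeff n f \<in> mvanish (m - n)" for n
      proof (rule vanishI)
        fix \<alpha> :: "'a \<Rightarrow> nat" assume "mdeg \<alpha> < m - n"
        moreover have "mdeg (case_option n \<alpha>) = n + mdeg \<alpha>"
          unfolding mdeg_conv_sum UNIV_option_conv by (simp add: sum.reindex)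
        ultimately show "mcoeff (tcoeff n f) \<alpha> = 0"
          using f by (auto simp: mcoeff_tcoeff intro: vanishD)
      qed
      then have "tcoeff n f * P ^ n \<in> mvanish m" for n
        using vanish_mult[OF _ Pn, of "tcoeff n f" "m - n" n] by (auto intro: vanish_mono[rotated])
      then show "S f \<in> mvanish m"
        by (intro vanishI) (auto simp: S intro!: sum.neutral intro: vanishD)
    qed
    show "msubst (mmonom c \<alpha>) (case_option P mvar) = S (mmonom c \<alpha>)" for c and \<alpha> :: "'a option \<Rightarrow> nat"
    proof (rule mfps_eqI)
      fix \<gamma> :: "'a \<Rightarrow> nat"
      define F where "F = mmonom c (\<lambda>i. \<alpha> (Some i)) * P ^ \<alpha> None"
      have "mpow (case_option P mvar) \<alpha> = P ^ \<alpha> None * mpow mvar (\<lambda>i. \<alpha> (Some i))"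
        unfolding mpow_def UNIV_option_conv by (subst prod.insert) (auto simp: prod.reindex)
      then have F: "msubst (mmonom c \<alpha>) (case_option P mvar) = F"
        unfolding msubst_mmonom[OF case_option_mvar_0[OF P0]] F_def
        by (subst (2) mmonom_conv_mpow) (simp add: ac_simps)
      have tc: "tcoeff n (mmonom c \<alpha>) * P ^ n = (if n = \<alpha> None then F else 0)" for n
      proof -
        have "case_option n \<beta> = \<alpha> \<longleftrightarrow> n = \<alpha> None \<and> \<beta> = (\<lambda>i. \<alpha> (Some i))" for \<beta>
          by (auto simp: fun_eq_iff split: option.split)
        then have "tcoeff n (mmonom c \<alpha>) = (if n = \<alpha> None then mmonom c (\<lambda>i. \<alpha> (Some i)) else 0)"
          by (intro mfps_eqI) (simp add: mcoeff_tcoeff mcoeff_mmonom)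
        then show ?thesis by (simp add: F_def)
      qed
      have "F \<in> mvanish (\<alpha> None)" unfolding F_def by (rule vanish_mult_right[OF Pn])
      then have "mcoeff F \<gamma> = 0" if "mdeg \<gamma> < \<alpha> None" using that by (rule vanishD)
      moreover have "mcoeff (S (mmonom c \<alpha>)) \<gamma> = (\<Sum>n\<le>mdeg \<gamma>. if n = \<alpha> None then mcoeff F \<gamma> else 0)"
        unfolding S tc by (rule sum.cong) auto
      ultimately show "mcoeff (msubst (mmonom c \<alpha>) (case_option P mvar)) \<gamma> = mcoeff (S (mmonom c \<alpha>)) \<gamma>"
        unfolding F by auto
    qed
  qed
  moreover have "{i. i \<le> m} = {..m}" for m :: nat by auto
  ultimately show ?thesis
    by (subst formal_has_sum_iff[where d = "\<lambda>n. n"]) (auto simp: vanish_term S)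
qed

unbundle no Formal_Power_Series.fps_syntax

section \<open>Convergent power series in several variables\<close>

definition vmon :: "complex ^ 'd \<Rightarrow> ('d::finite \<Rightarrow> nat) \<Rightarrow> complex" where
  "vmon x \<alpha> = (\<Prod>j\<in>UNIV. x $ j ^ \<alpha> j)"

lemma norm_vmon_le:
  assumes "\<And>j. norm (x $ j) \<le> R" shows "norm (vmon x \<alpha>) \<le> rwt R \<alpha>"
  unfolding vmon_def rwt_conv_prod prod_norm[symmetric] norm_power
  using assms by (auto intro!: prod_mono power_mono)

text \<open>
  For complex numbers unconditional and absolute summability coincide; evaluating at the point with all
  coordinates equal to a small positive number gives the bound.
\<close>

lemma wbound_of_mfps_convergent:
  assumes "mfps_convergent T" obtains R B where "0 < R" "wbound (rwt R) T B"
proof -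
  obtain r where r: "\<And>j. 0 < r j"
    and sm: "\<And>x. x \<in> polydisc r \<Longrightarrow> (\<lambda>\<alpha>. mcoeff T \<alpha> * (\<Prod>j\<in>UNIV. x $ j ^ \<alpha> j)) summable_on UNIV"
    using assms unfolding mfps_convergent_def by blast
  define R where "R = Min (range r) / 2"
  have "0 < Min (range r)" using r by (subst Min_gr_iff) auto
  then have R: "0 < R" "R < Min (range r)" by (auto simp: R_def)
  have "R < r j" for j using R(2) by (rule less_le_trans) auto
  then have "(\<chi> j. of_real R) \<in> polydisc r" using R by (simp add: polydisc_def)
  from sm[OF this] have "(\<lambda>\<alpha>. norm (mcoeff T \<alpha> * (\<Prod>j\<in>UNIV. (of_real R :: complex) ^ \<alpha> j))) summable_on UNIV"
    by (simp add: summable_on_iff_abs_summable_on_complex)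
  also have "(\<lambda>\<alpha>. norm (mcoeff T \<alpha> * (\<Prod>j\<in>UNIV. (of_real R :: complex) ^ \<alpha> j))) =
      (\<lambda>\<alpha>. norm (mcoeff T \<alpha>) * rwt R \<alpha>)"
    using R by (auto simp: norm_mult prod_norm[symmetric] norm_power rwt_conv_prod fun_eq_iff)
  finally have "(\<lambda>\<alpha>. norm (mcoeff T \<alpha>) * rwt R \<alpha>) summable_on UNIV" .
  then have "wbound (rwt R) T (infsum (\<lambda>\<alpha>. norm (mcoeff T \<alpha>) * rwt R \<alpha>) UNIV)"
    unfolding wbound_def using R
    by (intro allI impI finite_sum_le_infsum) (auto simp: rwt_def)
  with R(1) show thesis by (rule that)
qed

lemma mfps_convergent_of_expansion: "has_mfps_expansion f T \<Longrightarrow> mfps_convergent T"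
  unfolding has_mfps_expansion_def mfps_convergent_def by (blast intro: has_sum_imp_summable)

definition meval :: "'d::finite mfps \<Rightarrow> complex ^ 'd \<Rightarrow> complex" where
  "meval T x = infsum (\<lambda>\<alpha>. mcoeff T \<alpha> * vmon x \<alpha>) UNIV"

lemma wbound_summable:
  assumes "0 \<le> R" "wbound (rwt R) T B"
  shows "(\<lambda>\<alpha>. norm (mcoeff T \<alpha>) * rwt R \<alpha>) summable_on UNIV"
    and "infsum (\<lambda>\<alpha>. norm (mcoeff T \<alpha>) * rwt R \<alpha>) UNIV \<le> B"
proof -
  show 1: "(\<lambda>\<alpha>. norm (mcoeff T \<alpha>) * rwt R \<alpha>) summable_on UNIV"
    by (rule nonneg_bounded_partial_sums_imp_summable_on[where C = B])
       (use assms in \<open>auto simp: rwt_def wbound_def intro!: eventually_finite_subsets_at_top_weakI\<close>)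
  show "infsum (\<lambda>\<alpha>. norm (mcoeff T \<alpha>) * rwt R \<alpha>) UNIV \<le> B"
    by (rule infsum_le_finite_sums[OF 1]) (rule wboundD[OF assms(2)])
qed

lemma
  assumes R: "0 \<le> R" and T: "wbound (rwt R) T B" and x: "\<And>j. norm (x $ j) \<le> R"
  shows has_sum_meval: "((\<lambda>\<alpha>. mcoeff T \<alpha> * vmon x \<alpha>) has_sum meval T x) UNIV"
    and norm_meval_le: "norm (meval T x) \<le> B"
proof -
  note sm = wbound_summable[OF R T]
  have le: "norm (mcoeff T \<alpha> * vmon x \<alpha>) \<le> norm (mcoeff T \<alpha>) * rwt R \<alpha>" for \<alpha>
    unfolding norm_mult by (intro mult_left_mono norm_vmon_le x) auto
  have "(\<lambda>\<alpha>. norm (mcoeff T \<alpha> * vmon x \<alpha>)) summable_on UNIV"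
    by (rule Infinite_Sum.abs_summable_on_comparison_test'[OF sm(1)]) (rule le)
  then have "(\<lambda>\<alpha>. mcoeff T \<alpha> * vmon x \<alpha>) summable_on UNIV"
    by (rule abs_summable_summable)
  then show 1: "((\<lambda>\<alpha>. mcoeff T \<alpha> * vmon x \<alpha>) has_sum meval T x) UNIV"
    unfolding meval_def by (rule has_sum_infsum)
  show "norm (meval T x) \<le> B"
    using norm_infsum_le[OF 1 has_sum_infsum[OF sm(1)] le] sm(2) by simp
qed

lemma has_mfps_expansion_meval:
  assumes R: "0 < R" and T: "wbound (rwt R) T B"
  shows "has_mfps_expansion (meval T) T"
  unfolding has_mfps_expansion_def
  by (rule exI[of _ "\<lambda>_. R"])
     (use has_sum_meval[OF _ T] R in \<open>auto simp: polydisc_def vmon_def less_imp_le\<close>)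

lemma open_polydisc: "open (polydisc r)"
proof -
  have "polydisc r = (\<Inter>j. {x. norm (x $ j) < r j})" by (auto simp: polydisc_def)
  then show ?thesis
    by (auto intro!: open_INT open_Collect_less continuous_intros)
qed

lemma convex_polydisc: "convex (polydisc r)"
  unfolding convex_def
proof (intro ballI allI impI)
  fix x y :: "complex ^ 'a" and u v :: real
  assume x: "x \<in> polydisc r" and y: "y \<in> polydisc r" and uv: "0 \<le> u" "0 \<le> v" "u + v = 1"
  have "norm ((u *\<^sub>R x + v *\<^sub>R y) $ j) < r j" for j
  proof -
    have "x $ j \<in> ball 0 (r j)" "y $ j \<in> ball 0 (r j)" using x y by (auto simp: polydisc_def)
    then have "u *\<^sub>R x $ j + v *\<^sub>R y $ j \<in> ball 0 (r j)" using uv by (intro convexD convex_ball)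
    then show ?thesis by simp
  qed
  then show "u *\<^sub>R x + v *\<^sub>R y \<in> polydisc r" by (simp add: polydisc_def)
qed

definition vmon_deriv :: "complex ^ 'd \<Rightarrow> ('d::finite \<Rightarrow> nat) \<Rightarrow> complex ^ 'd \<Rightarrow> complex" where
  "vmon_deriv x \<alpha> h = (\<Sum>i\<in>UNIV. (of_nat (\<alpha> i) * h $ i * x $ i ^ (\<alpha> i - 1)) * (\<Prod>j\<in>UNIV - {i}. x $ j ^ \<alpha> j))"

lemma has_derivative_vmon: "((\<lambda>x. vmon x \<alpha>) has_derivative vmon_deriv x \<alpha>) (at x within S)"
  unfolding vmon_def vmon_deriv_def
  by (rule has_derivative_prod) 
     (auto intro!: derivative_eq_intros bounded_linear_imp_has_derivative bounded_linear_vec_nth)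

text \<open>
  On half of the radius the factor \<open>m = |\<alpha>|\<close> that differentiation produces is absorbed by
  \<open>2\<^bsup>m - 1\<^esup>\<close>.
\<close>

lemma norm_vmon_deriv_le:
  assumes R: "0 < R" and x: "\<And>j. norm (x $ j) \<le> R / 2"
  shows "norm (vmon_deriv x \<alpha> h) \<le> rwt R \<alpha> / R * norm h"
proof (cases "\<alpha> = 0")
  case True
  then show ?thesis using R by (simp add: vmon_deriv_def zero_fun_apply rwt_def)
next
  case False
  define m where "m = mdeg \<alpha>"
  have m: "m \<noteq> 0" using False by (simp add: m_def)
  have "norm ((of_nat (\<alpha> i) * h $ i * x $ i ^ (\<alpha> i - 1)) * (\<Prod>j\<in>UNIV - {i}. x $ j ^ \<alpha> j))
      \<le> real (\<alpha> i) * ((R / 2) ^ (m - 1) * norm h)" for i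
  proof (cases "\<alpha> i = 0")
    case False
    have "norm (x $ i ^ (\<alpha> i - 1)) * norm (\<Prod>j\<in>UNIV - {i}. x $ j ^ \<alpha> j) \<le>
        (R / 2) ^ (\<alpha> i - 1) * (\<Prod>j\<in>UNIV - {i}. (R / 2) ^ \<alpha> j)"
      unfolding prod_norm[symmetric] norm_power
      by (intro mult_mono power_mono prod_mono conjI x prod_nonneg zero_le_power) (use R in auto)
    also have "\<dots> = (R / 2) ^ (\<alpha> i - 1 + (\<Sum>j\<in>UNIV - {i}. \<alpha> j))"
      by (simp only: power_add power_sum)
    also have "\<alpha> i - 1 + (\<Sum>j\<in>UNIV - {i}. \<alpha> j) = m - 1"
      using False by (simp add: m_def mdeg_conv_sum sum.remove[of UNIV i])
    finally have le: "norm (x $ i ^ (\<alpha> i - 1)) * norm (\<Prod>j\<in>UNIV - {i}. x $ j ^ \<alpha> j) \<le> (R / 2) ^ (m - 1)" .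
    have "norm ((of_nat (\<alpha> i) * h $ i * x $ i ^ (\<alpha> i - 1)) * (\<Prod>j\<in>UNIV - {i}. x $ j ^ \<alpha> j)) =
        real (\<alpha> i) * ((norm (x $ i ^ (\<alpha> i - 1)) * norm (\<Prod>j\<in>UNIV - {i}. x $ j ^ \<alpha> j)) * norm (h $ i))"
      by (simp add: norm_mult)
    also have "\<dots> \<le> real (\<alpha> i) * ((R / 2) ^ (m - 1) * norm h)"
      by (intro mult_left_mono mult_mono le Finite_Cartesian_Product.norm_nth_le) (use R in auto)
    finally show ?thesis .
  qed simp
  then have "norm (vmon_deriv x \<alpha> h) \<le> (\<Sum>i\<in>UNIV. real (\<alpha> i) * ((R / 2) ^ (m - 1) * norm h))"
    unfolding vmon_deriv_def by (rule sum_norm_le)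
  also have "\<dots> = real m * (R / 2) ^ (m - 1) * norm h"
    by (simp add: m_def mdeg_conv_sum sum_distrib_right mult.assoc)
  also have "real m * (R / 2) ^ (m - 1) \<le> rwt R \<alpha> / R"
  proof -
    obtain p where p: "m = Suc p" using m not0_implies_Suc by blast
    have "Suc p \<le> 2 ^ p" by (induction p) auto
    then have "real (Suc p) \<le> 2 ^ p" by (metis of_nat_le_iff of_nat_numeral of_nat_power)
    then have "real (Suc p) * (R / 2) ^ p \<le> 2 ^ p * (R / 2) ^ p"
      using R by (intro mult_right_mono) auto
    also have "\<dots> = R ^ p" by (simp add: power_mult_distrib[symmetric])
    also have "\<dots> = rwt R \<alpha> / R" using R by (simp add: rwt_def m_def[symmetric] p)
    finally show ?thesis by (simp add: p)
  qed
  finally show ?thesis by (simp add: mult_right_mono)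
qed

lemma vmon_deriv_cmult: "vmon_deriv x \<alpha> (c *s h) = c * vmon_deriv x \<alpha> h"
  by (simp add: vmon_deriv_def sum_distrib_left ac_simps)

text \<open>
  Termwise differentiation. The multi-indices are enumerated by natural numbers so that the theorem on
  derivatives of uniformly convergent series applies; the derivatives are dominated by
  \<open>norm_vmon_deriv_le\<close>.
\<close>

lemma mholomorphic_meval:
  fixes T :: "'d::finite mfps"
  assumes R: "0 < R" and T: "wbound (rwt R) T B"
  shows "mholomorphic_on (meval T) (polydisc (\<lambda>_. R / 2))"
proof -
  let ?S = "polydisc (\<lambda>_. R / 2) :: (complex ^ 'd) set"
  have inf: "infinite (UNIV :: ('d \<Rightarrow> nat) set)"
    using finite_fun_UNIVD2[where ?'a = 'd and ?'b = nat] by auto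
  define e where "e = from_nat_into (UNIV :: ('d \<Rightarrow> nat) set)"
  have e: "bij_betw e UNIV UNIV"
    unfolding e_def using inf by (intro bij_betw_from_nat_into) auto
  define t where "t i x = mcoeff T (e i) * vmon x (e i)" for i x
  define t' where "t' i x h = mcoeff T (e i) * vmon_deriv x (e i) h" for i x h
  define M where "M i = norm (mcoeff T (e i)) * rwt R (e i) / R" for i
  define g' where "g' x h = (\<Sum>i. t' i x h)" for x h
  have "(\<lambda>\<alpha>. norm (mcoeff T \<alpha>) * rwt R \<alpha>) summable_on UNIV"
    by (rule wbound_summable[OF _ T]) (use R in simp)
  then have "(\<lambda>i. norm (mcoeff T (e i)) * rwt R (e i)) summable_on UNIV"
    by (subst summable_on_reindex_bij_betw[OF e, where f = "\<lambda>\<alpha>. norm (mcoeff T \<alpha>) * rwt R \<alpha>"])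
  then have sM: "summable M"
    unfolding M_def by (intro summable_divide summable_on_UNIV_nonneg_real_iff[THEN iffD1])
       (use R in \<open>auto simp: rwt_def\<close>)
  have M0: "0 \<le> M i" for i using R by (simp add: M_def rwt_def)
  have t'_le: "norm (t' i x h) \<le> M i * norm h" if "x \<in> ?S" for i x h
  proof -
    have "norm (t' i x h) \<le> norm (mcoeff T (e i)) * (rwt R (e i) / R * norm h)"
      unfolding t'_def norm_mult
      by (intro mult_left_mono norm_vmon_deriv_le R) (use that in \<open>auto simp: polydisc_def less_imp_le\<close>)
    then show ?thesis by (simp add: M_def)
  qed
  have sMh: "summable (\<lambda>i. M i * norm h)" for h :: "complex ^ 'd"
    by (rule summable_mult2[OF sM])
  have st': "summable (\<lambda>i. t' i x h)" if "x \<in> ?S" for x h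
    by (rule summable_comparison_test'[OF sMh[of h]]) (rule t'_le[OF that])
  have sums_t: "(\<lambda>i. t i x) sums meval T x" if "x \<in> ?S" for x
  proof -
    have "((\<lambda>\<alpha>. mcoeff T \<alpha> * vmon x \<alpha>) has_sum meval T x) UNIV"
    proof (rule has_sum_meval[OF _ T])
      show "norm (x $ j) \<le> R" for j
        using that R by (auto simp: polydisc_def dest!: spec[of _ j])
    qed (use R in simp)
    then have "((\<lambda>i. t i x) has_sum meval T x) UNIV"
      unfolding t_def
      by (subst has_sum_reindex_bij_betw[OF e, where f = "\<lambda>\<alpha>. mcoeff T \<alpha> * vmon x \<alpha>"])
    then show ?thesis by (rule has_sum_imp_sums)
  qed
  have unif: "\<forall>\<^sub>F n in sequentially. \<forall>x\<in>?S. \<forall>h. norm ((\<Sum>i<n. t' i x h) - g' x h) \<le> \<epsilon> * norm h"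
    if \<epsilon>: "0 < \<epsilon>" for \<epsilon>
  proof -
    obtain N where N: "\<And>n. n \<ge> N \<Longrightarrow> norm (\<Sum>i. M (i + n)) < \<epsilon>"
      using suminf_exist_split[OF \<epsilon> sM] by blast
    have "norm ((\<Sum>i<n. t' i x h) - g' x h) \<le> \<epsilon> * norm h" if "n \<ge> N" "x \<in> ?S" for n x h
    proof -
      have "norm ((\<Sum>i<n. t' i x h) - g' x h) = norm (\<Sum>i. t' (i + n) x h)"
        unfolding g'_def suminf_minus_initial_segment[OF st'[OF that(2)]] by (rule norm_minus_commute)
      also have "\<dots> \<le> (\<Sum>i. M (i + n) * norm h)"
        by (intro norm_suminf_le t'_le that summable_ignore_initial_segment[OF sMh])
      also have "\<dots> = (\<Sum>i. M (i + n)) * norm h"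
        by (intro suminf_mult2[symmetric] summable_ignore_initial_segment sM)
      also have "\<dots> \<le> \<epsilon> * norm h"
        using N[OF that(1)] by (intro mult_right_mono) auto
      finally show ?thesis .
    qed
    then show ?thesis unfolding eventually_sequentially by blast
  qed
  have dt: "(t i has_derivative t' i x) (at x within ?S)" for i x
    unfolding t_def t'_def by (rule has_derivative_mult_right[OF has_derivative_vmon])
  have S0: "0 \<in> ?S" using R by (simp add: polydisc_def)
  obtain g where g: "\<And>x. x \<in> ?S \<Longrightarrow> (\<lambda>i. t i x) sums g x \<and> (g has_derivative g' x) (at x within ?S)"
    using has_derivative_series[OF convex_polydisc dt unif S0 sums_t[OF S0]] by blast
  show ?thesis unfolding mholomorphic_on_def
  proof (intro ballI exI conjI allI)
    fix x assume x: "x \<in> ?S"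
    have "(g has_derivative g' x) (at x)"
      using g[OF x] at_within_open[OF x open_polydisc] by simp
    then show "(meval T has_derivative g' x) (at x)"
      by (rule has_derivative_transform_within_open[OF _ open_polydisc x])
         (use g sums_t sums_unique2 in blast)
    show "g' x (c *s v) = c * g' x v" for c v
      unfolding g'_def using suminf_mult[OF st'[OF x], of c v] 
      by (simp add: t'_def vmon_deriv_cmult ac_simps)
  qed
qed

section \<open>Uniqueness of Taylor expansions\<close>

lemma powser_zero_coeff:
  fixes b :: "nat \<Rightarrow> complex"
  assumes s: "0 < s" and z: "\<And>x. norm x < s \<Longrightarrow> (\<lambda>n. b n * x ^ n) sums 0"
  shows "b n = 0"
proof (induction n rule: less_induct)
  case (less n)
  have "(\<lambda>k. b (k + n) * x ^ k) sums 0" if "x \<noteq> 0" "norm x < s" for x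
  proof -
    have "(\<lambda>k. b (k + n) * x ^ (k + n)) sums 0"
      using z[OF that(2)] less by (subst sums_iff_shift) simp
    then have "(\<lambda>k. inverse (x ^ n) * (b (k + n) * x ^ (k + n))) sums (inverse (x ^ n) * 0)"
      by (rule sums_mult)
    then show ?thesis using that(1) by (simp add: power_add field_simps)
  qed
  then have "((\<lambda>_. 0 :: complex) \<longlongrightarrow> b (0 + n)) (at (0 :: complex))"
    by (intro powser_limit_0_strong[OF s, of "\<lambda>k. b (k + n)" "\<lambda>_. 0"]) auto
  then show ?case by (simp add: tendsto_const_iff)
qed

lemma has_sum_fibres:
  fixes t :: "('d \<Rightarrow> nat) \<Rightarrow> complex"
  assumes sum: "(t has_sum L) A" and fib: "\<And>n. (t has_sum b n) {\<alpha> \<in> A. \<alpha> j = n}"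
  shows "(b has_sum L) UNIV"
proof (rule has_sum_SigmaD[where f = "t \<circ> snd" and B = "\<lambda>n. {\<alpha> \<in> A. \<alpha> j = n}"])
  have "bij_betw snd (Sigma UNIV (\<lambda>n. {\<alpha> \<in> A. \<alpha> j = n})) A"
    by (rule bij_betwI[where g = "\<lambda>\<alpha>. (\<alpha> j, \<alpha>)"]) auto
  then show "(t \<circ> snd has_sum L) (Sigma UNIV (\<lambda>n. {\<alpha> \<in> A. \<alpha> j = n}))"
    using sum by (simp add: has_sum_reindex_bij_betw o_def)
qed (use fib in simp)

text \<open>
  One variable is eliminated at a time. For a set \<open>S\<close> of variables, the claim is that fixing the
  exponents in \<open>S\<close> and summing over the others, with the variables in \<open>S\<close> dropped, still gives zero.
  Adding a variable to \<open>S\<close> is the uniqueness of coefficients of a power series in that variable.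
\<close>

lemma mfps_coeff_zero:
  fixes c :: "('d::finite \<Rightarrow> nat) \<Rightarrow> complex"
  assumes R: "0 < R" and zero: "\<And>x. (\<And>j. norm (x $ j) < R) \<Longrightarrow> ((\<lambda>\<alpha>. c \<alpha> * vmon x \<alpha>) has_sum 0) UNIV"
  shows "c \<beta> = 0"
proof -
  have "\<forall>x. (\<forall>j. norm (x $ j) < R) \<longrightarrow>
      ((\<lambda>\<alpha>. c \<alpha> * (\<Prod>i\<in>-S. x $ i ^ \<alpha> i)) has_sum 0) {\<alpha>. \<forall>i\<in>S. \<alpha> i = \<beta> i}" for S :: "'d set"
    using finite[of S]
  proof (induction S rule: finite_induct)
    case empty
    then show ?case using zero by (simp add: vmon_def)
  next
    case (insert j S)
    show ?case
    proof (intro allI impI)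
      fix x :: "complex ^ 'd" assume x: "\<forall>j. norm (x $ j) < R"
      define A where "A = {\<alpha>. \<forall>i\<in>S. \<alpha> i = \<beta> i}"
      define t where "t \<alpha> = c \<alpha> * (\<Prod>i\<in>-insert j S. x $ i ^ \<alpha> i)" for \<alpha>
      define X where "X z = (\<chi> i. if i = j then z else x $ i)" for z
      have Xt: "c \<alpha> * (\<Prod>i\<in>-S. X z $ i ^ \<alpha> i) = z ^ \<alpha> j * t \<alpha>" for z \<alpha>
      proof -
        have "- S = insert j (- insert j S)" using insert by auto
        moreover have "(\<Prod>i\<in>-insert j S. X z $ i ^ \<alpha> i) = (\<Prod>i\<in>-insert j S. x $ i ^ \<alpha> i)"
          by (rule prod.cong) (auto simp: X_def)
        ultimately show ?thesis by (simp add: t_def X_def)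
      qed
      have IH: "((\<lambda>\<alpha>. z ^ \<alpha> j * t \<alpha>) has_sum 0) A" if "norm z < R" for z
      proof -
        have "\<forall>i. norm (X z $ i) < R" using that x by (simp add: X_def)
        then show ?thesis using insert.IH unfolding Xt[symmetric] A_def by blast
      qed
      have summ: "t summable_on {\<alpha> \<in> A. \<alpha> j = n}" for n
      proof -
        have "(\<lambda>\<alpha>. of_real (R / 2) ^ \<alpha> j * t \<alpha>) summable_on {\<alpha> \<in> A. \<alpha> j = n}"
          by (rule summable_on_subset[OF has_sum_imp_summable[OF IH]]) (use R in auto)
        also have "?this \<longleftrightarrow> (\<lambda>\<alpha>. of_real (R / 2) ^ n * t \<alpha>) summable_on {\<alpha> \<in> A. \<alpha> j = n}"
          by (rule summable_on_cong) auto
        finally show ?thesis using R by (subst (asm) summable_on_cmult_right') auto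
      qed
      define b where "b n = infsum t {\<alpha> \<in> A. \<alpha> j = n}" for n
      have "(\<lambda>n. b n * z ^ n) sums 0" if "norm z < R" for z
      proof (rule has_sum_imp_sums, rule has_sum_fibres[OF IH[OF that]])
        fix n
        have "((\<lambda>\<alpha>. z ^ n * t \<alpha>) has_sum z ^ n * b n) {\<alpha> \<in> A. \<alpha> j = n}"
          unfolding b_def by (intro has_sum_cmult_right has_sum_infsum summ)
        also have "?this \<longleftrightarrow> ((\<lambda>\<alpha>. z ^ \<alpha> j * t \<alpha>) has_sum z ^ n * b n) {\<alpha> \<in> A. \<alpha> j = n}"
          by (rule has_sum_cong) auto
        finally show "((\<lambda>\<alpha>. z ^ \<alpha> j * t \<alpha>) has_sum b n * z ^ n) {\<alpha> \<in> A. \<alpha> j = n}"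
          by (simp add: mult.commute)
      qed
      then have "b (\<beta> j) = 0" by (rule powser_zero_coeff[OF R])
      then have "(t has_sum 0) {\<alpha> \<in> A. \<alpha> j = \<beta> j}"
        using has_sum_infsum[OF summ[of "\<beta> j"]] by (simp add: b_def)
      moreover have "{\<alpha> \<in> A. \<alpha> j = \<beta> j} = {\<alpha>. \<forall>i\<in>insert j S. \<alpha> i = \<beta> i}"
        by (auto simp: A_def)
      ultimately show "((\<lambda>\<alpha>. c \<alpha> * (\<Prod>i\<in>-insert j S. x $ i ^ \<alpha> i)) has_sum 0)
          {\<alpha>. \<forall>i\<in>insert j S. \<alpha> i = \<beta> i}"
        by (simp add: t_def[abs_def])
    qed
  qed
  from this[of UNIV, THEN spec, of 0] R have "(c has_sum 0) {\<alpha>. \<forall>i. \<alpha> i = \<beta> i}" by simp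
  moreover have "{\<alpha>. \<forall>i. \<alpha> i = \<beta> i} = {\<beta>}" by auto
  ultimately show ?thesis by (simp add: has_sum_finite_iff)
qed

lemma has_mfps_expansion_radius:
  assumes "has_mfps_expansion f T"
  obtains R where "0 < R"
    "\<And>x. (\<And>j. norm (x $ j) < R) \<Longrightarrow> ((\<lambda>\<alpha>. mcoeff T \<alpha> * vmon x \<alpha>) has_sum f x) UNIV"
proof -
  obtain r where r: "\<And>j. 0 < r j"
    and sm: "\<And>x. x \<in> polydisc r \<Longrightarrow> ((\<lambda>\<alpha>. mcoeff T \<alpha> * (\<Prod>j\<in>UNIV. x $ j ^ \<alpha> j)) has_sum f x) UNIV"
    using assms unfolding has_mfps_expansion_def by blast
  have "0 < Min (range r)" using r by (subst Min_gr_iff) auto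
  moreover have "x \<in> polydisc r" if "\<And>j. norm (x $ j) < Min (range r)" for x
    unfolding polydisc_def using that by (auto intro: less_le_trans)
  ultimately show thesis using that[of "Min (range r)"] sm unfolding vmon_def by blast
qed

lemma has_mfps_expansion_unique:
  assumes "has_mfps_expansion f T" "has_mfps_expansion f T'"
  shows "T = T'"
proof (rule mfps_eqI)
  fix \<beta>
  obtain R where R: "0 < R"
    "\<And>x. (\<And>j. norm (x $ j) < R) \<Longrightarrow> ((\<lambda>\<alpha>. mcoeff T \<alpha> * vmon x \<alpha>) has_sum f x) UNIV"
    using has_mfps_expansion_radius[OF assms(1)] by blast
  obtain R' where R': "0 < R'"
    "\<And>x. (\<And>j. norm (x $ j) < R') \<Longrightarrow> ((\<lambda>\<alpha>. mcoeff T' \<alpha> * vmon x \<alpha>) has_sum f x) UNIV"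
    using has_mfps_expansion_radius[OF assms(2)] by blast
  have "mcoeff T \<beta> - mcoeff T' \<beta> = 0"
  proof (rule mfps_coeff_zero[where R = "min R R'" and c = "\<lambda>\<alpha>. mcoeff T \<alpha> - mcoeff T' \<alpha>"])
    show "((\<lambda>\<alpha>. (mcoeff T \<alpha> - mcoeff T' \<alpha>) * vmon x \<alpha>) has_sum 0) UNIV"
      if x: "\<And>j. norm (x $ j) < min R R'" for x
      using has_sum_add[OF R(2) has_sum_uminusI[OF R'(2)], of x x] x by (simp add: left_diff_distrib)
  qed (use R R' in auto)
  then show "mcoeff T \<beta> = mcoeff T' \<beta>" by simp
qed

text \<open>
  Restricting an expansion to a coordinate axis leaves a power series in one variable, whose first
  coefficients are the constant term and the entry of the Jacobian.
\<close>

lemma has_mfps_expansion_axis: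
  assumes "has_mfps_expansion f T"
  shows "mcoeff T 0 = f 0" "deriv (\<lambda>t. f (axis k t)) 0 = mcoeff T (munit k)"
proof -
  obtain R where R: "0 < R"
    "\<And>x. (\<And>j. norm (x $ j) < R) \<Longrightarrow> ((\<lambda>\<alpha>. mcoeff T \<alpha> * vmon x \<alpha>) has_sum f x) UNIV"
    using has_mfps_expansion_radius[OF assms(1)] by blast
  define u where "u n = (\<lambda>i. if i = k then n else (0::nat))" for n
  have u0: "u 0 = 0" by (simp add: u_def midx_eq)
  have u1: "u (Suc 0) = munit k" by (simp add: u_def munit_def fun_eq_iff)
  have vmon_u: "vmon (axis k t) (u n) = t ^ n" for n t
  proof -
    have "vmon (axis k t) (u n) = (\<Prod>i\<in>{k}. axis k t $ i ^ u n i)"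
      unfolding vmon_def by (rule prod.mono_neutral_right) (auto simp: u_def)
    then show ?thesis by (simp add: u_def)
  qed
  have sums: "(\<lambda>n. mcoeff T (u n) * t ^ n) sums f (axis k t)" if t: "norm t < R" for t
  proof -
    have "((\<lambda>\<alpha>. mcoeff T \<alpha> * vmon (axis k t) \<alpha>) has_sum f (axis k t)) UNIV"
      using R t by (intro R(2)) (simp add: axis_def)
    also have "?this \<longleftrightarrow> ((\<lambda>\<alpha>. mcoeff T \<alpha> * vmon (axis k t) \<alpha>) has_sum f (axis k t)) (range u)"
    proof (rule has_sum_cong_neutral)
      fix \<alpha> assume "\<alpha> \<in> UNIV - range u"
      then have "\<alpha> \<noteq> u (\<alpha> k)" by auto
      then obtain i where "i \<noteq> k" "\<alpha> i \<noteq> 0" by (auto simp: u_def fun_eq_iff split: if_splits)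
      then have "vmon (axis k t) \<alpha> = 0"
        unfolding vmon_def by (intro prod_zero) (auto simp: axis_def intro!: bexI[of _ i])
      then show "mcoeff T \<alpha> * vmon (axis k t) \<alpha> = 0" by simp
    qed auto
    also have "\<dots> \<longleftrightarrow> ((\<lambda>n. mcoeff T (u n) * t ^ n) has_sum f (axis k t)) UNIV"
      by (subst has_sum_reindex) (auto simp: inj_def u_def fun_eq_iff o_def vmon_u[unfolded u_def] split: if_splits)
    finally show ?thesis by (rule has_sum_imp_sums)
  qed
  have "(\<lambda>n. mcoeff T (u n) * 0 ^ n) sums f (axis k 0)" using R by (intro sums) simp
  moreover have "axis k (0::complex) = 0" by (simp add: axis_def vec_eq_iff)
  ultimately show "mcoeff T 0 = f 0" by (simp add: u0)
  have "((\<lambda>t. \<Sum>n. mcoeff T (u n) * t ^ n) has_field_derivative (\<Sum>n. diffs (\<lambda>n. mcoeff T (u n)) n * 0 ^ n)) (at 0)"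
    by (rule termdiffs_strong'[where K = R]) (use R sums sums_summable in auto)
  then have "((\<lambda>t. \<Sum>n. mcoeff T (u n) * t ^ n) has_field_derivative mcoeff T (munit k)) (at 0)"
    by (simp add: diffs_def u1)
  then have "((\<lambda>t. f (axis k t)) has_field_derivative mcoeff T (munit k)) (at 0)"
    by (rule has_field_derivative_transform_within_open[where S = "ball 0 R"])
       (use R sums sums_unique in \<open>auto simp: sums_iff\<close>)
  then show "deriv (\<lambda>t. f (axis k t)) 0 = mcoeff T (munit k)" by (rule DERIV_imp_deriv)
qed

section \<open>Taylor expansion of holomorphic functions\<close>

definition vupd :: "complex ^ 'k \<Rightarrow> 'k \<Rightarrow> complex \<Rightarrow> complex ^ 'k::finite" where
  "vupd x j z = (\<chi> i. if i = j then z else x $ i)"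

text \<open>
  Holomorphic in each variable separately. The expansion below needs only this together with
  boundedness, and both properties are inherited by the difference quotients \<open>slope j f\<close>.
\<close>

definition sep_hol :: "real \<Rightarrow> (complex ^ 'k::finite \<Rightarrow> complex) \<Rightarrow> bool" where
  "sep_hol R f \<longleftrightarrow> (\<forall>j. \<forall>x\<in>polydisc (\<lambda>_. R). (\<lambda>z. f (vupd x j z)) holomorphic_on ball 0 R)"

definition slope :: "'k \<Rightarrow> (complex ^ 'k::finite \<Rightarrow> complex) \<Rightarrow> complex ^ 'k \<Rightarrow> complex" where
  "slope j f x = (if x $ j = 0 then deriv (\<lambda>z. f (vupd x j z)) 0 else (f x - f (vupd x j 0)) / x $ j)"

lemma vupd_nth [simp]: "vupd x j z $ i = (if i = j then z else x $ i)"
  by (simp add: vupd_def)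

lemma vupd_same [simp]: "vupd (vupd x j z) j w = vupd x j w"
  by (simp add: vupd_def vec_eq_iff)

lemma vupd_commute: "i \<noteq> j \<Longrightarrow> vupd (vupd x i z) j w = vupd (vupd x j w) i z"
  by (simp add: vupd_def vec_eq_iff)

lemma vupd_triv: "x $ j = z \<Longrightarrow> vupd x j z = x"
  by (auto simp: vupd_def vec_eq_iff)

lemma vupd_polydisc: "x \<in> polydisc (\<lambda>_. R) \<Longrightarrow> norm z < R \<Longrightarrow> vupd x j z \<in> polydisc (\<lambda>_. R)"
  by (simp add: polydisc_def)

text \<open>
  The Schwarz lemma for \<open>g - g(0)\<close>, which is bounded by \<open>2 M\<close>. The constant \<open>3 M\<close> makes the bound
  strict, as the Schwarz lemma requires; a larger constant only costs a smaller radius of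
  convergence.
\<close>

lemma schwarz_slope:
  fixes g :: "complex \<Rightarrow> complex"
  assumes R: "0 < R" and M: "0 < M" and hol: "g holomorphic_on ball 0 R"
    and bd: "\<And>z. norm z < R \<Longrightarrow> norm (g z) \<le> M"
  defines "q \<equiv> \<lambda>z. if z = 0 then deriv g 0 else (g z - g 0) / z"
  shows "q holomorphic_on ball 0 R" and "norm z < R \<Longrightarrow> norm (g z - g 0) \<le> 3 * M / R * norm z"
    and "norm z < R \<Longrightarrow> norm (q z) \<le> 3 * M / R"
proof -
  show "q holomorphic_on ball 0 R"
    using pole_lemma[OF hol, of 0] R by (simp add: q_def cong: if_cong)
  define h where "h w = (g (of_real R * w) - g 0) / (3 * M)" for w
  have Rw: "norm (of_real R * w) < R" if "norm w < 1" for w :: complex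
    using that R by (simp add: norm_mult)
  have holh: "h holomorphic_on ball 0 1"
    unfolding h_def
  proof (intro holomorphic_intros)
    show "(\<lambda>w. g (of_real R * w)) holomorphic_on ball 0 1"
      by (rule holomorphic_on_compose_gen[OF _ hol, unfolded o_def])
         (use Rw in \<open>auto intro!: holomorphic_intros\<close>)
  qed (use M in auto)
  have no: "norm (h w) < 1" if "norm w < 1" for w
  proof -
    have "norm (g (of_real R * w) - g 0) \<le> M + M"
      by (rule order_trans[OF norm_triangle_ineq4]) (intro add_mono bd Rw that, use R in auto)
    then have "norm (g (of_real R * w) - g 0) < 3 * M" using M by simp
    then show ?thesis using M by (simp add: h_def norm_divide)
  qed
  have h0: "h 0 = 0" by (simp add: h_def)
  show "norm (g z - g 0) \<le> 3 * M / R * norm z" if z: "norm z < R" for z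
  proof -
    have w: "norm (z / of_real R) < 1" using z R by (simp add: norm_divide)
    have "norm (h (z / of_real R)) \<le> norm (z / of_real R)"
      by (rule Schwarz_Lemma(1)[OF holh h0 no w])
    then show ?thesis using R M by (simp add: h_def norm_divide field_simps)
  qed
  note le = this
  show "norm (q z) \<le> 3 * M / R" if z: "norm z < R" for z
  proof (cases "z = 0")
    case True
    have "(g has_field_derivative deriv g 0) (at (of_real R * 0))"
      using holomorphic_derivI[OF hol open_ball, of 0] R by simp
    then have "((\<lambda>w. g (of_real R * w)) has_field_derivative deriv g 0 * of_real R) (at 0)"
      by (rule DERIV_chain2) (auto intro!: derivative_eq_intros)
    then have "(h has_field_derivative (deriv g 0 * of_real R) / (3 * M)) (at 0)"
      unfolding h_def using M by (auto intro!: derivative_eq_intros)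
    then have "deriv h 0 = deriv g 0 * of_real R / (3 * M)" by (rule DERIV_imp_deriv)
    moreover have "norm (deriv h 0) \<le> 1"
      by (rule Schwarz_Lemma(2)[OF holh h0 no, of 0]) auto
    ultimately have "norm (deriv g 0) * R / (3 * M) \<le> 1"
      using R M by (simp add: norm_mult norm_divide)
    then show ?thesis using R M True by (simp add: q_def field_simps)
  next
    case False
    then show ?thesis using le[OF z] by (simp add: q_def norm_divide field_simps)
  qed
qed

lemma slope_eq: "f x = f (vupd x j 0) + x $ j * slope j f x"
  by (cases "x $ j = 0") (simp_all add: slope_def vupd_triv)

text \<open>
  In the variable \<open>j\<close> itself, and in the other variables as long as \<open>x\<^sub>j \<noteq> 0\<close>, the quotient is
  visibly holomorphic. At \<open>x\<^sub>j = 0\<close> it is a limit of the functions with \<open>x\<^sub>j = h\<close> for \<open>h \<rightarrow> 0\<close>, and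
  the convergence is uniform by the Schwarz lemma applied once more, to the quotient.
\<close>

lemma
  fixes f :: "complex ^ 'k::finite \<Rightarrow> complex"
  assumes R: "0 < R" and M: "0 < M" and f: "sep_hol R f"
    and bd: "\<And>x. x \<in> polydisc (\<lambda>_. R) \<Longrightarrow> norm (f x) \<le> M"
  shows norm_slope_le: "\<And>x. x \<in> polydisc (\<lambda>_. R) \<Longrightarrow> norm (slope j f x) \<le> 3 * M / R"
    and sep_hol_slope: "sep_hol R (slope j f)"
proof -
  define q where "q x z = slope j f (vupd x j z)" for x z
  have q: "q x = (\<lambda>z. if z = 0 then deriv (\<lambda>z. f (vupd x j z)) 0
      else (f (vupd x j z) - f (vupd x j 0)) / z)" for x
    by (simp add: q_def slope_def fun_eq_iff)
  have g: "(\<lambda>z. f (vupd x j z)) holomorphic_on ball 0 R"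
    "\<And>z. norm z < R \<Longrightarrow> norm (f (vupd x j z)) \<le> M" if "x \<in> polydisc (\<lambda>_. R)" for x
    using f that bd by (auto simp: sep_hol_def vupd_polydisc)
  have holq: "q x holomorphic_on ball 0 R" if "x \<in> polydisc (\<lambda>_. R)" for x
    unfolding q using schwarz_slope(1)[OF R M g[OF that]] by simp
  have bdq: "norm (q x z) \<le> 3 * M / R" if "x \<in> polydisc (\<lambda>_. R)" "norm z < R" for x z
    unfolding q using schwarz_slope(3)[OF R M g[OF that(1)] that(2)] by simp
  show "norm (slope j f x) \<le> 3 * M / R" if x: "x \<in> polydisc (\<lambda>_. R)" for x
  proof -
    have "norm (x $ j) < R" using x by (simp add: polydisc_def)
    from bdq[OF x this] show ?thesis by (simp add: q_def vupd_triv)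
  qed
  have other: "(\<lambda>z. slope j f (vupd x i z)) holomorphic_on ball 0 R"
    if x: "x \<in> polydisc (\<lambda>_. R)" and "i \<noteq> j" "x $ j \<noteq> 0" for x i
  proof -
    have eq: "slope j f (vupd x i z) = (f (vupd x i z) - f (vupd (vupd x j 0) i z)) / x $ j" for z
      using that vupd_commute[of i j x z 0] by (simp add: slope_def)
    have "vupd x j 0 \<in> polydisc (\<lambda>_. R)" using x R by (simp add: vupd_polydisc)
    then show ?thesis unfolding eq using f that by (intro holomorphic_intros) (auto simp: sep_hol_def)
  qed
  show "sep_hol R (slope j f)"
    unfolding sep_hol_def
  proof (intro allI ballI)
    fix i and x :: "complex ^ 'k" assume x: "x \<in> polydisc (\<lambda>_. R)"
    consider "i = j" | "i \<noteq> j" "x $ j \<noteq> 0" | "i \<noteq> j" "x $ j = 0" by blast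
    then show "(\<lambda>z. slope j f (vupd x i z)) holomorphic_on ball 0 R"
    proof cases
      case 1
      then show ?thesis using holq[OF x] by (simp add: q_def[abs_def])
    next
      case 2
      then show ?thesis using other x by blast
    next
      case 3
      define h where "h n = R / real (n + 2)" for n
      have "R * 1 < R * real (n + 2)" for n using R by (intro mult_strict_left_mono) auto
      then have h: "0 < h n" "h n < R" for n using R by (auto simp: h_def divide_less_eq)
      have "h \<longlonglongrightarrow> 0"
        unfolding h_def by (rule real_tendsto_divide_at_top[OF tendsto_const])
          (intro filterlim_at_top_add_at_top filterlim_compose[OF filterlim_real_sequentially] filterlim_add_const_nat_at_top)
      then have lim: "(\<lambda>n. 3 * (3 * M / R) / R * h n) \<longlonglongrightarrow> 0"
        by (rule tendsto_mult_right_zero)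
      define \<phi> where "\<phi> n z = slope j f (vupd (vupd x j (of_real (h n))) i z)" for n z
      have hol: "\<phi> n holomorphic_on ball 0 R" for n
        unfolding \<phi>_def using 3 h[of n] x by (intro other vupd_polydisc) auto
      have close: "norm (\<phi> n z - slope j f (vupd x i z)) \<le> 3 * (3 * M / R) / R * h n"
        if z: "norm z < R" for n z
      proof -
        have x': "vupd x i z \<in> polydisc (\<lambda>_. R)" using x z by (rule vupd_polydisc)
        have "\<phi> n z = q (vupd x i z) (of_real (h n))"
          using 3 by (simp add: \<phi>_def q_def vupd_commute)
        moreover have "slope j f (vupd x i z) = q (vupd x i z) 0"
          using 3 by (simp add: q_def vupd_triv)
        moreover have "norm (q (vupd x i z) (of_real (h n)) - q (vupd x i z) 0) \<le>
            3 * (3 * M / R) / R * norm (of_real (h n) :: complex)"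
          using M R h[of n] by (intro schwarz_slope(2)[OF R _ holq[OF x'] bdq[OF x']]) auto
        ultimately show ?thesis using h[of n] by simp
      qed
      show ?thesis
      proof (rule holomorphic_uniform_sequence[OF open_ball hol])
        fix z :: complex assume "z \<in> ball 0 R"
        then obtain d where d: "0 < d" "cball z d \<subseteq> ball 0 R"
          using open_contains_cball[of "ball (0::complex) R"] open_ball by blast
        have "uniform_limit (cball z d) \<phi> (\<lambda>z. slope j f (vupd x i z)) sequentially"
        proof (rule uniform_limitI)
          fix e :: real assume "0 < e"
          then have "\<forall>\<^sub>F n in sequentially. 3 * (3 * M / R) / R * h n < e"
            using lim by (rule order_tendstoD(2)[rotated])
          then show "\<forall>\<^sub>F n in sequentially. \<forall>w\<in>cball z d. dist (\<phi> n w) (slope j f (vupd x i w)) < e"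
          proof eventually_elim
            case (elim n)
            show ?case
            proof
              fix w assume "w \<in> cball z d"
              then have "norm w < R" using d(2) by auto
              from le_less_trans[OF close[OF this] elim]
              show "dist (\<phi> n w) (slope j f (vupd x i w)) < e" by (simp add: dist_norm)
            qed
          qed
        qed
        then show "\<exists>d>0. cball z d \<subseteq> ball 0 R \<and>
            uniform_limit (cball z d) \<phi> (\<lambda>z. slope j f (vupd x i z)) sequentially"
          using d by blast
      qed
    qed
  qed
qed

lemma slope_iterate:
  fixes f :: "complex ^ 'k::finite \<Rightarrow> complex"
  assumes R: "0 < R" and M: "0 < M" and f: "sep_hol R f"
    and bd: "\<And>x. x \<in> polydisc (\<lambda>_. R) \<Longrightarrow> norm (f x) \<le> M"
  shows "sep_hol R ((slope j ^^ n) f) \<and>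
    (\<forall>x\<in>polydisc (\<lambda>_. R). norm ((slope j ^^ n) f x) \<le> M * (3 / R) ^ n)"
proof (induction n)
  case (Suc n)
  have "0 < M * (3 / R) ^ n" using R M by simp
  from norm_slope_le[OF R this, of "(slope j ^^ n) f" _ j]
    sep_hol_slope[OF R this, of "(slope j ^^ n) f" j] Suc
  show ?case by (simp add: mult_ac)
qed (use f bd in auto)

text \<open>
  Taylor's formula in the variable \<open>j\<close>, with the iterated difference quotients as coefficients and
  remainder.
\<close>

lemma slope_expansion:
  "f x = (\<Sum>k<n. x $ j ^ k * (slope j ^^ k) f (vupd x j 0)) + x $ j ^ n * (slope j ^^ n) f x"
proof (induction n)
  case (Suc n)
  have "(slope j ^^ n) f x = (slope j ^^ n) f (vupd x j 0) + x $ j * (slope j ^^ Suc n) f x"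
    using slope_eq[of "(slope j ^^ n) f" x j] by simp
  with Suc show ?case by (simp add: algebra_simps)
qed simp

lemma summable_geometric_midx:
  fixes q :: "'k::finite \<Rightarrow> real"
  assumes q: "\<And>j. 0 \<le> q j" "\<And>j. q j < 1"
  shows "(\<lambda>\<alpha>. \<Prod>j\<in>UNIV. q j ^ \<alpha> j) summable_on UNIV"
proof (rule nonneg_bounded_partial_sums_imp_summable_on[where C = "\<Prod>j\<in>UNIV. 1 / (1 - q j)"])
  have "(\<Sum>\<alpha>\<in>A. \<Prod>j\<in>UNIV. q j ^ \<alpha> j) \<le> (\<Prod>j\<in>UNIV. 1 / (1 - q j))" if A: "finite A" for A
  proof -
    define N where "N = Max (insert 0 ((\<lambda>(\<alpha>, j). \<alpha> j) ` (A \<times> UNIV)))"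
    have N: "\<alpha> j \<le> N" if "\<alpha> \<in> A" for \<alpha> j
      unfolding N_def using A that by (intro Max_ge) (auto intro!: image_eqI[of _ _ "(\<alpha>, j)"])
    have "(\<Sum>\<alpha>\<in>A. \<Prod>j\<in>UNIV. q j ^ \<alpha> j) \<le> (\<Sum>\<alpha>\<in>PiE UNIV (\<lambda>_. {..N}). \<Prod>j\<in>UNIV. q j ^ \<alpha> j)"
      using N q by (intro sum_mono2 finite_PiE prod_nonneg) (auto simp: PiE_def extensional_def)
    also have "\<dots> = (\<Prod>j\<in>UNIV. \<Sum>n\<le>N. q j ^ n)"
      by (subst prod_sum_PiE) auto
    also have "\<dots> \<le> (\<Prod>j\<in>UNIV. 1 / (1 - q j))"
    proof (rule prod_mono, rule conjI)
      fix j
      show "0 \<le> (\<Sum>n\<le>N. q j ^ n)" using q by (intro sum_nonneg) auto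
      have "(\<Sum>n\<le>N. q j ^ n) \<le> (\<Sum>n. q j ^ n)"
        using q by (intro sum_le_suminf summable_geometric) auto
      then show "(\<Sum>n\<le>N. q j ^ n) \<le> 1 / (1 - q j)"
        using q by (simp add: suminf_geometric)
    qed
    finally show ?thesis .
  qed
  then show "\<forall>\<^sub>F A in finite_subsets_at_top UNIV. (\<Sum>\<alpha>\<in>A. \<Prod>j\<in>UNIV. q j ^ \<alpha> j) \<le> (\<Prod>j\<in>UNIV. 1 / (1 - q j))"
    by (intro eventually_finite_subsets_at_top_weakI)
qed (use q in \<open>auto intro!: prod_nonneg\<close>)

lemma summable_cauchy_bound:
  assumes R: "0 < R" and c: "\<And>\<alpha>. norm (c \<alpha>) \<le> M * rwt (3 / R) \<alpha>" and x: "\<And>j. norm (x $ j) < R / 3"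
  shows "(\<lambda>\<alpha>. c \<alpha> * vmon x \<alpha>) summable_on UNIV"
proof -
  have "(\<lambda>\<alpha>. M * (\<Prod>j\<in>UNIV. (3 / R * norm (x $ j)) ^ \<alpha> j)) summable_on UNIV"
    by (intro summable_on_cmult_right summable_geometric_midx) (use R x in \<open>auto simp: field_simps\<close>)
  moreover have "norm (c \<alpha> * vmon x \<alpha>) \<le> M * (\<Prod>j\<in>UNIV. (3 / R * norm (x $ j)) ^ \<alpha> j)" for \<alpha>
  proof -
    have "norm (c \<alpha> * vmon x \<alpha>) \<le> M * rwt (3 / R) \<alpha> * norm (vmon x \<alpha>)"
      unfolding norm_mult by (intro mult_right_mono c) auto
    then show ?thesis
      unfolding rwt_conv_prod vmon_def prod_norm[symmetric] norm_power power_mult_distrib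
        prod.distrib mult.assoc .
  qed
  ultimately have "(\<lambda>\<alpha>. norm (c \<alpha> * vmon x \<alpha>)) summable_on UNIV"
    by (rule Infinite_Sum.abs_summable_on_comparison_test')
  then show ?thesis by (rule abs_summable_summable)
qed

text \<open>
  Induction on a set \<open>S\<close> of variables, with the expansion claimed at the points whose coordinates
  outside \<open>S\<close> vanish. For a new variable \<open>j\<close>, the function is a power series in \<open>x\<^sub>j\<close> with coefficients \<open>(slope j)\<^sup>n f\<close> at \<open>x\<^sub>j = 0\<close>; the induction
  hypothesis, used with the bound \<open>M (3/R)\<^sup>n\<close>, expands these coefficients in the variables \<open>S\<close>.
  The estimates on the coefficients justify rearranging the double series.
\<close>

lemma sep_hol_power_series:
  fixes f :: "complex ^ 'k::finite \<Rightarrow> complex"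
  assumes R: "0 < R" and M: "0 < M" and f: "sep_hol R f"
    and bd: "\<And>x. x \<in> polydisc (\<lambda>_. R) \<Longrightarrow> norm (f x) \<le> M"
    and S: "finite S"
  shows "\<exists>c. (\<forall>\<alpha>. norm (c \<alpha>) \<le> M * rwt (3 / R) \<alpha>) \<and> (\<forall>\<alpha>. (\<exists>i. i \<notin> S \<and> \<alpha> i \<noteq> 0) \<longrightarrow> c \<alpha> = 0) \<and>
    (\<forall>x. (\<forall>j. norm (x $ j) < R / 3) \<longrightarrow> (\<forall>i. i \<notin> S \<longrightarrow> x $ i = 0) \<longrightarrow>
       ((\<lambda>\<alpha>. c \<alpha> * vmon x \<alpha>) has_sum f x) UNIV)"
  using S M f bd
proof (induction S arbitrary: f M rule: finite_induct)
  case empty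
  define c where "c \<alpha> = (if \<alpha> = 0 then f 0 else 0)" for \<alpha> :: "'k \<Rightarrow> nat"
  have "norm (c \<alpha>) \<le> M * rwt (3 / R) \<alpha>" for \<alpha>
    using empty R by (auto simp: c_def rwt_def polydisc_def)
  moreover have "((\<lambda>\<alpha>. c \<alpha> * vmon x \<alpha>) has_sum f x) UNIV" if "\<forall>i. x $ i = 0" for x
  proof (rule has_sum_finite_neutralI[where B = "{0}"])
    have "x = 0" using that by (simp add: vec_eq_iff)
    then show "f x = (\<Sum>\<alpha>\<in>{0}. c \<alpha> * vmon x \<alpha>)" by (simp add: c_def vmon_def zero_fun_apply)
  qed (auto simp: c_def)
  ultimately show ?case by (intro exI[of _ c]) (auto simp: c_def zero_fun_apply)
next
  case (insert j S)
  note it = slope_iterate[OF R insert.prems]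
  have Mn: "0 < M * (3 / R) ^ n" for n using insert.prems R by simp
  have "\<forall>n. \<exists>c. (\<forall>\<alpha>. norm (c \<alpha>) \<le> M * (3 / R) ^ n * rwt (3 / R) \<alpha>) \<and>
      (\<forall>\<alpha>. (\<exists>i. i \<notin> S \<and> \<alpha> i \<noteq> 0) \<longrightarrow> c \<alpha> = 0) \<and>
      (\<forall>x. (\<forall>j. norm (x $ j) < R / 3) \<longrightarrow> (\<forall>i. i \<notin> S \<longrightarrow> x $ i = 0) \<longrightarrow>
        ((\<lambda>\<alpha>. c \<alpha> * vmon x \<alpha>) has_sum (slope j ^^ n) f x) UNIV)"
  proof
    fix n
    show "\<exists>c. (\<forall>\<alpha>. norm (c \<alpha>) \<le> M * (3 / R) ^ n * rwt (3 / R) \<alpha>) \<and>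
      (\<forall>\<alpha>. (\<exists>i. i \<notin> S \<and> \<alpha> i \<noteq> 0) \<longrightarrow> c \<alpha> = 0) \<and>
      (\<forall>x. (\<forall>j. norm (x $ j) < R / 3) \<longrightarrow> (\<forall>i. i \<notin> S \<longrightarrow> x $ i = 0) \<longrightarrow>
        ((\<lambda>\<alpha>. c \<alpha> * vmon x \<alpha>) has_sum (slope j ^^ n) f x) UNIV)"
      using it[where j = j and n = n] by (intro insert.IH[OF Mn]) auto
  qed
  from choice[OF this] obtain c where c: "\<forall>n. (\<forall>\<alpha>. norm (c n \<alpha>) \<le> M * (3 / R) ^ n * rwt (3 / R) \<alpha>) \<and>
      (\<forall>\<alpha>. (\<exists>i. i \<notin> S \<and> \<alpha> i \<noteq> 0) \<longrightarrow> c n \<alpha> = 0) \<and>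
      (\<forall>x. (\<forall>j. norm (x $ j) < R / 3) \<longrightarrow> (\<forall>i. i \<notin> S \<longrightarrow> x $ i = 0) \<longrightarrow>
        ((\<lambda>\<alpha>. c n \<alpha> * vmon x \<alpha>) has_sum (slope j ^^ n) f x) UNIV)" ..
  have c_le: "norm (c n \<alpha>) \<le> M * (3 / R) ^ n * rwt (3 / R) \<alpha>" for n \<alpha>
    using c[THEN spec, of n] by simp
  have c_0: "c n \<alpha> = 0" if "i \<notin> S" "\<alpha> i \<noteq> 0" for n \<alpha> i
    using c[THEN spec, of n] that by blast
  have c_sum: "((\<lambda>\<alpha>. c n \<alpha> * vmon x \<alpha>) has_sum (slope j ^^ n) f x) UNIV"
    if "\<And>j. norm (x $ j) < R / 3" "\<And>i. i \<notin> S \<Longrightarrow> x $ i = 0" for n x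
    using c[THEN spec, of n] that by simp
  define C where "C \<alpha> = c (\<alpha> j) (\<alpha>(j := 0))" for \<alpha>
  have C_le: "norm (C \<alpha>) \<le> M * rwt (3 / R) \<alpha>" for \<alpha>
  proof -
    have "mdeg \<alpha> = \<alpha> j + mdeg (\<alpha>(j := 0))"
      unfolding mdeg_conv_sum by (simp add: sum.remove[of UNIV j])
    then show ?thesis
      using c_le[of "\<alpha> j" "\<alpha>(j := 0)"] by (simp add: C_def rwt_def power_add mult.assoc)
  qed
  moreover have "C \<alpha> = 0" if "i \<notin> insert j S" "\<alpha> i \<noteq> 0" for \<alpha> i
    unfolding C_def by (rule c_0[of i]) (use that in auto)
  moreover have "((\<lambda>\<alpha>. C \<alpha> * vmon x \<alpha>) has_sum f x) UNIV"
    if x: "\<And>j. norm (x $ j) < R / 3" "\<And>i. i \<notin> insert j S \<Longrightarrow> x $ i = 0" for x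
  proof -
    define y where "y = vupd x j 0"
    define F where "F n = (slope j ^^ n) f y" for n
    have y: "((\<lambda>\<alpha>. c n \<alpha> * vmon y \<alpha>) has_sum F n) UNIV" for n
      unfolding F_def by (rule c_sum) (use x R in \<open>auto simp: y_def\<close>)
    have fib: "((\<lambda>\<alpha>. C \<alpha> * vmon x \<alpha>) has_sum x $ j ^ n * F n) {\<alpha> \<in> UNIV. \<alpha> j = n}" for n
    proof -
      have "((\<lambda>\<alpha>. c n \<alpha> * vmon y \<alpha>) has_sum F n) {\<alpha>. \<alpha> j = 0}"
        by (rule has_sum_cong_neutral[THEN iffD1, OF _ _ _ y[of n]]) (use c_0 insert.hyps in auto)
      then have "((\<lambda>\<alpha>. x $ j ^ n * (c n \<alpha> * vmon y \<alpha>)) has_sum x $ j ^ n * F n) {\<alpha>. \<alpha> j = 0}"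
        by (rule has_sum_cmult_right)
      also have "?this \<longleftrightarrow> ?thesis"
      proof (rule has_sum_reindex_bij_witness[where i = "\<lambda>\<alpha>. \<alpha>(j := 0)" and j = "\<lambda>\<alpha>. \<alpha>(j := n)"])
        fix \<alpha> :: "'k \<Rightarrow> nat" assume \<alpha>: "\<alpha> \<in> {\<alpha>. \<alpha> j = 0}"
        then have upd: "\<alpha>(j := 0) = \<alpha>" by auto
        have "vmon x (\<alpha>(j := n)) = x $ j ^ n * vmon y \<alpha>"
        proof -
          have "vmon x (\<alpha>(j := n)) = x $ j ^ n * (\<Prod>i\<in>UNIV - {j}. x $ i ^ \<alpha> i)"
            unfolding vmon_def by (subst prod.remove[of _ j]) (auto intro!: prod.cong)
          moreover have "vmon y \<alpha> = (\<Prod>i\<in>UNIV - {j}. x $ i ^ \<alpha> i)"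
            unfolding vmon_def by (subst prod.remove[of _ j]) (use \<alpha> in \<open>auto simp: y_def intro!: prod.cong\<close>)
          ultimately show ?thesis by simp
        qed
        then show "C (\<alpha>(j := n)) * vmon x (\<alpha>(j := n)) = x $ j ^ n * (c n \<alpha> * vmon y \<alpha>)"
          by (simp add: C_def upd)
      qed auto
      finally show ?thesis .
    qed
    have "((\<lambda>\<alpha>. C \<alpha> * vmon x \<alpha>) has_sum infsum (\<lambda>\<alpha>. C \<alpha> * vmon x \<alpha>) UNIV) UNIV"
      by (intro has_sum_infsum summable_cauchy_bound[OF R C_le] x)
    moreover from has_sum_fibres[OF this fib]
    have "(\<lambda>n. x $ j ^ n * F n) sums infsum (\<lambda>\<alpha>. C \<alpha> * vmon x \<alpha>) UNIV"
      by (rule has_sum_imp_sums)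
    moreover have "(\<lambda>n. x $ j ^ n * F n) sums f x"
    proof -
      have xR: "x \<in> polydisc (\<lambda>_. R)"
      proof -
        have "R / 3 < R" using R by simp
        then have "norm (x $ i) < R" for i using x(1)[of i] by (rule less_trans[rotated])
        then show ?thesis by (simp add: polydisc_def)
      qed
      define q where "q = 3 / R * norm (x $ j)"
      have q: "0 \<le> q" "q < 1" using x(1)[of j] R by (auto simp: q_def field_simps)
      have rem_le: "norm (x $ j ^ n * (slope j ^^ n) f x) \<le> M * q ^ n" for n
      proof -
        have "norm (x $ j ^ n * (slope j ^^ n) f x) \<le> norm (x $ j) ^ n * (M * (3 / R) ^ n)"
          unfolding norm_mult norm_power using it[where j = j and n = n] xR by (intro mult_left_mono) auto
        then show ?thesis unfolding q_def power_mult_distrib by (simp only: mult_ac)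
      qed
      have "(\<lambda>n. M * q ^ n) \<longlonglongrightarrow> 0"
        using q by (intro tendsto_mult_right_zero LIMSEQ_power_zero) auto
      then have "(\<lambda>n. x $ j ^ n * (slope j ^^ n) f x) \<longlonglongrightarrow> 0"
        by (rule Lim_null_comparison[rotated]) (simp add: rem_le)
      then have "(\<lambda>n. f x - x $ j ^ n * (slope j ^^ n) f x) \<longlonglongrightarrow> f x - 0"
        by (intro tendsto_diff tendsto_const)
      moreover have "f x - x $ j ^ n * (slope j ^^ n) f x = (\<Sum>k<n. x $ j ^ k * F k)" for n
        using slope_expansion[of f x j n] by (simp add: F_def y_def)
      ultimately show ?thesis unfolding sums_def by simp
    qed
    ultimately show ?thesis by (metis sums_unique2)
  qed
  ultimately show ?case by (intro exI[of _ C]) blast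
qed

theorem mholomorphic_has_mfps_expansion:
  fixes f :: "complex ^ 'k::finite \<Rightarrow> complex"
  assumes U: "open U" "0 \<in> U" and f: "mholomorphic_on f U"
  obtains T where "has_mfps_expansion f T"
proof -
  obtain e where e: "0 < e" "cball 0 e \<subseteq> U"
    using U open_contains_cball by blast
  define R where "R = e / real CARD('k)"
  have R: "0 < R" using e by (simp add: R_def)
  have sub: "polydisc (\<lambda>_. R) \<subseteq> cball (0 :: complex ^ 'k) e"
  proof
    fix x :: "complex ^ 'k" assume "x \<in> polydisc (\<lambda>_. R)"
    then have "(\<Sum>i\<in>UNIV. norm (x $ i)) \<le> (\<Sum>i\<in>(UNIV :: 'k set). R)"
      by (intro sum_mono) (auto simp: polydisc_def less_imp_le)
    then have "norm x \<le> e"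
      unfolding norm_vec_def using L2_set_le_sum[of UNIV "\<lambda>i. norm (x $ i)"] by (simp add: R_def)
    then show "x \<in> cball 0 e" by simp
  qed
  have cont: "continuous_on (cball 0 e) f"
    using f e(2) unfolding mholomorphic_on_def
    by (intro continuous_at_imp_continuous_on) (auto dest!: has_derivative_continuous)
  have "bounded (f ` cball 0 e)"
    by (intro compact_imp_bounded compact_continuous_image cont compact_cball)
  then obtain M where M: "0 < M" "\<And>x. x \<in> cball 0 e \<Longrightarrow> norm (f x) \<le> M"
    unfolding bounded_pos by auto
  have sep: "sep_hol R f"
    unfolding sep_hol_def
  proof (intro allI ballI)
    fix j and x :: "complex ^ 'k" assume x: "x \<in> polydisc (\<lambda>_. R)"
    show "(\<lambda>z. f (vupd x j z)) holomorphic_on ball 0 R"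
      unfolding holomorphic_on_def
    proof
      fix z :: complex assume "z \<in> ball 0 R"
      then have "vupd x j z \<in> U" using vupd_polydisc[OF x] sub e(2) by auto
      then obtain D where D: "(f has_derivative D) (at (vupd x j z))" "\<And>c v. D (c *s v) = c * D v"
        using f unfolding mholomorphic_on_def by blast
      have upd: "vupd x j = (\<lambda>w. vupd x j 0 + w *s axis j 1)"
        by (auto simp: fun_eq_iff vec_eq_iff axis_def)
      have lin: "bounded_linear (\<lambda>w. w *s axis j 1 :: complex ^ 'k)"
        by (rule linear_conv_bounded_linear[THEN iffD1])
           (auto simp: linear_iff vec_eq_iff algebra_simps)
      have "((\<lambda>w. vupd x j 0 + w *s axis j 1) has_derivative (\<lambda>w. w *s axis j 1)) (at z)"
        using has_derivative_add[OF has_derivative_const bounded_linear_imp_has_derivative[OF lin]]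
        by simp
      then have "(vupd x j has_derivative (\<lambda>w. w *s axis j 1)) (at z)"
        by (subst upd)
      from has_derivative_compose[OF this D(1)]
      have "((\<lambda>z. f (vupd x j z)) has_derivative (\<lambda>w. w * D (axis j 1))) (at z)"
        by (simp add: D(2))
      then have "((\<lambda>z. f (vupd x j z)) has_field_derivative D (axis j 1)) (at z)"
        by (simp add: has_field_derivative_def mult.commute[of _ "D (axis j 1)"])
      then show "(\<lambda>z. f (vupd x j z)) field_differentiable at z within ball 0 R"
        unfolding field_differentiable_def using has_field_derivative_at_within by blast
    qed
  qed
  obtain c where c: "\<And>x. (\<And>j. norm (x $ j) < R / 3) \<Longrightarrow> ((\<lambda>\<alpha>. c \<alpha> * vmon x \<alpha>) has_sum f x) UNIV"
  proof -
    have bd: "norm (f x) \<le> M" if "x \<in> polydisc (\<lambda>_. R)" for x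
      using M(2) sub that by blast
    have fin: "finite (UNIV :: 'k set)" by simp
    have "\<exists>c. (\<forall>\<alpha>. norm (c \<alpha>) \<le> M * rwt (3 / R) \<alpha>) \<and> (\<forall>\<alpha>. (\<exists>i. i \<notin> UNIV \<and> \<alpha> i \<noteq> 0) \<longrightarrow> c \<alpha> = 0) \<and>
        (\<forall>x. (\<forall>j. norm (x $ j) < R / 3) \<longrightarrow> (\<forall>i. i \<notin> UNIV \<longrightarrow> x $ i = 0) \<longrightarrow>
          ((\<lambda>\<alpha>. c \<alpha> * vmon x \<alpha>) has_sum f x) UNIV)"
      by (rule sep_hol_power_series[OF R M(1) sep _ fin]) (rule bd)
    then show thesis using that by blast
  qed
  have "has_mfps_expansion f (Abs_mfps c)"
    unfolding has_mfps_expansion_def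
    by (rule exI[of _ "\<lambda>_. R / 3"]) (use R c in \<open>auto simp: polydisc_def Abs_mfps_inverse vmon_def\<close>)
  then show thesis by (rule that)
qed

section \<open>Existence, uniqueness and Gevrey estimates\<close>

lemma wbound_common_radius:
  assumes "finite I" "\<And>i. i \<in> I \<Longrightarrow> mfps_convergent (T i)"
  shows "\<exists>R>0. \<exists>B. \<forall>i\<in>I. wbound (rwt R) (T i) B"
  using assms
proof (induction I rule: finite_induct)
  case empty
  then show ?case by (auto intro: exI[of _ "1::real"])
next
  case (insert i I)
  then obtain R B where R: "0 < R" "\<And>i. i \<in> I \<Longrightarrow> wbound (rwt R) (T i) B" by auto
  obtain R' B' where R': "0 < R'" "wbound (rwt R') (T i) B'"
    using insert.prems wbound_of_mfps_convergent by blast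
  have "wbound (rwt (min R R')) (T k) (max B B')" if "k \<in> insert i I" for k
  proof (cases "k = i")
    case True
    then show ?thesis
      using wbound_le[OF wbound_rwt_mono[OF R'(2), of "min R R'"], of "max B B'"] R R' by auto
  next
    case False
    then show ?thesis
      using wbound_le[OF wbound_rwt_mono[OF R(2), of k "min R R'"], of "max B B'"] R R' that by auto
  qed
  then show ?case using R R' by (intro exI[of _ "min R R'"]) auto
qed

text \<open>
  The functions in the definition of a Gevrey series are the sums of the coefficients of \<open>t\<^sup>n\<close>, which
  are convergent series in \<open>x\<close>. Half of the radius is lost in
  \<open>wbound_tcoeff\<close>, and half of the rest in differentiating termwise.
\<close>

lemma P_gevrey_of_wbound:
  fixes P :: "'d::finite mfps"
  assumes "0 < \<rho>" "0 < \<tau>" "0 < s" and P0: "mcoeff P 0 = 0" and f: "wbound (gwt \<rho> \<tau>) f s"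
  shows "P_gevrey P 1 (msubst f (case_option P mvar))"
  unfolding P_gevrey_def
proof (intro exI conjI allI ballI)
  let ?T = "\<lambda>n. tcoeff n f"
  note T = wbound_tcoeff[OF assms(1,2) f]
  have \<rho>: "0 < \<rho> / 2" using assms by simp
  show "0 < (\<lambda>_::'d. \<rho> / 2 / 2) j" for j using assms by simp
  show "0 < s" "0 < 2 / \<tau>" using assms by auto
  show "has_mfps_expansion (meval (?T n)) (?T n)" for n
    by (rule has_mfps_expansion_meval[OF \<rho> T])
  have le: "norm (meval (?T n) x) \<le> fact n * (2 / \<tau>) ^ n * s" if "x \<in> polydisc (\<lambda>_. \<rho> / 2 / 2)" for n x
  proof (rule norm_meval_le[OF _ T])
    have "\<rho> / 2 / 2 \<le> \<rho> / 2" using \<rho> by simp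
    then show "norm (x $ j) \<le> \<rho> / 2" for j
      using that unfolding polydisc_def by (metis (mono_tags) less_imp_le mem_Collect_eq order_trans)
  qed (use \<rho> in simp)
  then show "norm (meval (?T n) x) \<le> s * (2 / \<tau>) ^ n * fact n powr 1" if "x \<in> polydisc (\<lambda>_. \<rho> / 2 / 2)" for n x
    using that by (simp add: mult_ac)
  show "meval (?T n) \<in> bounded_holomorphic (\<lambda>_. \<rho> / 2 / 2)" for n
    unfolding bounded_holomorphic_def bounded_iff using le mholomorphic_meval[OF \<rho> T] by blast
  show "formal_has_sum (\<lambda>n. ?T n * P ^ n) (msubst f (case_option P mvar))"
    by (rule formal_has_sum_tcoeff[OF P0])
qed

text \<open>
  Substituting \<open>t = P(x)\<close> in the solution of the equation in \<open>(t, x)\<close>.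
\<close>

theorem gevrey_solution_exists:
  fixes P :: "'d::finite mfps" and a :: "'d \<Rightarrow> 'd mfps" and G :: "'n::finite \<Rightarrow> ('d + 'n) mfps"
  assumes P0: "mcoeff P 0 = 0" and LP: "vfield a P = P * Q"
    and conv: "\<And>j. mfps_convergent (a j)" "mfps_convergent Q" "\<And>l. mfps_convergent (G l)"
    and G0: "\<And>l. mcoeff (G l) 0 = 0"
    and \<nu>: "\<And>i k. (\<Sum>l\<in>UNIV. mcoeff (G i) (munit (Inr l)) * \<nu> l k) = (if i = k then 1 else 0)"
  obtains y where "\<And>k. mcoeff (y k) 0 = 0"
    "\<And>l. msubst (G l) (case_sum mvar y) = P * vfield a (y l)"
    "\<And>k. P_gevrey P 1 (y k)"
proof -
  obtain R1 B1 where 1: "0 < R1" "\<And>j. wbound (rwt R1) (a j) B1"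
    using wbound_common_radius[of UNIV a] conv by auto
  obtain R2 B2 where 2: "0 < R2" "wbound (rwt R2) Q B2"
    using wbound_of_mfps_convergent[OF conv(2)] by blast
  obtain R3 B3 where 3: "0 < R3" "\<And>l. wbound (rwt R3) (G l) B3"
    using wbound_common_radius[of UNIV G] conv by auto
  define R where "R = min R1 (min R2 R3)"
  define M where "M = max B1 (max B2 B3)"
  have R: "0 < R" using 1 2 3 by (simp add: R_def)
  have M: "wbound (rwt R) (a j) M" "wbound (rwt R) Q M" "wbound (rwt R) (G l) M" for j l
    using R wbound_le[OF wbound_rwt_mono[OF 1(2)[of j], of R], of M]
      wbound_le[OF wbound_rwt_mono[OF 2(2), of R], of M]
      wbound_le[OF wbound_rwt_mono[OF 3(2)[of l], of R], of M]
    by (auto simp: R_def M_def)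
  obtain Y \<rho> \<tau> s where Y: "0 < \<rho>" "0 < \<tau>" "0 < s" "\<And>k. mcoeff (Y k) 0 = 0"
    "\<And>l. msubst (G l) (lifted_args Y) = lifted_op a Q (Y l)"
    "\<And>k. wbound (gwt \<rho> \<tau>) (Y k) s"
    by (rule lifted_solution_exists[where a = a and Q = Q, OF G0 \<nu> R M]) (rule that)
  let ?\<sigma> = "case_option P mvar"
  note \<sigma>0 = case_option_mvar_0[OF P0]
  define y where "y k = msubst (Y k) ?\<sigma>" for k
  have "(\<lambda>k. msubst (lifted_args Y k) ?\<sigma>) = case_sum mvar y"
    by (rule ext) (simp add: lifted_args_def y_def msubst_mvar[OF \<sigma>0] split: sum.split)
  then have "msubst (G l) (case_sum mvar y) = msubst (msubst (G l) (lifted_args Y)) ?\<sigma>" for l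
    by (subst msubst_msubst) (simp_all add: lifted_args_0 Y(4) \<sigma>0)
  then have "msubst (G l) (case_sum mvar y) = P * vfield a (y l)" for l
    by (simp add: Y(5) msubst_lifted_op[OF P0 LP] y_def)
  moreover have "mcoeff (y k) 0 = 0" for k by (simp add: y_def Y(4))
  moreover have "P_gevrey P 1 (y k)" for k
    unfolding y_def by (rule P_gevrey_of_wbound[OF Y(1-3) P0 Y(6)])
  ultimately show thesis using that by blast
qed

theorem theorem1p1:
  fixes P :: "'d::finite mfps"
    and a :: "'d \<Rightarrow> 'd mfps"
    and F :: "complex ^ ('d + 'n::finite) \<Rightarrow> complex ^ 'n"
    and U :: "(complex ^ ('d + 'n)) set"
  assumes "mfps_convergent P" and "P \<noteq> 0" and "mcoeff P 0 = 0"
    and "\<And>j. mfps_convergent (a j)" and "\<exists>j. a j \<noteq> 0"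
    and "open U" and "0 \<in> U" and "\<And>k. mholomorphic_on (\<lambda>z. F z $ k) U"
    and "F 0 = 0"
    and "invertible (\<chi> i k. deriv (\<lambda>t. F (axis (Inr k) t) $ i) 0)"
    and "\<exists>Q. mfps_convergent Q \<and> vfield a P = P * Q"
  shows "(\<exists>!y :: 'd mfps ^ 'n. (\<forall>k. mcoeff (y $ k) 0 = 0) \<and> formal_solution P a F y) \<and>
         (\<forall>y :: 'd mfps ^ 'n. (\<forall>k. mcoeff (y $ k) 0 = 0) \<and> formal_solution P a F y \<longrightarrow>
            (\<forall>k. P_gevrey P 1 (y $ k)))"
proof -
  obtain Q where Q: "mfps_convergent Q" "vfield a P = P * Q" using assms(11) by blast
  have "\<forall>k. \<exists>T. has_mfps_expansion (\<lambda>z. F z $ k) T"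
    using mholomorphic_has_mfps_expansion[OF assms(6,7,8)] by blast
  then obtain G where G: "\<And>k. has_mfps_expansion (\<lambda>z. F z $ k) (G k)" by metis
  define \<mu> where "\<mu> = (\<chi> i k. mcoeff (G i) (munit (Inr k)))"
  have "\<mu> = (\<chi> i k. deriv (\<lambda>t. F (axis (Inr k) t) $ i) 0)"
    by (simp add: \<mu>_def has_mfps_expansion_axis(2)[OF G])
  then obtain \<nu> where \<nu>: "\<mu> ** \<nu> = mat 1" "\<nu> ** \<mu> = mat 1"
    using assms(10) unfolding invertible_def by auto
  have \<mu>\<nu>: "(\<Sum>l\<in>UNIV. mcoeff (G i) (munit (Inr l)) * \<nu> $ l $ k) = (if i = k then 1 else 0)" for i k
    using \<nu>(1) by (simp add: \<mu>_def matrix_matrix_mult_def mat_def vec_eq_iff)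
  have \<nu>\<mu>: "(\<Sum>l\<in>UNIV. \<nu> $ i $ l * mcoeff (G l) (munit (Inr k))) = (if i = k then 1 else 0)" for i k
    using \<nu>(2) by (simp add: \<mu>_def matrix_matrix_mult_def mat_def vec_eq_iff)
  have G0: "mcoeff (G l) 0 = 0" for l
    using has_mfps_expansion_axis(1)[OF G] assms(9) by simp
  \<comment> \<open>Uniqueness of Taylor expansions fixes the series in the definition of a formal solution once and for all.\<close>
  have sol_iff: "formal_solution P a F y \<longleftrightarrow> (\<forall>k. msubst (G k) (case_sum mvar (($) y)) = P * vfield a (y $ k))"
    if y0: "\<forall>k. mcoeff (y $ k) 0 = 0" for y :: "'d mfps ^ 'n"
  proof -
    have "G' = G" if "\<forall>k. has_mfps_expansion (\<lambda>z. F z $ k) (G' k)" for G'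
      using that G has_mfps_expansion_unique by (intro ext) blast
    moreover have "formal_subst (G' k) y S \<longleftrightarrow> S = msubst (G' k) (case_sum mvar (($) y))" for G' k S
      using y0 by (intro formal_subst_iff) auto
    ultimately show ?thesis
      unfolding formal_solution_def using G by metis
  qed
  obtain y where y: "\<And>k. mcoeff (y k) 0 = 0"
    "\<And>l. msubst (G l) (case_sum mvar y) = P * vfield a (y l)" "\<And>k. P_gevrey P 1 (y k)"
    using gevrey_solution_exists[OF assms(3) Q(2) assms(4) Q(1) mfps_convergent_of_expansion[OF G] G0 \<mu>\<nu>]
    by blast
  define yv where "yv = (\<chi> k. y k)"
  have yv: "($) yv = y" by (simp add: yv_def fun_eq_iff)
  have ex: "(\<forall>k. mcoeff (yv $ k) 0 = 0) \<and> formal_solution P a F yv"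
    using y by (simp add: sol_iff yv)
  have uniq: "y' = yv" if "(\<forall>k. mcoeff (y' $ k) 0 = 0) \<and> formal_solution P a F y'" for y'
  proof -
    have "($) y' = ($) yv"
      by (rule formal_solution_unique[OF assms(3) Q(2) \<nu>\<mu>])
         (use that ex sol_iff[of y'] sol_iff[of yv] in auto)
    then show ?thesis by (simp add: vec_eq_iff fun_eq_iff)
  qed
  have "P_gevrey P 1 (yv $ k)" for k using y(3) yv by simp
  then show ?thesis using ex uniq by blast
qed

end
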